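(* Let $u\in L^\infty(\mathbb{R}^d)$, let $b\in BV_{loc}(\mathbb{R}^d;\mathbb{R}^d)$ with $\operatorname{div}b\in L^1_{loc}(\mathbb{R}^d)$, and let $\theta\in C_c^\infty(\mathbb{R}^d)$ be a smooth even nonnegative convolution kernel with $\operatorname{supp}\theta\subset B_1$. For $\varepsilon>0$ let $$r_\varepsilon:=b\cdot\nabla(u\ast\theta_\varepsilon)-(b\cdot\nabla u)\ast\theta_\varepsilon .$$ Then there exist an even convolution kernel $\rho$ with $\operatorname{supp}\rho\subset B_1$ and a constant $C_\theta$ depending only on $\theta$ (and $d$) such that, for every $\varepsilon>0$ and every measurable $\varphi:\mathbb{R}^d\to\mathbb{R}$, $$\int_{\mathbb{R}^d}|r_\varepsilon\varphi|\,dx\le C_\theta\,\|u\|_{L^\infty((\operatorname{supp}\varphi)_\varepsilon)}\int_{\mathbb{R}^d}(|\varphi|\ast\rho_\varepsilon)\,d|Db|,$$ where $(\operatorname{supp}\varphi)_\varepsilon=\{x\in\mathbb{R}^d:\operatorname{dist}(x,\operatorname{supp}\varphi)\le\varepsilon\}$. Consequently, for a.e. $x\in\mathbb{R}^d$, $$|r_\varepsilon|(x)\le C_\theta\,\|u\|_{L^\infty(B(x,\varepsilon))}\,(|Db|\ast\rho_\varepsilon)(x).$$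
   Context: A convolution kernel on $\mathbb{R}^d$ is a nonnegative integrable function with integral $1$; even means $\theta(-x)=\theta(x)$. For a kernel $\theta$ and $\varepsilon>0$, $\theta_\varepsilon(x)=\varepsilon^{-d}\theta(x/\varepsilon)$ (likewise $\rho_\varepsilon$). $B_1$ is the unit ball of $\mathbb{R}^d$ centred at the origin and $B(x,\varepsilon)$ the ball of centre $x$ and radius $\varepsilon$ (balls may be taken closed). $|Db|$ is the total variation measure of the matrix-valued Radon measure $Db$ (distributional derivative of $b$), and $(|Db|\ast\rho_\varepsilon)(x)=\int\rho_\varepsilon(x-y)\,d|Db|(y)$. The distribution $b\cdot\nabla u$ is defined by $b\cdot\nabla u=\operatorname{div}(bu)-u\operatorname{div}b$, so that $$\big((b\cdot\nabla u)\ast\theta_\varepsilon\big)(x)=-\int u(y)\big[\theta_\varepsilon(x-y)\operatorname{div}b(y)+b(y)\cdot\nabla_y(\theta_\varepsilon(x-y))\big]dy .$$ Integrals of nonnegative functions take values in $[0,\infty]$, with the convention $0\cdot\infty=0$. *)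

theory Defs
  imports "HOL-Analysis.Analysis" "HOL-Probability.Essential_Supremum"
begin

section \<open>Smooth functions, supports, kernels\<close>

primrec C_k :: "nat \<Rightarrow> ('a::real_normed_vector \<Rightarrow> real) \<Rightarrow> bool" where
  "C_k 0 f \<longleftrightarrow> continuous_on UNIV f"
| "C_k (Suc k) f \<longleftrightarrow>
     (\<forall>x. f differentiable (at x)) \<and> (\<forall>v. C_k k (\<lambda>x. frechet_derivative f (at x) v))"

definition smooth :: "('a::real_normed_vector \<Rightarrow> real) \<Rightarrow> bool" where
  "smooth f \<longleftrightarrow> (\<forall>k. C_k k f)"

definition supp :: "('a::topological_space \<Rightarrow> real) \<Rightarrow> 'a set" where
  "supp f = closure {x. f x \<noteq> 0}"

definition test_fun :: "('a::real_normed_vector \<Rightarrow> real) \<Rightarrow> bool" where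
  "test_fun f \<longleftrightarrow> smooth f \<and> compact (supp f)"

definition partial :: "'n \<Rightarrow> (real^'n \<Rightarrow> real) \<Rightarrow> real^'n \<Rightarrow> real" where
  "partial j f x = frechet_derivative f (at x) (axis j 1)"

definition grad :: "(real^'n \<Rightarrow> real) \<Rightarrow> real^'n \<Rightarrow> real^'n" where
  "grad f x = (\<chi> j. partial j f x)"

text \<open>Kernels are Borel functions (not just Lebesgue measurable ones), so that they can be
  integrated against an arbitrary Borel measure.\<close>

definition conv_kernel :: "(real^'n \<Rightarrow> real) \<Rightarrow> bool" where
  "conv_kernel k \<longleftrightarrow> (\<forall>x. 0 \<le> k x) \<and> integrable lborel k \<and> integral\<^sup>L lborel k = 1"

definition even_fun :: "(real^'n \<Rightarrow> real) \<Rightarrow> bool" where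
  "even_fun f \<longleftrightarrow> (\<forall>x. f (- x) = f x)"

definition rescale :: "(real^'n \<Rightarrow> real) \<Rightarrow> real \<Rightarrow> real^'n \<Rightarrow> real" where
  "rescale k \<epsilon> x = k (x /\<^sub>R \<epsilon>) / \<epsilon> ^ CARD('n)"

section \<open>Function spaces\<close>

text \<open>The norm is \<open>0\<close> on a null set, in particular on the empty set.\<close>

definition Linf_norm :: "(real^'n \<Rightarrow> real) \<Rightarrow> (real^'n) set \<Rightarrow> ennreal" where
  "Linf_norm u A = esssup (restrict_space lebesgue A) (\<lambda>x. ennreal \<bar>u x\<bar>)"

definition Linf :: "(real^'n \<Rightarrow> real) \<Rightarrow> bool" where
  "Linf u \<longleftrightarrow> u \<in> borel_measurable lebesgue \<and> Linf_norm u UNIV < \<infinity>"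

definition L1_loc :: "(real^'n \<Rightarrow> 'b::euclidean_space) \<Rightarrow> bool" where
  "L1_loc f \<longleftrightarrow> (\<forall>K. compact K \<longrightarrow> f absolutely_integrable_on K)"

text \<open>\<open>infdist\<close> to the empty set is \<open>0\<close>, whereas the mathematical distance is infinite.\<close>

definition closed_nbhd :: "'a::metric_space set \<Rightarrow> real \<Rightarrow> 'a set" where
  "closed_nbhd A \<epsilon> = {x. A \<noteq> {} \<and> infdist x A \<le> \<epsilon>}"

section \<open>Vector-valued Radon measures\<close>

text \<open>A vector-valued Radon measure is a set function that is countably additive on the bounded
  Borel sets; its values on other sets are irrelevant. The total variation is the supremum over
  countable Borel partitions, with the Euclidean norm on the values (for matrices in
  \<open>real^'n^'n\<close> this is the Frobenius norm).\<close>

definition variation :: "('a::euclidean_space set \<Rightarrow> 'b::euclidean_space) \<Rightarrow> 'a set \<Rightarrow> ennreal" where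
  "variation \<nu> A =
     (SUP P \<in> {P :: nat \<Rightarrow> 'a set. disjoint_family P \<and> (\<forall>n. P n \<in> sets borel \<and> bounded (P n)) \<and>
                 (\<Union>n. P n) = A}.
        \<Sum>n. ennreal (norm (\<nu> (P n))))"

definition variation_measure :: "('a::euclidean_space set \<Rightarrow> 'b::euclidean_space) \<Rightarrow> 'a measure" where
  "variation_measure \<nu> = measure_of UNIV (sets borel) (variation \<nu>)"

definition vector_radon_measure :: "('a::euclidean_space set \<Rightarrow> 'b::euclidean_space) \<Rightarrow> bool" where
  "vector_radon_measure \<nu> \<longleftrightarrow>
     (\<forall>A :: nat \<Rightarrow> 'a set. disjoint_family A \<and> (\<forall>n. A n \<in> sets borel) \<and> bounded (\<Union>n. A n) \<longrightarrow>
        (\<lambda>n. \<nu> (A n)) sums \<nu> (\<Union>n. A n)) \<and>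
     (\<forall>K. compact K \<longrightarrow> variation \<nu> K < \<infinity>)"

text \<open>Integration against a real-valued Radon measure \<open>m\<close> uses its Jordan decomposition into the
  positive variation \<open>m\<^sup>+(A) = sup {m(B) | B \<subseteq> A}\<close> and the negative variation \<open>(-m)\<^sup>+\<close>. The value
  \<open>m {} = 0\<close> makes the truncation of negative numbers by \<open>ennreal\<close> harmless.\<close>

definition pos_variation_measure :: "('a::euclidean_space set \<Rightarrow> real) \<Rightarrow> 'a measure" where
  "pos_variation_measure m =
     measure_of UNIV (sets borel)
       (\<lambda>A. SUP B \<in> {B. B \<in> sets borel \<and> bounded B \<and> B \<subseteq> A}. ennreal (m B))"

definition signed_integral :: "('a::euclidean_space set \<Rightarrow> real) \<Rightarrow> ('a \<Rightarrow> real) \<Rightarrow> real" where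
  "signed_integral m f =
     integral\<^sup>L (pos_variation_measure m) f - integral\<^sup>L (pos_variation_measure (\<lambda>A. - m A)) f"

section \<open>Functions of locally bounded variation\<close>

text \<open>The entry \<open>D A $ i $ j\<close> is the value on \<open>A\<close> of the \<open>j\<close>-th derivative of the \<open>i\<close>-th component.\<close>

definition distr_derivative ::
  "(real^'n \<Rightarrow> real^'n) \<Rightarrow> ((real^'n) set \<Rightarrow> real^'n^'n) \<Rightarrow> bool" where
  "distr_derivative b D \<longleftrightarrow>
     vector_radon_measure D \<and>
     (\<forall>f i j. test_fun f \<longrightarrow>
        (LINT x|lebesgue. b x $ i * partial j f x) = - signed_integral (\<lambda>A. D A $ i $ j) f)"

definition BV_loc :: "(real^'n \<Rightarrow> real^'n) \<Rightarrow> bool" where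
  "BV_loc b \<longleftrightarrow> L1_loc b \<and> (\<exists>D. distr_derivative b D)"

definition distr_div :: "(real^'n \<Rightarrow> real^'n) \<Rightarrow> (real^'n \<Rightarrow> real) \<Rightarrow> bool" where
  "distr_div b g \<longleftrightarrow>
     (\<forall>f. test_fun f \<longrightarrow> (LINT x|lebesgue. b x \<bullet> grad f x) = - (LINT x|lebesgue. g x * f x))"

section \<open>The commutator\<close>

definition conv :: "(real^'n \<Rightarrow> real) \<Rightarrow> (real^'n \<Rightarrow> real) \<Rightarrow> real^'n \<Rightarrow> real" where
  "conv f k x = (LINT y|lebesgue. f y * k (x - y))"

text \<open>The distribution \<open>b \<cdot> \<nabla>u = div (b u) - u div b\<close>, where \<open>g\<close> is the function \<open>div b\<close>.\<close>

definition advection ::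
  "(real^'n \<Rightarrow> real^'n) \<Rightarrow> (real^'n \<Rightarrow> real) \<Rightarrow> (real^'n \<Rightarrow> real) \<Rightarrow> (real^'n \<Rightarrow> real) \<Rightarrow> real" where
  "advection b g u f = - (LINT y|lebesgue. u y * (f y * g y + b y \<bullet> grad f y))"

definition distr_conv ::
  "((real^'n \<Rightarrow> real) \<Rightarrow> real) \<Rightarrow> (real^'n \<Rightarrow> real) \<Rightarrow> real^'n \<Rightarrow> real" where
  "distr_conv T k x = T (\<lambda>y. k (x - y))"

definition commutator ::
  "(real^'n \<Rightarrow> real^'n) \<Rightarrow> (real^'n \<Rightarrow> real) \<Rightarrow> (real^'n \<Rightarrow> real) \<Rightarrow> (real^'n \<Rightarrow> real) \<Rightarrow>
     real \<Rightarrow> real^'n \<Rightarrow> real" where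
  "commutator b g u \<theta> \<epsilon> x =
     b x \<bullet> grad (conv u (rescale \<theta> \<epsilon>)) x - distr_conv (advection b g u) (rescale \<theta> \<epsilon>) x"

text \<open>Convolution of a nonnegative function with a kernel, and of a Borel measure with a kernel,
  as functions with values in \<open>[0, \<infinity>]\<close>.\<close>

definition nn_conv :: "(real^'n \<Rightarrow> real) \<Rightarrow> (real^'n \<Rightarrow> real) \<Rightarrow> real^'n \<Rightarrow> ennreal" where
  "nn_conv f k x = (\<integral>\<^sup>+ y. ennreal (f y * k (x - y)) \<partial>lebesgue)"

definition measure_conv :: "(real^'n) measure \<Rightarrow> (real^'n \<Rightarrow> real) \<Rightarrow> real^'n \<Rightarrow> ennreal" where
  "measure_conv \<mu> k x = (\<integral>\<^sup>+ y. ennreal (k (x - y)) \<partial>\<mu>)"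

end

theory Submission
  imports Defs
begin

text \<open>
  Writing \<open>\<theta>\<^sub>\<epsilon>\<close> for the rescaled kernel, the commutator at \<open>x\<close> is the integral of
  \<open>u(y) ((b(x) - b(y)) \<cdot> \<nabla>\<theta>\<^sub>\<epsilon>(x - y) + \<theta>\<^sub>\<epsilon>(x - y) div b(y))\<close>, so it suffices to bound the integral of
  \<open>|b(x) - b(y)| |\<nabla>\<theta>\<^sub>\<epsilon>(x - y)| + \<theta>\<^sub>\<epsilon>(x - y) |div b(y)|\<close> by a multiple of \<open>(|Db| * \<rho>\<^sub>\<epsilon>)(x)\<close>.
  For the mollification \<open>b * \<theta>\<^sub>\<delta>\<close> this follows from the fundamental theorem of calculus along the
  segment from \<open>x\<close> to \<open>y\<close> and from \<open>|D(b * \<theta>\<^sub>\<delta>)| \<le> |Db| * \<theta>\<^sub>\<delta>\<close>: averaging over all segments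
  produces the kernel \<open>\<rho>\<close>, and the bound is \<open>(|Db| * \<rho>\<^sub>\<epsilon>) * \<theta>\<^sub>\<delta>\<close>. As \<open>|Db| * \<rho>\<^sub>\<epsilon>\<close> is locally integrable,
  both sides converge almost everywhere along a sequence \<open>\<delta> \<rightarrow> 0\<close>, by Fatou's lemma on the left.
  The integral inequality is the pointwise one, integrated against \<open>|\<phi>|\<close> using Tonelli's theorem.
\<close>

section \<open>Total variation of a vector measure\<close>

text \<open>The limit cannot be taken in \<open>|Db| * \<theta>\<^sub>\<delta>\<close> itself: where
  \<open>Db\<close> is singular, these functions concentrate and lose mass in the pointwise limit.
  Exchanging the two convolutions saves the argument: with \<open>\<delta>\<close> acting last, the
  bound is a mollification of a function. This function
  \<open>|Db| * \<rho>\<^sub>\<epsilon>\<close> may be infinite on a null set, since in dimension d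
  the kernel grows like |w|^(1-d) at the origin (like - log |w| if d = 1); hence its real-valued
  version is mollified. The kernel has two equal shares of mass: the segments from x to x - z with
  |z| \<le> \<epsilon> give \<open>cone_density\<close>, and the divergence, as the trace of
  \<open>Db\<close>, gives the indicator of the ball. The gradient of
  \<open>\<theta>\<^sub>\<epsilon>\<close> costs a factor 1/\<epsilon>, which the length of the
  segment returns. So no \<epsilon> remains in the constant 2 V d^2 M, where V is the volume of the
  unit ball and M bounds both \<theta>(z) and |z| |grad \<theta>(z)|; one d counts the components of
  b, the other the partial derivatives of each.\<close>

lemma vector_radon_measure_empty:
  assumes "vector_radon_measure \<nu>"
  shows "\<nu> {} = 0"
proof -
  have "(\<lambda>n::nat. \<nu> {}) sums \<nu> (\<Union>n::nat. {})"
    using assms[unfolded vector_radon_measure_def, THEN conjunct1, rule_format, of "\<lambda>n. {}"]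
    by (simp add: disjoint_family_on_def)
  \<comment> \<open>A constant series converges only if its term is 0.\<close>
  then show ?thesis
    by (simp add: summable_const_iff sums_iff)
qed

text \<open>Ensures that the supremum in \<open>variation\<close> runs over a nonempty set, so that
  an increasing sequence of partition sums can approach it. The pieces are the shells between
  integer radii.\<close>

lemma bounded_partition_exists:
  fixes A :: "'a::euclidean_space set"
  assumes "A \<in> sets borel"
  shows "\<exists>P :: nat \<Rightarrow> 'a set. disjoint_family P \<and>
    (\<forall>n. P n \<in> sets borel \<and> bounded (P n)) \<and> (\<Union>n. P n) = A"
proof (intro exI conjI allI)
  let ?P = "disjointed (\<lambda>n. A \<inter> cball 0 (real n))"
  show "disjoint_family ?P" by (rule disjoint_family_disjointed)
  show "?P n \<in> sets borel" for n
  proof -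
    have "range ?P \<subseteq> sets borel"
      by (rule sets.range_disjointed_sets) (use assms in auto)
    then show ?thesis by auto
  qed
  show "bounded (?P n)" for n
    by (rule bounded_subset[OF _ disjointed_subset]) auto
  have "x \<in> (\<Union>n. A \<inter> cball 0 (real n))" if "x \<in> A" for x
    using that real_arch_simple[of "norm x"] by auto
  then show "(\<Union>n. ?P n) = A"
    unfolding UN_disjointed_eq by blast
qed

lemma variation_upper:
  assumes "disjoint_family P" "\<And>n. P n \<in> sets borel" "\<And>n. bounded (P n)" "(\<Union>n. P n) = A"
  shows "(\<Sum>n::nat. ennreal (norm (\<nu> (P n)))) \<le> variation \<nu> A"
  unfolding variation_def by (rule SUP_upper) (use assms in auto)

text \<open>Upper bound: cutting a partition of the union along the sets \<open>A i\<close> only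
  increases its sum, and the double series can be summed in either order. Lower bound: for each
  \<open>i\<close> take partitions whose sums increase to \<open>variation \<nu> (A i)\<close>; for
  fixed \<open>m\<close>, the m-th partitions of all the \<open>A i\<close> together partition the
  union. Monotone sequences replace the usual errors e / 2^i, so infinite values need no separate
  case.\<close>

lemma countably_additive_variation:
  fixes \<nu> :: "'a::euclidean_space set \<Rightarrow> 'b::euclidean_space"
  assumes \<nu>: "vector_radon_measure \<nu>"
  shows "countably_additive (sets borel) (variation \<nu>)"
  unfolding countably_additive_def
proof (intro allI impI antisym)
  fix A :: "nat \<Rightarrow> 'a set"
  assume rA: "range A \<subseteq> sets borel" and dA: "disjoint_family A" and "\<Union>(range A) \<in> sets borel"
  have A: "A i \<in> sets borel" for i using rA by auto
  have sums: "(\<lambda>n. \<nu> (B n)) sums \<nu> (\<Union>n. B n)"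
    if "disjoint_family B" "\<And>n. B n \<in> sets borel" "bounded (\<Union>n. B n)" for B
    using \<nu> that unfolding vector_radon_measure_def by blast
  show "variation \<nu> (\<Union>(range A)) \<le> (\<Sum>i. variation \<nu> (A i))"
    unfolding variation_def[of \<nu> "\<Union>(range A)"]
  proof (rule SUP_least, clarify)
    fix P :: "nat \<Rightarrow> 'a set"
    assume dP: "disjoint_family P" and P: "\<forall>n. P n \<in> sets borel \<and> bounded (P n)"
      and UP: "\<Union>(range P) = \<Union>(range A)"
    have "ennreal (norm (\<nu> (P n))) \<le> (\<Sum>i. ennreal (norm (\<nu> (P n \<inter> A i))))" for n
    proof -
      have U: "(\<Union>i. P n \<inter> A i) = P n" using UP by blast
      \<comment> \<open>\<open>P n\<close> is bounded, so \<open>\<nu>\<close> is countably additive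
        on its pieces; the triangle inequality for the partial sums then passes to the
        limit.\<close>
      have s: "(\<lambda>i. \<nu> (P n \<inter> A i)) sums \<nu> (P n)"
      proof (rule sums[of "\<lambda>i. P n \<inter> A i", unfolded U])
        show "disjoint_family (\<lambda>i. P n \<inter> A i)" using dA unfolding disjoint_family_on_def by blast
        show "P n \<inter> A i \<in> sets borel" for i using P A by auto
        show "bounded (P n)" using P by auto
      qed
      have lim: "(\<lambda>N. ennreal (norm (\<Sum>i<N. \<nu> (P n \<inter> A i)))) \<longlonglongrightarrow> ennreal (norm (\<nu> (P n)))"
        using s unfolding sums_def by (intro tendsto_ennrealI tendsto_norm)
      have "ennreal (norm (\<Sum>i<N. \<nu> (P n \<inter> A i))) \<le> (\<Sum>i. ennreal (norm (\<nu> (P n \<inter> A i))))" for N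
      proof -
        have "ennreal (norm (\<Sum>i<N. \<nu> (P n \<inter> A i))) \<le> ennreal (\<Sum>i<N. norm (\<nu> (P n \<inter> A i)))"
          by (intro ennreal_leI norm_sum)
        also have "\<dots> = (\<Sum>i<N. ennreal (norm (\<nu> (P n \<inter> A i))))" by (subst sum_ennreal) auto
        also have "\<dots> \<le> (\<Sum>i. ennreal (norm (\<nu> (P n \<inter> A i))))"
          by (rule sum_le_suminf) auto
        finally show ?thesis .
      qed
      then show ?thesis by (intro Lim_bounded[OF lim, of 0]) blast
    qed
    then have "(\<Sum>n. ennreal (norm (\<nu> (P n)))) \<le> (\<Sum>n. \<Sum>i. ennreal (norm (\<nu> (P n \<inter> A i))))"
      by (intro suminf_le) auto
    also have "\<dots> = (\<Sum>i. \<Sum>n. ennreal (norm (\<nu> (P n \<inter> A i))))"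
      by (subst (1 3) nn_integral_count_space_nat[symmetric]) (rule nn_integral_suminf, simp)
    also have "\<dots> \<le> (\<Sum>i. variation \<nu> (A i))"
    proof (intro suminf_le allI variation_upper)
      fix i n
      show "disjoint_family (\<lambda>n. P n \<inter> A i)" using dP by (auto simp: disjoint_family_on_def)
      show "P n \<inter> A i \<in> sets borel" using P A by auto
      show "bounded (P n \<inter> A i)" using P by (metis bounded_Int)
      show "(\<Union>n. P n \<inter> A i) = A i" using UP by blast
    qed auto
    finally show "(\<Sum>n. ennreal (norm (\<nu> (P n)))) \<le> (\<Sum>i. variation \<nu> (A i))" .
  qed
  define S where "S i = {P :: nat \<Rightarrow> 'a set. disjoint_family P \<and>
      (\<forall>n. P n \<in> sets borel \<and> bounded (P n)) \<and> (\<Union>n. P n) = A i}" for i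
  define F where "F P = (\<Sum>n. ennreal (norm (\<nu> (P n))))" for P :: "nat \<Rightarrow> 'a set"
  have vS: "variation \<nu> (A i) = Sup (F ` S i)" for i
    unfolding variation_def S_def F_def by simp
  have "\<forall>i. \<exists>f. incseq f \<and> range f \<subseteq> F ` S i \<and> Sup (F ` S i) = (SUP m. f m)"
  proof
    fix i
    have "S i \<noteq> {}" using bounded_partition_exists[OF A[of i]] unfolding S_def by auto
    then show "\<exists>f. incseq f \<and> range f \<subseteq> F ` S i \<and> Sup (F ` S i) = (SUP m. f m)"
      using ennreal_Sup_countable_SUP[of "F ` S i"] by auto
  qed
  then obtain f where f: "\<And>i. incseq (f i)" "\<And>i. range (f i) \<subseteq> F ` S i"
    "\<And>i. Sup (F ` S i) = (SUP m. f i m)" by metis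
  have "\<forall>i m. \<exists>P. P \<in> S i \<and> f i m = F P" using f(2) by blast
  then obtain Q where Q: "\<And>i m. Q i m \<in> S i" "\<And>i m. f i m = F (Q i m)" by metis
  have "(\<Sum>i. variation \<nu> (A i)) = (\<Sum>i. SUP m. f i m)" by (simp add: vS f(3))
  also have "\<dots> = (SUP m. \<Sum>i. f i m)"
    by (intro ennreal_suminf_SUP_eq f(1))
  also have "\<dots> \<le> variation \<nu> (\<Union>(range A))"
  proof (rule SUP_least)
    fix m
    \<comment> \<open>The pieces \<open>Q i m n\<close> form a double family, whereas
      \<open>variation\<close> admits partitions indexed by \<open>nat\<close>; hence the
      enumeration of pairs.\<close>
    define R where "R k = (case prod_decode k of (i, n) \<Rightarrow> Q i m n)" for k
    have QS: "disjoint_family (Q i m)" "Q i m n \<in> sets borel" "bounded (Q i m n)"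
      "(\<Union>n. Q i m n) = A i" for i n
      using Q(1)[of i m] unfolding S_def by auto
    have "(\<Sum>i. f i m) = (\<Sum>i. \<Sum>n. ennreal (norm (\<nu> (Q i m n))))"
      unfolding Q(2) F_def ..
    also have "\<dots> = (\<Sum>k. (\<lambda>(i, n). ennreal (norm (\<nu> (Q i m n)))) (prod_decode k))"
      by (rule suminf_ennreal_2dimen[symmetric, unfolded comp_def]) (rule suminf_cong, unfold prod.case, rule refl)
    also have "\<dots> = (\<Sum>k. ennreal (norm (\<nu> (R k))))"
      by (intro suminf_cong) (auto simp: R_def split: prod.split)
    also have "\<dots> \<le> variation \<nu> (\<Union>(range A))"
    proof (rule variation_upper)
      show "disjoint_family R"
        unfolding disjoint_family_on_def
      proof (intro ballI impI)
        fix k l :: nat assume "k \<noteq> l"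
        obtain i n j n' where kl: "prod_decode k = (i, n)" "prod_decode l = (j, n')" by force
        have ne: "(i, n) \<noteq> (j, n')"
          using \<open>k \<noteq> l\<close> kl by (metis prod_decode_inverse)
        show "R k \<inter> R l = {}"
        proof (cases "i = j")
          case True
          then show ?thesis using ne QS(1)[of i] kl
            by (auto simp: R_def disjoint_family_on_def)
        next
          case False
          then have "A i \<inter> A j = {}" using dA by (auto simp: disjoint_family_on_def)
          moreover have "Q i m n \<subseteq> A i" "Q j m n' \<subseteq> A j" using QS(4) by blast+
          moreover have "R k = Q i m n" "R l = Q j m n'" using kl by (auto simp: R_def)
          ultimately show ?thesis by blast
        qed
      qed
      show "R k \<in> sets borel" "bounded (R k)" for k
        using QS by (auto simp: R_def split: prod.split)
      have RU: "x \<in> (\<Union>k. R k)" if "x \<in> Q i m n" for x i n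
        using that by (intro UN_I[of "prod_encode (i, n)"]) (auto simp: R_def)
      have RA: "R k \<subseteq> (\<Union>i. A i)" for k
      proof -
        obtain i n where "prod_decode k = (i, n)" by force
        then have "R k = Q i m n" by (simp add: R_def)
        then show ?thesis using QS(4)[of i] by blast
      qed
      show "(\<Union>k. R k) = \<Union>(range A)"
      proof (intro equalityI subsetI)
        show "x \<in> \<Union>(range A)" if "x \<in> (\<Union>k. R k)" for x using that RA by blast
        fix x assume "x \<in> \<Union>(range A)"
        then obtain i where "x \<in> A i" by blast
        then obtain n where "x \<in> Q i m n" unfolding QS(4)[of i, symmetric] by blast
        then show "x \<in> (\<Union>k. R k)" by (rule RU)
      qed
    qed
    finally show "(\<Sum>i. f i m) \<le> variation \<nu> (\<Union>(range A))" .
  qed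
  finally show "(\<Sum>i. variation \<nu> (A i)) \<le> variation \<nu> (\<Union>(range A))" .
qed

lemma sets_variation_measure [simp, measurable_cong]:
  "sets (variation_measure \<nu>) = sets borel"
  unfolding variation_measure_def using sets.sigma_sets_eq[of borel] by (simp add: sets_measure_of_conv)

lemma space_variation_measure [simp]: "space (variation_measure \<nu>) = UNIV"
  unfolding variation_measure_def by (simp add: space_measure_of_conv)

text \<open>\<open>measure_of\<close> yields the zero measure for a set function that is not a
  measure, so countable additivity is what gives \<open>variation_measure\<close> its intended
  values.\<close>

lemma emeasure_variation_measure:
  fixes \<nu> :: "'a::euclidean_space set \<Rightarrow> 'b::euclidean_space"
  assumes \<nu>: "vector_radon_measure \<nu>" and A: "A \<in> sets borel"
  shows "emeasure (variation_measure \<nu>) A = variation \<nu> A"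
  unfolding variation_measure_def
proof (rule emeasure_measure_of_sigma)
  show "sigma_algebra UNIV (sets (borel :: 'a measure))"
    using sets.sigma_algebra_axioms[of borel] by simp
  have "variation \<nu> {} = 0"
    unfolding variation_def
  proof (rule antisym[OF SUP_least])
    fix P :: "nat \<Rightarrow> 'a set"
    assume "P \<in> {P. disjoint_family P \<and> (\<forall>n. P n \<in> sets borel \<and> bounded (P n)) \<and> \<Union> (range P) = {}}"
    then have "P n = {}" for n by auto
    then show "(\<Sum>n. ennreal (norm (\<nu> (P n)))) \<le> 0"
      by (simp add: vector_radon_measure_empty[OF \<nu>])
  qed auto
  then show "positive (sets borel) (variation \<nu>)" by (simp add: positive_def)
  show "countably_additive (sets borel) (variation \<nu>)" by (rule countably_additive_variation[OF \<nu>])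
qed (rule A)

lemma emeasure_variation_measure_compact:
  assumes "vector_radon_measure \<nu>" "compact K"
  shows "emeasure (variation_measure \<nu>) K < \<infinity>"
  using assms emeasure_variation_measure[OF assms(1), of K]
  unfolding vector_radon_measure_def by (simp add: compact_imp_closed borel_closed)

lemma sigma_finite_variation_measure:
  fixes \<nu> :: "'a::euclidean_space set \<Rightarrow> 'b::euclidean_space"
  assumes "vector_radon_measure \<nu>"
  shows "sigma_finite_measure (variation_measure \<nu>)"
proof
  let ?A = "range (\<lambda>n. cball (0::'a) (real n))"
  have "x \<in> \<Union>?A" for x :: 'a
    using real_arch_simple[of "norm x"] by auto
  then have "\<Union>?A = space (variation_measure \<nu>)" by auto
  moreover have "\<forall>a\<in>?A. emeasure (variation_measure \<nu>) a \<noteq> \<infinity>"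
    using emeasure_variation_measure_compact[OF assms] by (auto simp: less_top[symmetric])
  ultimately show "\<exists>A. countable A \<and> A \<subseteq> sets (variation_measure \<nu>) \<and>
    \<Union>A = space (variation_measure \<nu>) \<and> (\<forall>a\<in>A. emeasure (variation_measure \<nu>) a \<noteq> \<infinity>)"
    by (intro exI[of _ ?A]) auto
qed

section \<open>Integrals against signed measures, bounded by the total variation\<close>

lemma norm_le_variation:
  fixes \<nu> :: "'a::euclidean_space set \<Rightarrow> 'b::euclidean_space"
  assumes \<nu>: "vector_radon_measure \<nu>" and B: "B \<in> sets borel" "bounded B"
  shows "ennreal (norm (\<nu> B)) \<le> variation \<nu> B"
proof -
  let ?P = "\<lambda>n::nat. if n = 0 then B else {}"
  have "ennreal (norm (\<nu> B)) = (\<Sum>n<1. ennreal (norm (\<nu> (?P n))))" by simp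
  also have "\<dots> \<le> (\<Sum>n. ennreal (norm (\<nu> (?P n))))"
    by (rule sum_le_suminf) auto
  also have "\<dots> \<le> variation \<nu> B"
    by (rule variation_upper) (use B in \<open>auto simp: disjoint_family_on_def split: if_splits\<close>)
  finally show ?thesis .
qed

text \<open>If the set function defining \<open>pos_variation_measure\<close> were not a measure, the measure would
  be zero, so that no Jordan decomposition is needed for an upper bound.\<close>

lemma pos_variation_measure_le:
  fixes \<nu> :: "'a::euclidean_space set \<Rightarrow> 'b::euclidean_space"
  assumes \<nu>: "vector_radon_measure \<nu>" and m: "\<And>B. m B \<le> norm (\<nu> B)"
  shows "pos_variation_measure m \<le> variation_measure \<nu>"
proof -
  have s: "sets (pos_variation_measure m) = sets borel"
    unfolding pos_variation_measure_def using sets.sigma_sets_eq[of borel]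
    by (simp add: sets_measure_of_conv)
  have "emeasure (pos_variation_measure m) A \<le> emeasure (variation_measure \<nu>) A" for A
  proof (cases "A \<in> sets borel")
    case A: True
    have "emeasure (pos_variation_measure m) A \<le>
      (SUP B \<in> {B. B \<in> sets borel \<and> bounded B \<and> B \<subseteq> A}. ennreal (m B))"
      unfolding pos_variation_measure_def emeasure_measure_of_conv by auto
    also have "\<dots> \<le> emeasure (variation_measure \<nu>) A"
    proof (rule SUP_least, clarify)
      fix B assume B: "B \<in> sets borel" "bounded B" "B \<subseteq> A"
      have "ennreal (m B) \<le> ennreal (norm (\<nu> B))" by (intro ennreal_leI m)
      also have "\<dots> \<le> emeasure (variation_measure \<nu>) B"
        using norm_le_variation[OF \<nu> B(1,2)] emeasure_variation_measure[OF \<nu> B(1)] by simp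
      also have "\<dots> \<le> emeasure (variation_measure \<nu>) A"
        by (rule emeasure_mono) (use A B in auto)
      finally show "ennreal (m B) \<le> emeasure (variation_measure \<nu>) A" .
    qed
    finally show ?thesis .
  next
    case False
    then show ?thesis using s by (simp add: emeasure_notin_sets)
  qed
  then show ?thesis
    using s by (simp add: le_measure le_fun_def)
qed

text \<open>The integrals against both Jordan parts lie between 0 and the integral against the
  variation, hence so does the absolute value of their difference, without a factor 2. A part
  against which \<open>f\<close> is not integrable contributes the default value 0, which respects
  the bound.\<close>

lemma abs_signed_integral_le:
  fixes \<nu> :: "'a::euclidean_space set \<Rightarrow> 'b::euclidean_space"
  assumes \<nu>: "vector_radon_measure \<nu>" and m: "\<And>B. \<bar>m B\<bar> \<le> norm (\<nu> B)"
    and f: "f \<in> borel_measurable borel" "\<And>x. 0 \<le> f x"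
  shows "ennreal \<bar>signed_integral m f\<bar> \<le> (\<integral>\<^sup>+ x. ennreal (f x) \<partial>variation_measure \<nu>)"
proof -
  have *: "ennreal (integral\<^sup>L (pos_variation_measure k) f) \<le> (\<integral>\<^sup>+ x. ennreal (f x) \<partial>variation_measure \<nu>)"
    "0 \<le> integral\<^sup>L (pos_variation_measure k) f"
    if "\<And>B. k B \<le> norm (\<nu> B)" for k
  proof -
    have s: "sets (pos_variation_measure k) = sets borel"
      unfolding pos_variation_measure_def using sets.sigma_sets_eq[of borel]
      by (simp add: sets_measure_of_conv)
    have "ennreal (integral\<^sup>L (pos_variation_measure k) f) \<le> (\<integral>\<^sup>+ x. ennreal (f x) \<partial>pos_variation_measure k)"
      using f(2) measurable_cong_sets[OF s refl] f(1)
      by (subst integral_eq_nn_integral) (auto simp: ennreal_enn2real_if)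
    also have "\<dots> \<le> (\<integral>\<^sup>+ x. ennreal (f x) \<partial>variation_measure \<nu>)"
      using pos_variation_measure_le[OF \<nu>, of k] that s
      by (intro nn_integral_mono_measure) auto
    finally show "ennreal (integral\<^sup>L (pos_variation_measure k) f) \<le> (\<integral>\<^sup>+ x. ennreal (f x) \<partial>variation_measure \<nu>)" .
    show "0 \<le> integral\<^sup>L (pos_variation_measure k) f" using f(2) by simp
  qed
  have m1: "m B \<le> norm (\<nu> B)" "- m B \<le> norm (\<nu> B)" for B using m[of B] by auto
  have "\<bar>signed_integral m f\<bar> \<le> max (integral\<^sup>L (pos_variation_measure m) f)
      (integral\<^sup>L (pos_variation_measure (\<lambda>A. - m A)) f)"
    unfolding signed_integral_def using *(2)[OF m1(1)] *(2)[OF m1(2)] by auto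
  then show ?thesis
    using *(1)[OF m1(1)] *(1)[OF m1(2)] by (auto simp: max_def split: if_splits dest!: ennreal_leI)
qed

section \<open>Test functions and convolutions\<close>

text \<open>The prefactor \<open>a\<close> closes the induction: the derivative in direction
  \<open>v\<close> is again of this form, with \<open>a * c\<close> in place of \<open>a\<close> and
  the derivative of \<open>f\<close> in direction \<open>v\<close> in place of
  \<open>f\<close>.\<close>

lemma C_k_affine:
  assumes "C_k k f"
  shows "C_k k (\<lambda>y. a * f (c *\<^sub>R y + p))"
  using assms
proof (induction k arbitrary: f a)
  case 0
  then have "continuous_on UNIV f" by simp
  then have "continuous_on UNIV (\<lambda>y. f (c *\<^sub>R y + p))"
    by (rule continuous_on_compose2) (auto intro!: continuous_intros)
  then show ?case by (auto intro!: continuous_intros)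
next
  case (Suc k)
  have d: "(f has_derivative frechet_derivative f (at x)) (at x)" for x
    using Suc.prems by (auto simp: frechet_derivative_works)
  have D: "((\<lambda>y. a * f (c *\<^sub>R y + p)) has_derivative
      (\<lambda>v. a * frechet_derivative f (at (c *\<^sub>R x + p)) (c *\<^sub>R v))) (at x)" for x
    by (rule has_derivative_compose[OF _ d, THEN has_derivative_mult_right])
      (auto intro!: derivative_eq_intros)
  have e: "frechet_derivative (\<lambda>y. a * f (c *\<^sub>R y + p)) (at x) v =
      (a * c) * frechet_derivative f (at (c *\<^sub>R x + p)) v" for x v
    using frechet_derivative_at[OF D[of x]] has_derivative_bounded_linear[OF d]
    by (simp add: linear_cmul bounded_linear.linear fun_eq_iff[symmetric])
      (metis (no_types, lifting) bounded_linear.linear linear_cmul mult.assoc real_scaleR_def)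
  show ?case
    using D Suc.prems Suc.IH[of "\<lambda>x. frechet_derivative f (at x) v" "a * c" for v]
    by (auto simp: differentiable_def e)
qed

lemma supp_outside: "x \<notin> supp f \<Longrightarrow> f x = 0"
  using closure_subset[of "{x. f x \<noteq> 0}"] unfolding supp_def by blast

lemma test_fun_affine:
  fixes f :: "'a::euclidean_space \<Rightarrow> real"
  assumes "test_fun f" "c \<noteq> 0"
  shows "test_fun (\<lambda>y. a * f (c *\<^sub>R y + p))"
  unfolding test_fun_def
proof
  show "smooth (\<lambda>y. a * f (c *\<^sub>R y + p))"
    using assms(1) by (auto simp: test_fun_def smooth_def intro: C_k_affine)
  \<comment> \<open>The preimage of the support under the affine map, written as an image of it so
    that compactness is inherited.\<close>
  let ?T = "(\<lambda>y. (1 / c) *\<^sub>R (y - p)) ` supp f"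
  have T: "compact ?T"
    using assms(1) by (intro compact_continuous_image continuous_intros) (auto simp: test_fun_def)
  have "y \<in> ?T" if "a * f (c *\<^sub>R y + p) \<noteq> 0" for y
    using that assms(2) supp_outside[of "c *\<^sub>R y + p" f]
    by (intro image_eqI[of _ _ "c *\<^sub>R y + p"]) auto
  then have "supp (\<lambda>y. a * f (c *\<^sub>R y + p)) \<subseteq> ?T"
    unfolding supp_def[of "\<lambda>y. a * f (c *\<^sub>R y + p)"]
    by (intro closure_minimal compact_imp_closed T) auto
  then show "compact (supp (\<lambda>y. a * f (c *\<^sub>R y + p)))"
    using T by (metis closed_closure closed_Int_compact inf.absorb_iff1 supp_def)
qed

lemma has_derivative_grad:
  fixes f :: "real^'n \<Rightarrow> real"
  assumes "f differentiable (at x)"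
  shows "(f has_derivative (\<lambda>v. grad f x \<bullet> v)) (at x)"
proof -
  let ?D = "frechet_derivative f (at x)"
  have D: "(f has_derivative ?D) (at x)" using assms by (simp add: frechet_derivative_works)
  then have l: "linear ?D" by (rule has_derivative_linear)
  have "?D v = grad f x \<bullet> v" for v
  proof -
    have "?D v = ?D (\<Sum>j\<in>UNIV. v $ j *s axis j 1)" by (simp only: basis_expansion)
    also have "\<dots> = (\<Sum>j\<in>UNIV. v $ j * ?D (axis j 1))"
      using l by (simp add: linear_sum linear_cmul scalar_mult_eq_scaleR)
    finally show ?thesis by (simp add: inner_vec_def grad_def partial_def mult.commute)
  qed
  then show ?thesis using D by (metis (no_types, lifting) ext)
qed

lemma grad_unique:
  fixes f :: "real^'n \<Rightarrow> real"
  assumes "(f has_derivative (\<lambda>v. g \<bullet> v)) (at x)"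
  shows "grad f x = g"
  using frechet_derivative_at[OF assms]
  by (simp add: grad_def partial_def vec_eq_iff inner_axis fun_eq_iff[symmetric])
    (metis inner_axis inner_real_def mult.right_neutral)

lemma test_fun_differentiable: "test_fun f \<Longrightarrow> f differentiable (at x)"
  unfolding test_fun_def smooth_def by (auto dest!: spec[of _ "Suc 0"])

lemma test_fun_continuous: "test_fun f \<Longrightarrow> continuous_on UNIV f"
  unfolding test_fun_def smooth_def by (auto dest!: spec[of _ 0])

lemma test_fun_continuous_grad:
  fixes f :: "real^'n \<Rightarrow> real"
  assumes "test_fun f"
  shows "continuous_on UNIV (grad f)"
proof -
  have "C_k (Suc 0) f" using assms by (auto simp: test_fun_def smooth_def)
  then show ?thesis
    unfolding grad_def[abs_def] partial_def by (intro continuous_on_vec_lambda) auto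
qed

lemma grad_affine:
  fixes f :: "real^'n \<Rightarrow> real"
  assumes "test_fun f"
  shows "grad (\<lambda>y. a * f (c *\<^sub>R y + p)) x = (a * c) *\<^sub>R grad f (c *\<^sub>R x + p)"
proof (rule grad_unique)
  have "((\<lambda>y. a * f (c *\<^sub>R y + p)) has_derivative
      (\<lambda>v. a * (grad f (c *\<^sub>R x + p) \<bullet> (c *\<^sub>R v)))) (at x)"
    by (rule has_derivative_compose[OF _ has_derivative_grad, THEN has_derivative_mult_right])
      (auto intro!: derivative_eq_intros test_fun_differentiable assms)
  then show "((\<lambda>y. a * f (c *\<^sub>R y + p)) has_derivative
      (\<lambda>v. ((a * c) *\<^sub>R grad f (c *\<^sub>R x + p)) \<bullet> v)) (at x)"
    by (simp add: mult.assoc)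
qed

lemma test_fun_reflect:
  fixes f :: "'a::euclidean_space \<Rightarrow> real"
  assumes "test_fun f"
  shows "test_fun (\<lambda>y. f (x - y))"
  using test_fun_affine[OF assms, of "-1" 1 x] by (simp add: algebra_simps)

lemma grad_reflect:
  fixes f :: "real^'n \<Rightarrow> real"
  assumes "test_fun f"
  shows "grad (\<lambda>y. f (x - y)) y = - grad f (x - y)"
  using grad_affine[OF assms, of 1 "-1" x y] by (simp add: algebra_simps)

section \<open>Rescaled kernels and their supports\<close>

lemma rescale_affine: "rescale f \<epsilon> = (\<lambda>x::real^'n. (1 / \<epsilon> ^ CARD('n)) * f ((1 / \<epsilon>) *\<^sub>R x + 0))"
  by (auto simp: rescale_def divide_simps)

lemma test_fun_rescale: "test_fun f \<Longrightarrow> \<epsilon> > 0 \<Longrightarrow> test_fun (rescale f \<epsilon>)"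
  unfolding rescale_affine by (rule test_fun_affine) auto

lemma grad_rescale:
  fixes f :: "real^'n \<Rightarrow> real"
  assumes "test_fun f"
  shows "grad (rescale f \<epsilon>) x = (1 / (\<epsilon> * \<epsilon> ^ CARD('n))) *\<^sub>R grad f (x /\<^sub>R \<epsilon>)"
  unfolding rescale_affine grad_affine[OF assms] by (simp add: divide_simps)

lemma grad_outside_supp:
  fixes f :: "real^'n \<Rightarrow> real"
  assumes "x \<notin> supp f"
  shows "grad f x = 0"
proof (rule grad_unique)
  have "open (- supp f)" by (simp add: supp_def open_Compl)
  then have "(f has_derivative (\<lambda>v. 0)) (at x)"
    using assms supp_outside[of _ f]
    by (intro has_derivative_transform_within_open[of "\<lambda>_. 0" "\<lambda>_. 0" x UNIV "- supp f" f]) auto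
  then show "(f has_derivative (\<lambda>v. 0 \<bullet> v)) (at x)" by simp
qed

lemma bounded_of_compact_support:
  fixes g :: "'a::euclidean_space \<Rightarrow> 'b::real_normed_vector"
  assumes "continuous_on UNIV g" "compact K" "\<And>x. x \<notin> K \<Longrightarrow> g x = 0"
  obtains M where "0 \<le> M" "\<And>x. norm (g x) \<le> M"
proof -
  have "compact (g ` K)"
    by (rule compact_continuous_image) (use assms in \<open>auto intro: continuous_on_subset\<close>)
  then obtain M where M: "\<And>x. x \<in> K \<Longrightarrow> norm (g x) \<le> M"
    by (meson bounded_iff compact_imp_bounded imageI)
  show thesis
  proof
    show "norm (g x) \<le> max 0 M" for x
      using M[of x] assms(3)[of x] by (cases "x \<in> K") (auto simp: le_max_iff_disj)
  qed simp
qed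

lemma supp_rescale:
  fixes f :: "real^'n \<Rightarrow> real"
  assumes "supp f \<subseteq> cball 0 1" "\<epsilon> > 0"
  shows "supp (rescale f \<epsilon>) \<subseteq> cball 0 \<epsilon>"
proof -
  have "norm x \<le> \<epsilon>" if "rescale f \<epsilon> x \<noteq> 0" for x
  proof -
    have "x /\<^sub>R \<epsilon> \<in> supp f" using that supp_outside[of "x /\<^sub>R \<epsilon>" f] by (auto simp: rescale_def)
    then show ?thesis using assms by (auto simp: divide_simps)
  qed
  then show ?thesis unfolding supp_def by (intro closure_minimal) auto
qed

section \<open>Locally integrable functions against compactly supported ones\<close>

lemma L1_loc_measurable:
  fixes f :: "real^'n \<Rightarrow> 'b::euclidean_space"
  assumes "L1_loc f"
  shows "f \<in> borel_measurable lebesgue"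
proof (rule borel_measurable_LIMSEQ_metric)
  fix n
  show "(\<lambda>x. indicat_real (cball 0 (real n)) x *\<^sub>R f x) \<in> borel_measurable lebesgue"
    using assms by (auto simp: L1_loc_def set_integrable_def dest!: spec[of _ "cball 0 (real n)"])
next
  fix x :: "real^'n"
  obtain N where N: "norm x \<le> real N" using real_arch_simple by blast
  show "(\<lambda>n. indicat_real (cball 0 (real n)) x *\<^sub>R f x) \<longlonglongrightarrow> f x"
  proof (rule tendsto_eventually)
    show "\<forall>\<^sub>F n in sequentially. indicat_real (cball 0 (real n)) x *\<^sub>R f x = f x"
      using eventually_ge_at_top[of N] by eventually_elim (use N in auto)
  qed
qed

lemma L1_loc_integrable_scaleR:
  fixes f :: "real^'n \<Rightarrow> real" and g :: "real^'n \<Rightarrow> 'c::euclidean_space"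
  assumes f: "L1_loc f" and g: "g \<in> borel_measurable lebesgue" "\<And>x. norm (g x) \<le> M"
    "\<And>x. x \<notin> K \<Longrightarrow> g x = 0" and K: "compact K"
  shows "integrable lebesgue (\<lambda>y. f y *\<^sub>R g y)"
proof (rule Bochner_Integration.integrable_bound)
  show "integrable lebesgue (\<lambda>y. M *\<^sub>R (indicat_real K y *\<^sub>R f y))"
    using f K by (intro integrable_scaleR_right) (auto simp: L1_loc_def set_integrable_def)
  show "(\<lambda>y. f y *\<^sub>R g y) \<in> borel_measurable lebesgue"
    using L1_loc_measurable[OF f] g(1) by measurable
  have M: "0 \<le> M" using g(2)[of 0] norm_ge_zero order_trans by blast
  show "AE y in lebesgue. norm (f y *\<^sub>R g y) \<le> norm (M *\<^sub>R (indicat_real K y *\<^sub>R f y))"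
  proof (rule AE_I2)
    fix y
    have "\<bar>f y\<bar> * norm (g y) \<le> \<bar>f y\<bar> * M" by (intro mult_left_mono g) auto
    then show "norm (f y *\<^sub>R g y) \<le> norm (M *\<^sub>R (indicat_real K y *\<^sub>R f y))"
      using g(3)[of y] M by (cases "y \<in> K") (auto simp: mult.commute)
  qed
qed

lemma L1_loc_integrable_conv:
  fixes f :: "real^'n \<Rightarrow> real" and g :: "real^'n \<Rightarrow> 'c::euclidean_space"
  assumes f: "L1_loc f" and g: "continuous_on UNIV g" "compact K" "\<And>x. x \<notin> K \<Longrightarrow> g x = 0"
  shows "integrable lebesgue (\<lambda>y. f y *\<^sub>R g (x - y))"
proof -
  obtain M where M: "\<And>x. norm (g x) \<le> M"
    using bounded_of_compact_support[of g K] g by blast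
  have c: "continuous_on UNIV (\<lambda>y. g (x - y))"
    by (rule continuous_on_compose2[OF g(1)]) (auto intro!: continuous_intros)
  show ?thesis
  proof (rule L1_loc_integrable_scaleR[OF f, where K="(\<lambda>z. x - z) ` K"])
    show "(\<lambda>y. g (x - y)) \<in> borel_measurable lebesgue"
      using c by (intro measurable_completion) (simp add: borel_measurable_continuous_onI)
    show "compact ((\<lambda>z. x - z) ` K)"
      using g(2) by (intro compact_continuous_image continuous_intros)
    show "g (x - y) = 0" if "y \<notin> (\<lambda>z. x - z) ` K" for y
      using that by (intro g(3)) (auto simp: image_iff)
  qed (rule M)
qed

lemma test_fun_integrable_conv:
  fixes f :: "real^'n \<Rightarrow> real"
  assumes "L1_loc f" "test_fun k"
  shows "integrable lebesgue (\<lambda>y. f y * k (x - y))"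
    "integrable lebesgue (\<lambda>y. f y *\<^sub>R grad k (x - y))"
  using L1_loc_integrable_conv[OF assms(1), of k "supp k" x]
    L1_loc_integrable_conv[OF assms(1), of "grad k" "supp k" x] assms(2)
  by (auto simp: supp_outside grad_outside_supp test_fun_continuous test_fun_continuous_grad test_fun_def)

text \<open>The Taylor remainder is controlled uniformly in \<open>p\<close> and vanishes outside a
  fixed ball. Multiplied by a merely locally integrable function, it therefore still has a small
  integral, as differentiation under the integral requires.\<close>

lemma test_fun_uniform_linearization:
  fixes k :: "real^'n \<Rightarrow> real"
  assumes k: "test_fun k" and R: "supp k \<subseteq> cball 0 R" and e: "0 < e"
  obtains d where "0 < d" "\<And>p h. norm h < d \<Longrightarrow>
    \<bar>k (p + h) - k p - grad k p \<bullet> h\<bar> \<le> indicat_real (cball 0 (R + 1)) p * (e * norm h)"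
proof -
  \<comment> \<open>For \<open>p\<close> in the ball of radius \<open>R + 1\<close> and increments
    shorter than 1, the segment from \<open>p\<close> to \<open>p + h\<close> stays in the ball of
    radius \<open>R + 2\<close>.\<close>
  have "uniformly_continuous_on (cball 0 (R + 2)) (grad k)"
    by (intro compact_uniformly_continuous compact_cball continuous_on_subset[OF test_fun_continuous_grad[OF k]]) auto
  then obtain d where d: "0 < d" "\<And>p q. \<lbrakk>norm p \<le> R + 2; norm q \<le> R + 2; dist q p < d\<rbrakk> \<Longrightarrow> dist (grad k q) (grad k p) < e"
    unfolding uniformly_continuous_on_def using e by (metis mem_cball_0)
  show thesis
  proof
    show "0 < min d 1" using d by simp
    fix p h :: "real^'n" assume h: "norm h < min d 1"
    show "\<bar>k (p + h) - k p - grad k p \<bullet> h\<bar> \<le> indicat_real (cball 0 (R + 1)) p * (e * norm h)"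
    proof (cases "norm p \<le> R + 1")
      case True
      have "norm (k (p + h) - k p - grad k p \<bullet> (p + h - p)) \<le> norm (p + h - p) * e"
      proof (rule differentiable_bound_linearization[where S="cball p (norm h)" and f'="\<lambda>x v. grad k x \<bullet> v"])
        show "p + t *\<^sub>R (p + h - p) \<in> cball p (norm h)" if "t \<in> {0..1}" for t
          using that by (auto simp: dist_norm mult_left_le_one_le)
        fix x assume x: "x \<in> cball p (norm h)"
        show "(k has_derivative (\<lambda>v. grad k x \<bullet> v)) (at x within cball p (norm h))"
          by (rule has_derivative_at_withinI[OF has_derivative_grad[OF test_fun_differentiable[OF k]]])
        have "norm x \<le> norm p + norm (x - p)" by (metis add.commute diff_add_cancel norm_triangle_ineq)
        then have "norm x \<le> R + 2" "dist x p < d"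
          using x True h by (auto simp: dist_norm norm_minus_commute)
        then have "norm (grad k x - grad k p) < e"
          using d(2)[of p x] True by (auto simp: dist_norm)
        moreover have "onorm (\<lambda>v. (grad k x - grad k p) \<bullet> v) \<le> norm (grad k x - grad k p)"
          by (rule onorm_le) (auto simp: Cauchy_Schwarz_ineq2)
        ultimately show "onorm ((\<lambda>v. grad k x \<bullet> v) - (\<lambda>v. grad k p \<bullet> v)) \<le> e"
          by (simp add: fun_diff_def inner_diff_left)
      qed auto
      then show ?thesis using True by (simp add: mult.commute)
    next
      \<comment> \<open>Beyond radius \<open>R + 1\<close>, an increment shorter than 1 cannot reach
        the support, so all three terms vanish.\<close>
      case False
      have "norm p \<le> norm (p + h) + norm h" by (metis add_diff_cancel norm_triangle_ineq4)
      then have "p \<notin> supp k" "p + h \<notin> supp k" using R False h by auto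
      then show ?thesis using e by (simp add: supp_outside grad_outside_supp indicator_def)
    qed
  qed
qed

text \<open>The remainder of \<open>conv f k\<close> is the integral of \<open>f\<close> times the
  remainder of \<open>k\<close>, and the uniform linearization makes it at most
  \<open>e' * norm (z - x)\<close> times the L1 norm of \<open>f\<close> on a fixed ball around
  \<open>x\<close>.\<close>

lemma has_derivative_conv:
  fixes f k :: "real^'n \<Rightarrow> real"
  assumes f: "L1_loc f" and k: "test_fun k"
  shows "(conv f k has_derivative (\<lambda>v. (LINT y|lebesgue. f y *\<^sub>R grad k (x - y)) \<bullet> v)) (at x)"
  unfolding has_derivative_at_alt
proof (intro conjI allI impI)
  show "bounded_linear (\<lambda>v. (LINT y|lebesgue. f y *\<^sub>R grad k (x - y)) \<bullet> v)"
    by (rule bounded_linear_inner_right)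
  fix e :: real assume e: "0 < e"
  have "bounded (supp k)" using k by (auto simp: test_fun_def compact_imp_bounded)
  then obtain R where R: "supp k \<subseteq> cball 0 R" unfolding bounded_iff subset_iff mem_cball_0 by blast
  define I where "I = (LINT y|lebesgue. \<bar>indicat_real (cball x (R + 1)) y *\<^sub>R f y\<bar>)"
  have I: "0 \<le> I" unfolding I_def by simp
  have fi: "integrable lebesgue (\<lambda>y. \<bar>indicat_real (cball x (R + 1)) y *\<^sub>R f y\<bar>)"
    using f by (intro integrable_abs) (auto simp: L1_loc_def set_integrable_def)
  \<comment> \<open>\<open>I\<close> is the L1 norm of \<open>f\<close> on the ball that the
    remainder can see; the added 1 covers \<open>I = 0\<close>.\<close>
  define e' where "e' = e / (I + 1)"
  have e': "0 < e'" using e I by (simp add: e'_def)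
  obtain d where d: "0 < d" and lin: "\<And>p h. norm h < d \<Longrightarrow>
    \<bar>k (p + h) - k p - grad k p \<bullet> h\<bar> \<le> indicat_real (cball 0 (R + 1)) p * (e' * norm h)"
    using test_fun_uniform_linearization[OF k R e'] by blast
  show "\<exists>d>0. \<forall>y. norm (y - x) < d \<longrightarrow>
    norm (conv f k y - conv f k x - (LINT y|lebesgue. f y *\<^sub>R grad k (x - y)) \<bullet> (y - x)) \<le> e * norm (y - x)"
  proof (intro exI conjI allI impI)
    fix z assume z: "norm (z - x) < d"
    note i = test_fun_integrable_conv[OF f k]
    have i3: "integrable lebesgue (\<lambda>y. (f y *\<^sub>R grad k (x - y)) \<bullet> (z - x))"
      using i(2) by (intro integrable_inner_left) auto
    have "conv f k z - conv f k x - (LINT y|lebesgue. f y *\<^sub>R grad k (x - y)) \<bullet> (z - x) =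
      (LINT y|lebesgue. f y * k (z - y) - f y * k (x - y) - (f y *\<^sub>R grad k (x - y)) \<bullet> (z - x))"
      unfolding conv_def using i i3 integral_inner_left[OF i(2)[of x], of "z - x"] by simp
    also have "norm \<dots> \<le> (LINT y|lebesgue. (e' * norm (z - x)) * \<bar>indicat_real (cball x (R + 1)) y *\<^sub>R f y\<bar>)"
    proof (rule order_trans[OF integral_norm_bound integral_mono])
      show "integrable lebesgue (\<lambda>y. norm (f y * k (z - y) - f y * k (x - y) - (f y *\<^sub>R grad k (x - y)) \<bullet> (z - x)))"
        using i i3 by auto
      show "integrable lebesgue (\<lambda>y. (e' * norm (z - x)) * \<bar>indicat_real (cball x (R + 1)) y *\<^sub>R f y\<bar>)"
        using fi by (intro integrable_mult_right) auto
      fix y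
      have "norm (f y * k (z - y) - f y * k (x - y) - (f y *\<^sub>R grad k (x - y)) \<bullet> (z - x)) =
        \<bar>f y\<bar> * \<bar>k ((x - y) + (z - x)) - k (x - y) - grad k (x - y) \<bullet> (z - x)\<bar>"
        by (simp add: abs_mult[symmetric] algebra_simps)
      also have "\<dots> \<le> \<bar>f y\<bar> * (indicat_real (cball 0 (R + 1)) (x - y) * (e' * norm (z - x)))"
        by (intro mult_left_mono lin z) auto
      also have "\<dots> = (e' * norm (z - x)) * \<bar>indicat_real (cball x (R + 1)) y *\<^sub>R f y\<bar>"
        by (auto simp: indicator_def dist_norm norm_minus_commute)
      finally show "norm (f y * k (z - y) - f y * k (x - y) - (f y *\<^sub>R grad k (x - y)) \<bullet> (z - x)) \<le>
        (e' * norm (z - x)) * \<bar>indicat_real (cball x (R + 1)) y *\<^sub>R f y\<bar>" .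
    qed
    also have "\<dots> = (e' * I) * norm (z - x)" by (simp add: I_def)
    also have "\<dots> \<le> e * norm (z - x)"
      using e I by (intro mult_right_mono) (auto simp: e'_def divide_simps)
    finally show "norm (conv f k z - conv f k x - (LINT y|lebesgue. f y *\<^sub>R grad k (x - y)) \<bullet> (z - x)) \<le> e * norm (z - x)" .
  qed (rule d)
qed

lemma grad_conv:
  fixes f k :: "real^'n \<Rightarrow> real"
  assumes "L1_loc f" "test_fun k"
  shows "grad (conv f k) x = (LINT y|lebesgue. f y *\<^sub>R grad k (x - y))"
  by (rule grad_unique[OF has_derivative_conv[OF assms]])

lemma L1_loc_component:
  fixes b :: "real^'n \<Rightarrow> real^'m"
  assumes "L1_loc b"
  shows "L1_loc (\<lambda>y. b y $ i)"
  unfolding L1_loc_def set_integrable_def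
proof (intro allI impI)
  fix K :: "(real^'n) set" assume "compact K"
  then have "integrable lebesgue (\<lambda>x. (indicat_real K x *\<^sub>R b x) \<bullet> axis i 1)"
    using assms by (intro integrable_inner_left) (auto simp: L1_loc_def set_integrable_def)
  then show "integrable lebesgue (\<lambda>x. indicat_real K x *\<^sub>R b x $ i)"
    by (simp add: inner_axis)
qed

text \<open>Two signs cancel, one from differentiating \<open>k (x - y)\<close> in \<open>y\<close>
  and one from the definition of the distributional derivative. What remains is the integral of the
  kernel against one entry of \<open>D\<close>, and an entry is at most the Frobenius norm.\<close>

lemma abs_grad_conv_component_le:
  fixes b :: "real^'n \<Rightarrow> real^'n"
  assumes b: "L1_loc b" and D: "distr_derivative b D" and k: "test_fun k" "\<And>x. 0 \<le> k x"
  shows "ennreal \<bar>grad (conv (\<lambda>y. b y $ i) k) x $ j\<bar> \<le> measure_conv (variation_measure D) k x"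
proof -
  have "grad (conv (\<lambda>y. b y $ i) k) x $ j = (LINT y|lebesgue. b y $ i * grad k (x - y) $ j)"
    using integral_inner_left[OF test_fun_integrable_conv(2)[OF L1_loc_component[OF b, of i] k(1), of x], of "axis j 1"]
    unfolding grad_conv[OF L1_loc_component[OF b] k(1)] by (simp add: inner_axis)
  also have "\<dots> = - (LINT y|lebesgue. b y $ i * partial j (\<lambda>y. k (x - y)) y)"
    using grad_reflect[OF k(1), of x] by (simp add: grad_def vec_eq_iff)
  also have "\<dots> = signed_integral (\<lambda>A. D A $ i $ j) (\<lambda>y. k (x - y))"
    using D test_fun_reflect[OF k(1), of x] unfolding distr_derivative_def by simp
  finally show ?thesis
    unfolding measure_conv_def
    using abs_signed_integral_le[of D "\<lambda>A. D A $ i $ j" "\<lambda>y. k (x - y)"] D k(2)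
      test_fun_continuous[OF test_fun_reflect[OF k(1), of x]]
    by (auto simp: distr_derivative_def borel_measurable_continuous_onI
        intro: order_trans[OF component_le_norm_cart Finite_Cartesian_Product.norm_nth_le])
qed

text \<open>Tested with \<open>k (x - y)\<close>, the divergence is the trace of \<open>D\<close>,
  whence \<open>CARD('n)\<close> diagonal entries, each dominated by the variation. The divergence
  is thus compared with the variation through mollifications only, and never as a measure.\<close>

lemma abs_conv_div_le:
  fixes b :: "real^'n \<Rightarrow> real^'n"
  assumes b: "L1_loc b" and D: "distr_derivative b D" and g: "distr_div b g"
    and k: "test_fun k" "\<And>x. 0 \<le> k x"
  shows "ennreal \<bar>conv g k x\<bar> \<le> of_nat CARD('n) * measure_conv (variation_measure D) k x"
proof -
  let ?k = "\<lambda>y. k (x - y)"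
  have t: "test_fun ?k" by (rule test_fun_reflect[OF k(1)])
  have i: "integrable lebesgue (\<lambda>y. b y $ i * partial i ?k y)" for i
  proof -
    have "integrable lebesgue (\<lambda>y. - ((b y $ i *\<^sub>R grad k (x - y)) \<bullet> axis i 1))"
      using test_fun_integrable_conv(2)[OF L1_loc_component[OF b, of i] k(1), of x]
      by (intro Bochner_Integration.integrable_minus integrable_inner_left) auto
    then show ?thesis using grad_reflect[OF k(1), of x] by (simp add: grad_def vec_eq_iff inner_axis)
  qed
  have "conv g k x = - (LINT y|lebesgue. b y \<bullet> grad ?k y)"
    using g t unfolding distr_div_def conv_def by simp
  also have "\<dots> = - (\<Sum>i\<in>UNIV. LINT y|lebesgue. b y $ i * partial i ?k y)"
    using i by (subst Bochner_Integration.integral_sum[symmetric]) (auto simp: inner_vec_def grad_def)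
  also have "\<dots> = (\<Sum>i\<in>UNIV. signed_integral (\<lambda>A. D A $ i $ i) ?k)"
    using D t unfolding distr_derivative_def by (simp add: sum_negf)
  finally have "ennreal \<bar>conv g k x\<bar> \<le> ennreal (\<Sum>i\<in>UNIV. \<bar>signed_integral (\<lambda>A. D A $ i $ i) ?k\<bar>)"
    by (simp add: ennreal_leI)
  also have "\<dots> = (\<Sum>i\<in>UNIV. ennreal \<bar>signed_integral (\<lambda>A. D A $ i $ i) ?k\<bar>)"
    by (subst sum_ennreal) auto
  also have "\<dots> \<le> (\<Sum>i\<in>(UNIV::'n set). measure_conv (variation_measure D) k x)"
    unfolding measure_conv_def using D k(2) test_fun_continuous[OF t]
    by (intro sum_mono abs_signed_integral_le)
      (auto simp: distr_derivative_def borel_measurable_continuous_onI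
        intro: order_trans[OF component_le_norm_cart Finite_Cartesian_Product.norm_nth_le])
  finally show ?thesis by simp
qed

section \<open>Essentially bounded factors\<close>

lemma AE_le_Linf_norm:
  assumes "A \<in> sets lebesgue"
  shows "AE x in lebesgue. x \<in> A \<longrightarrow> ennreal \<bar>u x\<bar> \<le> Linf_norm u A"
  using esssup_AE[where M="restrict_space lebesgue A" and f="\<lambda>x. ennreal \<bar>u x\<bar>"] assms
  unfolding Linf_norm_def by (subst (asm) AE_restrict_space_iff) auto

lemma L1_loc_mult_Linf:
  assumes u: "Linf u" and f: "L1_loc f"
  shows "L1_loc (\<lambda>x. u x * f x :: real)"
  unfolding L1_loc_def set_integrable_def
proof (intro allI impI)
  fix K :: "(real^'a) set" assume K: "compact K"
  define c where "c = enn2real (Linf_norm u UNIV)"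
  have um: "u \<in> borel_measurable lebesgue" and fin: "Linf_norm u UNIV < \<infinity>" using u by (auto simp: Linf_def)
  have c: "ennreal c = Linf_norm u UNIV" "0 \<le> c" using fin by (auto simp: c_def)
  have "AE x in lebesgue. ennreal \<bar>u x\<bar> \<le> Linf_norm u UNIV"
    using AE_le_Linf_norm[of UNIV u] by simp
  then have ae: "AE x in lebesgue. \<bar>u x\<bar> \<le> c"
    unfolding c(1)[symmetric] using c(2) by simp
  have fi: "integrable lebesgue (\<lambda>x. indicat_real K x *\<^sub>R f x)"
    using f K by (auto simp: L1_loc_def set_integrable_def)
  show "integrable lebesgue (\<lambda>x. indicat_real K x *\<^sub>R (u x * f x))"
  proof (rule Bochner_Integration.integrable_bound)
    show "integrable lebesgue (\<lambda>x. c * (indicat_real K x *\<^sub>R f x))" using fi by (rule integrable_mult_right)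
    have "(\<lambda>x. u x * (indicat_real K x *\<^sub>R f x)) \<in> borel_measurable lebesgue"
      using um fi by (intro borel_measurable_times) auto
    then show "(\<lambda>x. indicat_real K x *\<^sub>R (u x * f x)) \<in> borel_measurable lebesgue"
      by (simp add: ac_simps)
    show "AE x in lebesgue. norm (indicat_real K x *\<^sub>R (u x * f x)) \<le> norm (c * (indicat_real K x *\<^sub>R f x))"
      using ae by eventually_elim (use c(2) in \<open>auto simp: indicator_def abs_mult intro: mult_right_mono\<close>)
  qed
qed

lemma Linf_imp_L1_loc:
  assumes "Linf u"
  shows "L1_loc u"
proof -
  have "L1_loc (\<lambda>_ :: real^'a. 1 :: real)"
    unfolding L1_loc_def by (auto intro: absolutely_integrable_on_const lmeasurable_compact)
  then show ?thesis using L1_loc_mult_Linf[OF assms] by fastforce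
qed

section \<open>Continuity of translations and mollification\<close>

lemma nn_integral_lborel_affine:
  fixes t :: "'a::euclidean_space"
  assumes "f \<in> borel_measurable borel" "c \<noteq> 0"
  shows "(\<integral>\<^sup>+ x. f x \<partial>lborel) = ennreal (\<bar>c\<bar> ^ DIM('a)) * (\<integral>\<^sup>+ x. f (t + c *\<^sub>R x) \<partial>lborel)"
  using assms(1)
  by (subst lborel_affine[OF assms(2), of t])
    (simp add: nn_integral_density nn_integral_distr nn_integral_cmult)

lemma nn_integral_lborel_translate:
  fixes h :: "'a::euclidean_space"
  assumes "f \<in> borel_measurable borel"
  shows "(\<integral>\<^sup>+ x. f (x + h) \<partial>lborel) = (\<integral>\<^sup>+ x. f x \<partial>lborel)"
  using nn_integral_lborel_affine[OF assms, of 1 h] by (simp add: add.commute)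

lemma nn_integral_lborel_reflect:
  fixes h :: "'a::euclidean_space"
  assumes "f \<in> borel_measurable borel"
  shows "(\<integral>\<^sup>+ x. f (h - x) \<partial>lborel) = (\<integral>\<^sup>+ x. f x \<partial>lborel)"
  using nn_integral_lborel_affine[OF assms, of "-1" h] by simp

definition L1_modulus :: "('a::euclidean_space \<Rightarrow> real) \<Rightarrow> 'a \<Rightarrow> ennreal" where
  "L1_modulus f h = (\<integral>\<^sup>+ x. ennreal \<bar>f (x + h) - f x\<bar> \<partial>lborel)"

text \<open>The error of the approximation enters at \<open>x + h\<close> and at \<open>x\<close>;
  translation invariance makes the two contributions equal.\<close>

lemma L1_modulus_approx:
  fixes f g :: "'a::euclidean_space \<Rightarrow> real"
  assumes [measurable]: "f \<in> borel_measurable borel" "g \<in> borel_measurable borel"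
  shows "L1_modulus f h \<le> L1_modulus g h + 2 * (\<integral>\<^sup>+ x. ennreal \<bar>f x - g x\<bar> \<partial>lborel)"
proof -
  have "L1_modulus f h \<le> (\<integral>\<^sup>+ x. ennreal \<bar>f (x + h) - g (x + h)\<bar> + (ennreal \<bar>g (x + h) - g x\<bar> + ennreal \<bar>f x - g x\<bar>) \<partial>lborel)"
    unfolding L1_modulus_def
    by (intro nn_integral_mono) (auto simp: ennreal_plus[symmetric] simp del: ennreal_plus intro!: ennreal_leI)
  also have "\<dots> = (\<integral>\<^sup>+ x. ennreal \<bar>f (x + h) - g (x + h)\<bar> \<partial>lborel) + (L1_modulus g h + (\<integral>\<^sup>+ x. ennreal \<bar>f x - g x\<bar> \<partial>lborel))"
    unfolding L1_modulus_def by (subst nn_integral_add; simp)+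
  also have "(\<integral>\<^sup>+ x. ennreal \<bar>f (x + h) - g (x + h)\<bar> \<partial>lborel) = (\<integral>\<^sup>+ x. ennreal \<bar>f x - g x\<bar> \<partial>lborel)"
    by (rule nn_integral_lborel_translate[of "\<lambda>x. ennreal \<bar>f x - g x\<bar>"]) simp
  finally show ?thesis by (simp add: mult_2 ac_simps)
qed

definition L1_translation_continuous :: "('a::euclidean_space \<Rightarrow> real) \<Rightarrow> bool" where
  "L1_translation_continuous f \<longleftrightarrow> (\<forall>e>0. \<forall>\<^sub>F h in nhds 0. L1_modulus f h < ennreal e)"

text \<open>The property is closed under L1 approximation. The error \<open>e/4\<close> counts twice
  by \<open>L1_modulus_approx\<close>, which leaves \<open>e/2\<close> for the modulus of
  \<open>g\<close>.\<close>

lemma L1_translation_continuous_approx: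
  fixes f :: "'a::euclidean_space \<Rightarrow> real"
  assumes f: "f \<in> borel_measurable borel"
    and g: "\<And>e::real. e > 0 \<Longrightarrow> \<exists>g \<in> borel_measurable borel. L1_translation_continuous g \<and>
      (\<integral>\<^sup>+ x. ennreal \<bar>f x - g x\<bar> \<partial>lborel) \<le> ennreal e"
  shows "L1_translation_continuous f"
  unfolding L1_translation_continuous_def
proof (intro allI impI)
  fix e :: real assume e: "e > 0"
  obtain g where gm: "g \<in> borel_measurable borel" and gc: "L1_translation_continuous g"
    and fg: "(\<integral>\<^sup>+ x. ennreal \<bar>f x - g x\<bar> \<partial>lborel) \<le> ennreal (e/4)"
    using g[of "e/4"] e by auto
  have "\<forall>\<^sub>F h in nhds 0. L1_modulus g h < ennreal (e/2)"
    using gc e by (simp add: L1_translation_continuous_def)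
  then show "\<forall>\<^sub>F h in nhds 0. L1_modulus f h < ennreal e"
  proof eventually_elim
    case (elim h)
    have "L1_modulus f h \<le> L1_modulus g h + 2 * (\<integral>\<^sup>+ x. ennreal \<bar>f x - g x\<bar> \<partial>lborel)"
      by (rule L1_modulus_approx[OF f gm])
    also have "\<dots> \<le> L1_modulus g h + 2 * ennreal (e/4)"
      by (intro add_left_mono mult_left_mono fg) auto
    also have "\<dots> = ennreal (e/2) + L1_modulus g h"
      using e by (simp add: ennreal_numeral[symmetric] ennreal_mult[symmetric] add.commute del: ennreal_numeral)
    also have "\<dots> < ennreal (e/2) + ennreal (e/2)"
      using elim by (intro ennreal_add_left_cancel_less[THEN iffD2]) auto
    also have "\<dots> = ennreal e" using e by (simp add: ennreal_plus[symmetric] del: ennreal_plus)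
    finally show ?case .
  qed
qed

text \<open>Points of an open set are only lost under small translations on a set of small measure, and
  as translations preserve the measure, equally much is gained.\<close>

lemma L1_translation_continuous_indicator_open:
  fixes U :: "'a::euclidean_space set"
  assumes U: "open U" "emeasure lborel U < \<infinity>"
  shows "L1_translation_continuous (indicat_real U)"
  unfolding L1_translation_continuous_def
proof (intro allI impI)
  fix e :: real assume e: "e > 0"
  have [measurable]: "U \<in> sets borel" using U(1) by simp
  define a where "a h = (\<integral>\<^sup>+ x. indicator U x * indicator (- U) (x + h) \<partial>lborel)" for h
  have eq: "L1_modulus (indicat_real U) h = 2 * a h" for h
  proof -
    \<comment> \<open>\<open>a h\<close> measures the points that leave \<open>U\<close>,
      \<open>b\<close> those that enter and \<open>c\<close> those that stay. Both
      \<open>a h + c\<close> and \<open>b + c\<close> are the measure of \<open>U\<close>, and the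
      finite \<open>c\<close> cancels.\<close>
    define b where "b = (\<integral>\<^sup>+ x. indicator (- U) x * indicator U (x + h) \<partial>(lborel :: 'a measure))"
    define c where "c = (\<integral>\<^sup>+ x. indicator U x * indicator U (x + h) \<partial>(lborel :: 'a measure))"
    have "a h + c = (\<integral>\<^sup>+ x. indicator U x * indicator (- U) (x + h) + indicator U x * indicator U (x + h) \<partial>lborel)"
      unfolding a_def c_def by (rule nn_integral_add[symmetric]) auto
    also have "\<dots> = (\<integral>\<^sup>+ x. indicator U x \<partial>lborel)"
      by (rule nn_integral_cong) (auto simp: indicator_def)
    also have "\<dots> = (\<integral>\<^sup>+ x. indicator U (x + h) \<partial>lborel)"
      by (rule nn_integral_lborel_translate[symmetric]) simp
    also have "\<dots> = (\<integral>\<^sup>+ x. indicator (- U) x * indicator U (x + h) + indicator U x * indicator U (x + h) \<partial>lborel)"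
      by (rule nn_integral_cong) (auto simp: indicator_def)
    also have "\<dots> = b + c"
      unfolding b_def c_def by (rule nn_integral_add) auto
    finally have "a h + c = b + c" .
    moreover have "c \<noteq> \<infinity>"
    proof -
      have "c \<le> (\<integral>\<^sup>+ x. indicator U x \<partial>lborel)"
        unfolding c_def by (intro nn_integral_mono) (auto simp: indicator_def)
      then show ?thesis using U(2) by (auto simp: top_unique)
    qed
    ultimately have "a h = b" by (simp add: ennreal_add_left_cancel add.commute)
    moreover have "L1_modulus (indicat_real U) h =
      (\<integral>\<^sup>+ x. indicator U x * indicator (- U) (x + h) + indicator (- U) x * indicator U (x + h) \<partial>lborel)"
      unfolding L1_modulus_def by (rule nn_integral_cong) (auto simp: indicator_def)
    moreover have "\<dots> = a h + b"
      unfolding a_def b_def by (rule nn_integral_add) auto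
    ultimately show ?thesis by (simp add: mult_2)
  qed
  \<comment> \<open>Only the leaving points lie in a set independent of \<open>h\<close>, namely
    \<open>U\<close>. This is why the modulus was expressed by \<open>a\<close> alone: dominated
    convergence applies to it, and openness makes its integrand eventually 0.\<close>
  show "\<forall>\<^sub>F h in nhds 0. L1_modulus (indicat_real U) h < ennreal e"
    unfolding eventually_nhds_iff_sequentially
  proof (intro allI impI)
    fix h :: "nat \<Rightarrow> 'a" assume h: "h \<longlonglongrightarrow> 0"
    have "(\<lambda>n. a (h n)) \<longlonglongrightarrow> (\<integral>\<^sup>+ x. 0 \<partial>(lborel :: 'a measure))"
      unfolding a_def
    proof (rule nn_integral_dominated_convergence[where w="indicator U"])
      show "(\<integral>\<^sup>+ x. indicator U x \<partial>lborel) < \<infinity>" using U by simp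
      show "AE x in lborel. (\<lambda>n. indicator U x * indicator (- U) (x + h n)) \<longlonglongrightarrow> (0::ennreal)"
      proof (rule AE_I2)
        fix x :: 'a
        show "(\<lambda>n. indicator U x * indicator (- U) (x + h n)) \<longlonglongrightarrow> (0::ennreal)"
        proof (cases "x \<in> U")
          case True
          have "(\<lambda>n. x + h n) \<longlonglongrightarrow> x" using tendsto_add[OF tendsto_const h, of x] by simp
          then have "\<forall>\<^sub>F n in sequentially. x + h n \<in> U"
            using U(1) True by (rule topological_tendstoD)
          then show ?thesis
            by (intro tendsto_eventually) (auto elim!: eventually_mono simp: indicator_def)
        qed simp
      qed
    qed (auto simp: indicator_def)
    then have "(\<lambda>n. 2 * a (h n)) \<longlonglongrightarrow> 0"
      using ennreal_tendsto_cmult[of 2 "\<lambda>n. a (h n)" 0] by simp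
    then show "\<forall>\<^sub>F n in sequentially. L1_modulus (indicat_real U) (h n) < ennreal e"
      unfolding eq using e by (intro order_tendstoD(2)) auto
  qed
qed

lemma L1_translation_continuous_cmult:
  fixes f :: "'a::euclidean_space \<Rightarrow> real"
  assumes "L1_translation_continuous f" and [measurable]: "f \<in> borel_measurable borel"
  shows "L1_translation_continuous (\<lambda>x. f x * c)"
  unfolding L1_translation_continuous_def
proof (intro allI impI)
  fix e :: real assume e: "e > 0"
  have "\<forall>\<^sub>F h in nhds 0. L1_modulus f h < ennreal (e / (\<bar>c\<bar> + 1))"
    using assms(1) e by (simp add: L1_translation_continuous_def)
  then show "\<forall>\<^sub>F h in nhds 0. L1_modulus (\<lambda>x. f x * c) h < ennreal e"
  proof eventually_elim
    case (elim h)
    have "L1_modulus (\<lambda>x. f x * c) h = ennreal \<bar>c\<bar> * L1_modulus f h"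
      unfolding L1_modulus_def
      by (subst nn_integral_cmult[symmetric])
        (auto simp: ennreal_mult[symmetric] abs_mult[symmetric] algebra_simps)
    also have "\<dots> \<le> ennreal \<bar>c\<bar> * ennreal (e / (\<bar>c\<bar> + 1))"
      using elim by (intro mult_left_mono) auto
    also have "\<dots> = ennreal (\<bar>c\<bar> * (e / (\<bar>c\<bar> + 1)))"
      using e by (intro ennreal_mult[symmetric]) auto
    also have "\<dots> < ennreal e"
      using e by (intro ennreal_lessI) (auto simp: divide_simps)
    finally show ?case .
  qed
qed

text \<open>Indicators of measurable sets of finite measure are reached from open sets by outer
  regularity; sums and dominated limits then give all integrable functions.\<close>

lemma integrable_L1_translation_continuous:
  fixes f :: "'a::euclidean_space \<Rightarrow> real"
  assumes "integrable lborel f"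
  shows "L1_translation_continuous f"
  using assms
proof (induction rule: integrable_induct)
  case (base A c)
  have A[measurable]: "A \<in> sets borel" and fin: "emeasure lborel A < \<infinity>" using base by auto
  have "L1_translation_continuous (indicat_real A)"
  proof (rule L1_translation_continuous_approx)
    fix e :: real assume e: "e > 0"
    obtain U where U: "open U" "A \<subseteq> U" "emeasure lborel (U - A) < e"
      using outer_regular_lborel[OF A e] by blast
    have [measurable]: "U \<in> sets borel" using U(1) by simp
    have "emeasure lborel U = emeasure lborel A + emeasure lborel (U - A)"
      using U(2) by (subst plus_emeasure) (auto intro!: arg_cong[where f="emeasure lborel"])
    also have "\<dots> < \<infinity>" using fin U(3) by (simp add: less_top[symmetric] top_unique)
      (metis ennreal_less_top less_top order_less_trans)
    finally have "L1_translation_continuous (indicat_real U)"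
      using U(1) by (intro L1_translation_continuous_indicator_open) auto
    moreover have "(\<integral>\<^sup>+ x. ennreal \<bar>indicat_real A x - indicat_real U x\<bar> \<partial>lborel) = (\<integral>\<^sup>+ x. indicator (U - A) x \<partial>lborel)"
      using U(2) by (intro nn_integral_cong) (auto simp: indicator_def)
    ultimately show "\<exists>g\<in>borel_measurable borel. L1_translation_continuous g \<and>
      (\<integral>\<^sup>+ x. ennreal \<bar>indicat_real A x - g x\<bar> \<partial>lborel) \<le> ennreal e"
      using U(3) by (intro bexI[of _ "indicat_real U"]) auto
  qed simp
  then show ?case using L1_translation_continuous_cmult[of "indicat_real A" c] by simp
next
  case (add f g)
  have [measurable]: "f \<in> borel_measurable borel" "g \<in> borel_measurable borel" using add by auto
  show ?case unfolding L1_translation_continuous_def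
  proof (intro allI impI)
    fix e :: real assume e: "e > 0"
    have "\<forall>\<^sub>F h in nhds 0. L1_modulus f h < ennreal (e/2)" "\<forall>\<^sub>F h in nhds 0. L1_modulus g h < ennreal (e/2)"
      using add e by (auto simp: L1_translation_continuous_def)
    then show "\<forall>\<^sub>F h in nhds 0. L1_modulus (\<lambda>x. f x + g x) h < ennreal e"
    proof eventually_elim
      case (elim h)
      have "L1_modulus (\<lambda>x. f x + g x) h \<le> (\<integral>\<^sup>+ x. ennreal \<bar>f (x + h) - f x\<bar> + ennreal \<bar>g (x + h) - g x\<bar> \<partial>lborel)"
        unfolding L1_modulus_def
        by (intro nn_integral_mono) (auto simp: ennreal_plus[symmetric] simp del: ennreal_plus intro!: ennreal_leI)
      also have "\<dots> = L1_modulus f h + L1_modulus g h"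
        unfolding L1_modulus_def by (rule nn_integral_add) auto
      also have "\<dots> < ennreal (e/2) + ennreal (e/2)"
        using elim by (intro add_strict_mono) auto
      also have "\<dots> = ennreal e" using e by (simp add: ennreal_plus[symmetric] del: ennreal_plus)
      finally show ?case .
    qed
  qed
next
  case (lim f s)
  have [measurable]: "f \<in> borel_measurable borel" "\<And>i. s i \<in> borel_measurable borel" using lim by auto
  show ?case
  proof (rule L1_translation_continuous_approx)
    fix e :: real assume e: "e > 0"
    have "(\<lambda>i. \<integral>\<^sup>+ x. ennreal \<bar>f x - s i x\<bar> \<partial>lborel) \<longlonglongrightarrow> (\<integral>\<^sup>+ x. ennreal 0 \<partial>(lborel :: 'a measure))"
    proof (rule nn_integral_dominated_convergence[where w="\<lambda>x. ennreal (3 * \<bar>f x\<bar>)"])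
      \<comment> \<open>The approximating functions of \<open>integrable_induct\<close> satisfy
        \<open>\<bar>s i x\<bar> \<le> 2 * \<bar>f x\<bar>\<close>, hence the factor 3 for the
        difference.\<close>
      have "integrable lborel (\<lambda>x. 3 * \<bar>f x\<bar>)" using lim by auto
      then show "(\<integral>\<^sup>+ x. ennreal (3 * \<bar>f x\<bar>) \<partial>lborel) < \<infinity>"
        by (simp only: integrable_iff_bounded real_norm_def abs_mult abs_abs abs_numeral)
      show "AE x in lborel. ennreal \<bar>f x - s j x\<bar> \<le> ennreal (3 * \<bar>f x\<bar>)" for j
      proof (rule AE_I2, rule ennreal_leI)
        fix x show "\<bar>f x - s j x\<bar> \<le> 3 * \<bar>f x\<bar>" using lim.hyps(3)[of x j] by auto
      qed
      show "AE x in lborel. (\<lambda>i. ennreal \<bar>f x - s i x\<bar>) \<longlonglongrightarrow> ennreal 0"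
      proof (rule AE_I2, rule tendsto_ennrealI)
        fix x
        have "(\<lambda>i. \<bar>f x - s i x\<bar>) \<longlonglongrightarrow> \<bar>f x - f x\<bar>"
          using lim.hyps(2)[of x] by (intro tendsto_intros) auto
        then show "(\<lambda>i. \<bar>f x - s i x\<bar>) \<longlonglongrightarrow> 0" by simp
      qed
    qed auto
    then have "\<forall>\<^sub>F i in sequentially. (\<integral>\<^sup>+ x. ennreal \<bar>f x - s i x\<bar> \<partial>lborel) < ennreal e"
      using e by (intro order_tendstoD(2)) auto
    then obtain i where "(\<integral>\<^sup>+ x. ennreal \<bar>f x - s i x\<bar> \<partial>lborel) < ennreal e"
      using eventually_happens'[OF sequentially_bot] by blast
    then show "\<exists>g\<in>borel_measurable borel. L1_translation_continuous g \<and>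
      (\<integral>\<^sup>+ x. ennreal \<bar>f x - g x\<bar> \<partial>lborel) \<le> ennreal e"
      using lim.IH[of i] by (intro bexI[of _ "s i"]) auto
  qed simp
qed

section \<open>Convergence of mollifications\<close>

lemma nn_integral_rescale:
  fixes k :: "real^'n \<Rightarrow> real"
  assumes [measurable]: "k \<in> borel_measurable borel" and "\<epsilon> > 0"
  shows "(\<integral>\<^sup>+ x. ennreal (rescale k \<epsilon> x) \<partial>lborel) = (\<integral>\<^sup>+ x. ennreal (k x) \<partial>lborel)"
proof -
  have "(\<integral>\<^sup>+ x. ennreal (k x) \<partial>lborel) =
      ennreal (\<bar>inverse \<epsilon>\<bar> ^ CARD('n)) * (\<integral>\<^sup>+ x. ennreal (k (x /\<^sub>R \<epsilon>)) \<partial>lborel)"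
    using nn_integral_lborel_affine[of "\<lambda>x. ennreal (k x)" "inverse \<epsilon>" 0] assms by simp
  also have "\<dots> = (\<integral>\<^sup>+ x. ennreal (rescale k \<epsilon> x) \<partial>lborel)"
    using assms(2) unfolding rescale_def
    by (subst nn_integral_cmult[symmetric])
      (auto intro!: nn_integral_cong simp: ennreal_mult'[symmetric] field_simps)
  finally show ?thesis ..
qed

lemma borel_measurable_rescale [measurable]:
  assumes [measurable]: "k \<in> borel_measurable borel"
  shows "rescale k \<epsilon> \<in> borel_measurable borel"
  unfolding rescale_def[abs_def] by measurable

lemma rescale_nonneg: "(\<And>x. 0 \<le> k x) \<Longrightarrow> \<epsilon> > 0 \<Longrightarrow> 0 \<le> rescale k \<epsilon> x"
  by (simp add: rescale_def)

lemma nn_integral_rescale_kernel: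
  fixes k :: "real^'n \<Rightarrow> real"
  assumes "conv_kernel k" "\<epsilon> > 0"
  shows "(\<integral>\<^sup>+ x. ennreal (rescale k \<epsilon> x) \<partial>lborel) = 1"
  using assms nn_integral_rescale[of k \<epsilon>] nn_integral_eq_integral[of lborel k]
  by (auto simp: conv_kernel_def)

lemma L1_loc_of_lborel:
  assumes "integrable lborel f"
  shows "L1_loc f"
  using assms unfolding L1_loc_def set_integrable_def
  by (auto intro!: integrable_completion[THEN iffD2] integrable_mult_indicator simp: compact_imp_closed borel_closed)

text \<open>As \<open>k\<close> has integral 1, \<open>conv f k x - f x\<close> is the average of
  \<open>f (x - z) - f x\<close> with weight \<open>k z\<close>. By Tonelli, its L1 norm is at most
  the same average of the translation moduli, all of which are at most \<open>e\<close> on the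
  support.\<close>

lemma nn_integral_conv_diff_le:
  fixes f k :: "real^'n \<Rightarrow> real"
  assumes f: "integrable lborel f" and k: "test_fun k" "\<And>x. 0 \<le> k x" "supp k \<subseteq> cball 0 \<delta>"
    and k1: "(\<integral>\<^sup>+ x. ennreal (k x) \<partial>lborel) = 1"
    and T: "\<And>h. norm h \<le> \<delta> \<Longrightarrow> L1_modulus f h \<le> e"
  shows "(\<integral>\<^sup>+ x. ennreal \<bar>conv f k x - f x\<bar> \<partial>lborel) \<le> e"
proof -
  have [measurable]: "f \<in> borel_measurable borel" using f by auto
  have [measurable]: "k \<in> borel_measurable borel"
    using test_fun_continuous[OF k(1)] by (rule borel_measurable_continuous_onI)
  have *: "ennreal \<bar>conv f k x - f x\<bar> \<le> (\<integral>\<^sup>+ z. ennreal (k z * \<bar>f (x - z) - f x\<bar>) \<partial>lborel)" for x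
  proof -
    have i1: "integrable lborel (\<lambda>y. f y * k (x - y))"
      using test_fun_integrable_conv(1)[OF L1_loc_of_lborel[OF f] k(1)]
      by (subst (asm) integrable_completion) auto
    have k2: "(\<integral>\<^sup>+ y. ennreal (k (x - y)) \<partial>lborel) = 1"
      using nn_integral_lborel_reflect[of "\<lambda>y. ennreal (k y)" x] k1 by simp
    have i2: "integrable lborel (\<lambda>y. k (x - y))"
      using k2 k(2) by (intro integrableI_nonneg) auto
    have i3: "(LINT y|lborel. k (x - y)) = 1"
      using k2 k(2) by (subst integral_eq_nn_integral) auto
    have "conv f k x = (LINT y|lborel. f y * k (x - y))"
      unfolding conv_def by (subst integral_completion) auto
    then have "conv f k x - f x = (LINT y|lborel. f y * k (x - y) - f x * k (x - y))"
      using i1 i2 i3 by simp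
    then have "ennreal \<bar>conv f k x - f x\<bar> \<le> (\<integral>\<^sup>+ y. ennreal (norm (f y * k (x - y) - f x * k (x - y))) \<partial>lborel)"
      using integral_norm_bound_ennreal[of lborel "\<lambda>y. f y * k (x - y) - f x * k (x - y)"] i1 i2 by simp
    \<comment> \<open>Writing \<open>y\<close> as \<open>x - (x - y)\<close> exhibits the integrand
      as a function of \<open>x - y\<close>, ready for the substitution
      \<open>z = x - y\<close>.\<close>
    also have "\<dots> = (\<integral>\<^sup>+ y. ennreal (k (x - y) * \<bar>f (x - (x - y)) - f x\<bar>) \<partial>lborel)"
    proof (rule nn_integral_cong)
      fix y
      have "norm (f y * k (x - y) - f x * k (x - y)) = k (x - y) * \<bar>f (x - (x - y)) - f x\<bar>"
        using k(2)[of "x - y"] by (simp add: left_diff_distrib[symmetric] abs_mult)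
      then show "ennreal (norm (f y * k (x - y) - f x * k (x - y))) = ennreal (k (x - y) * \<bar>f (x - (x - y)) - f x\<bar>)"
        by simp
    qed
    also have "\<dots> = (\<integral>\<^sup>+ z. ennreal (k z * \<bar>f (x - z) - f x\<bar>) \<partial>lborel)"
      by (rule nn_integral_lborel_reflect[of "\<lambda>z. ennreal (k z * \<bar>f (x - z) - f x\<bar>)"]) measurable
    finally show ?thesis .
  qed
  have "(\<integral>\<^sup>+ x. ennreal \<bar>conv f k x - f x\<bar> \<partial>lborel) \<le>
    (\<integral>\<^sup>+ x. \<integral>\<^sup>+ z. ennreal (k z * \<bar>f (x - z) - f x\<bar>) \<partial>lborel \<partial>lborel)"
    by (intro nn_integral_mono *)
  also have "\<dots> = (\<integral>\<^sup>+ z. \<integral>\<^sup>+ x. ennreal (k z * \<bar>f (x - z) - f x\<bar>) \<partial>lborel \<partial>lborel)"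
    by (rule lborel_pair.Fubini') measurable
  also have "\<dots> \<le> (\<integral>\<^sup>+ z. ennreal (k z) * e \<partial>lborel)"
  proof (rule nn_integral_mono)
    fix z :: "real^'n"
    have "(\<integral>\<^sup>+ x. ennreal (k z * \<bar>f (x - z) - f x\<bar>) \<partial>lborel) = ennreal (k z) * L1_modulus f (- z)"
      unfolding L1_modulus_def using k(2) by (subst nn_integral_cmult[symmetric]) (auto simp: ennreal_mult)
    also have "\<dots> \<le> ennreal (k z) * e"
    proof (cases "z \<in> supp k")
      case True
      then show ?thesis using k(3) by (intro mult_left_mono T) auto
    qed (simp add: supp_outside)
    finally show "(\<integral>\<^sup>+ x. ennreal (k z * \<bar>f (x - z) - f x\<bar>) \<partial>lborel) \<le> ennreal (k z) * e" .
  qed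
  also have "\<dots> = e" by (simp add: nn_integral_multc k1)
  finally show ?thesis .
qed

text \<open>On the ball of radius \<open>R\<close>, a mollification with \<delta> < 1 sees
  \<open>f\<close> only on the ball of radius \<open>R + 1\<close>, so \<open>f\<close> may be cut
  off there and becomes integrable. The bound holds for all small \<delta>, which lets several
  functions share one \<delta>.\<close>

lemma mollification_tendsto_L1_loc:
  fixes f \<theta> :: "real^'n \<Rightarrow> real"
  assumes f: "L1_loc f" and \<theta>: "test_fun \<theta>" "conv_kernel \<theta>" "supp \<theta> \<subseteq> cball 0 1" and e: "e > 0"
  shows "\<exists>d>0. \<forall>\<delta>. 0 < \<delta> \<and> \<delta> < d \<longrightarrow>
    (\<integral>\<^sup>+ x. indicator (cball 0 R) x * ennreal \<bar>conv f (rescale \<theta> \<delta>) x - f x\<bar> \<partial>lebesgue) \<le> ennreal e"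
proof -
  obtain f' where f'[measurable]: "f' \<in> borel_measurable borel" and ae: "AE x in lborel. f x = f' x"
    using completion_ex_borel_measurable_real[OF L1_loc_measurable[OF f]] by auto
  define F where "F x = indicat_real (cball 0 (R + 1)) x *\<^sub>R f' x" for x
  have [measurable]: "F \<in> borel_measurable borel" unfolding F_def[abs_def] by (intro borel_measurable_scaleR borel_measurable_indicator f') auto
  have aeL: "AE x in lebesgue. f x = f' x" using ae by (rule AE_completion)
  have "integrable lebesgue (\<lambda>x. indicat_real (cball 0 (R + 1)) x *\<^sub>R f x)"
    using f by (auto simp: L1_loc_def set_integrable_def)
  then have "integrable lebesgue F"
    by (rule integrable_cong_AE_imp) (use aeL in \<open>auto simp: F_def intro!: measurable_completion\<close>)
  then have Fi: "integrable lborel F" by (subst (asm) integrable_completion) auto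
  have "\<forall>\<^sub>F h in nhds 0. L1_modulus F h < ennreal e"
    using integrable_L1_translation_continuous[OF Fi] e by (simp add: L1_translation_continuous_def)
  then obtain d where d: "d > 0" "\<And>h. norm h < d \<Longrightarrow> L1_modulus F h < ennreal e"
    unfolding eventually_nhds_metric by (auto simp: dist_norm)
  show ?thesis
  proof (intro exI[of _ "min d 1"] conjI allI impI)
    show "0 < min d 1" using d by simp
    fix \<delta> assume \<delta>: "0 < \<delta> \<and> \<delta> < min d 1"
    let ?k = "rescale \<theta> \<delta>"
    have k: "test_fun ?k" "supp ?k \<subseteq> cball 0 \<delta>" "\<And>x. 0 \<le> ?k x"
      using test_fun_rescale[OF \<theta>(1), of \<delta>] supp_rescale[OF \<theta>(3), of \<delta>] \<theta>(2) \<delta>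
      by (auto intro!: rescale_nonneg simp: conv_kernel_def)
    have ceq: "conv f ?k x = conv F ?k x" if x: "norm x \<le> R" for x
      unfolding conv_def
    proof (rule integral_cong_AE)
      show "(\<lambda>y. f y * ?k (x - y)) \<in> borel_measurable lebesgue" "(\<lambda>y. F y * ?k (x - y)) \<in> borel_measurable lebesgue"
        using test_fun_integrable_conv(1)[OF f k(1)] test_fun_integrable_conv(1)[OF L1_loc_of_lborel[OF Fi] k(1)]
        by auto
      show "AE y in lebesgue. f y * ?k (x - y) = F y * ?k (x - y)"
        using aeL
      proof eventually_elim
        case (elim y)
        show ?case
        proof (cases "x - y \<in> supp ?k")
          case True
          then have "norm (x - y) \<le> 1" using k(2) \<delta> by auto
          then have "norm y \<le> R + 1" using x norm_triangle_ineq3[of x y] by linarith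
          then show ?thesis using elim by (simp add: F_def)
        qed (simp add: supp_outside)
      qed
    qed
    have "(\<integral>\<^sup>+ x. indicator (cball 0 R) x * ennreal \<bar>conv f ?k x - f x\<bar> \<partial>lebesgue)
      \<le> (\<integral>\<^sup>+ x. ennreal \<bar>conv F ?k x - F x\<bar> \<partial>lebesgue)"
    proof (rule nn_integral_mono_AE)
      show "AE x in lebesgue. indicator (cball 0 R) x * ennreal \<bar>conv f ?k x - f x\<bar> \<le> ennreal \<bar>conv F ?k x - F x\<bar>"
        using aeL by eventually_elim (auto simp: indicator_def ceq F_def)
    qed
    also have "\<dots> = (\<integral>\<^sup>+ x. ennreal \<bar>conv F ?k x - F x\<bar> \<partial>lborel)"
      by (rule nn_integral_completion)
    also have "\<dots> \<le> ennreal e"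
    proof (rule nn_integral_conv_diff_le[OF Fi k(1,3,2)])
      show "(\<integral>\<^sup>+ x. ennreal (?k x) \<partial>lborel) = 1" using nn_integral_rescale_kernel[OF \<theta>(2)] \<delta> by auto
      show "L1_modulus F h \<le> ennreal e" if "norm h \<le> \<delta>" for h
        using that d(2)[of h] \<delta> by auto
    qed
    finally show "(\<integral>\<^sup>+ x. indicator (cball 0 R) x * ennreal \<bar>conv f ?k x - f x\<bar> \<partial>lebesgue) \<le> ennreal e" .
  qed
qed

lemma continuous_conv:
  assumes "L1_loc f" "test_fun k"
  shows "continuous_on UNIV (conv f k)"
  using has_derivative_continuous[OF has_derivative_conv[OF assms]]
  by (simp add: continuous_on_eq_continuous_at)

text \<open>The components of \<open>b\<close>, its divergence and the bounding function must
  converge along one common sequence. So their errors are added up in \<open>U\<close>, and one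
  almost everywhere convergent subsequence is extracted from its L1 convergence to 0.\<close>

lemma mollification_AE_subsequence:
  fixes \<theta> :: "real^'n \<Rightarrow> real"
  assumes FF: "finite FF" "\<And>f. f \<in> FF \<Longrightarrow> L1_loc f"
    and \<theta>: "test_fun \<theta>" "conv_kernel \<theta>" "supp \<theta> \<subseteq> cball 0 1"
  shows "\<exists>\<delta>::nat \<Rightarrow> real. (\<forall>n. 0 < \<delta> n) \<and> (AE x in lebesgue. norm x \<le> R \<longrightarrow>
    (\<forall>f\<in>FF. (\<lambda>n. conv f (rescale \<theta> (\<delta> n)) x) \<longlonglongrightarrow> f x))"
proof -
  define U where "U \<delta> x = (\<Sum>f\<in>FF. indicat_real (cball 0 R) x * \<bar>conv f (rescale \<theta> \<delta>) x - f x\<bar>)" for \<delta> x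
  have term_measurable: "(\<lambda>x. indicat_real (cball 0 R) x * \<bar>conv f (rescale \<theta> \<delta>) x - f x\<bar>) \<in> borel_measurable lebesgue"
    if "f \<in> FF" "\<delta> > 0" for f \<delta>
  proof -
    have "conv f (rescale \<theta> \<delta>) \<in> borel_measurable lebesgue"
      using continuous_conv[OF FF(2)[OF that(1)] test_fun_rescale[OF \<theta>(1) that(2)]]
      by (intro measurable_completion) (simp add: borel_measurable_continuous_onI)
    moreover have "f \<in> borel_measurable lebesgue" using FF(2)[OF that(1)] by (rule L1_loc_measurable)
    moreover have "indicat_real (cball 0 R) \<in> borel_measurable (lebesgue :: (real^'n) measure)"
      by (intro borel_measurable_indicator) auto
    ultimately show ?thesis by measurable
  qed
  have "\<exists>\<delta>>0. (\<integral>\<^sup>+ x. ennreal (U \<delta> x) \<partial>lebesgue) \<le> ennreal ((1/2) ^ n)" for n :: nat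
  proof -
    \<comment> \<open>Chosen so that \<open>card FF\<close> errors sum to at most
      \<open>(1/2) ^ n\<close>; the added 1 covers an empty \<open>FF\<close>.\<close>
    define e where "e = (1/2) ^ n / (real (card FF) + 1)"
    have e: "e > 0" by (simp add: e_def add_nonneg_pos)
    define good where "good f d \<longleftrightarrow> d > 0 \<and> (\<forall>\<delta>. 0 < \<delta> \<and> \<delta> < d \<longrightarrow>
      (\<integral>\<^sup>+ x. indicator (cball 0 R) x * ennreal \<bar>conv f (rescale \<theta> \<delta>) x - f x\<bar> \<partial>lebesgue) \<le> ennreal e)" for f d
    have "\<forall>f\<in>FF. \<exists>d. good f d"
      using mollification_tendsto_L1_loc[OF FF(2) \<theta> e] unfolding good_def by blast
    then obtain d where "\<And>f. f \<in> FF \<Longrightarrow> good f (d f)" by metis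
    then have d: "\<And>f. f \<in> FF \<Longrightarrow> d f > 0" "\<And>f \<delta>. \<lbrakk>f \<in> FF; 0 < \<delta>; \<delta> < d f\<rbrakk> \<Longrightarrow>
      (\<integral>\<^sup>+ x. indicator (cball 0 R) x * ennreal \<bar>conv f (rescale \<theta> \<delta>) x - f x\<bar> \<partial>lebesgue) \<le> ennreal e"
      unfolding good_def by blast+
    \<comment> \<open>The 1 keeps the minimum defined for empty \<open>FF\<close>, and halving makes
      the inequality \<open>\<delta> < d f\<close> strict.\<close>
    define \<delta> where "\<delta> = Min (insert 1 (d ` FF)) / 2"
    have m: "0 < Min (insert 1 (d ` FF))" using FF(1) d(1) by auto
    have \<delta>: "\<delta> > 0" using m by (simp add: \<delta>_def)
    have \<delta>d: "\<delta> < d f" if "f \<in> FF" for f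
    proof -
      have "Min (insert 1 (d ` FF)) \<le> d f" using FF(1) that by (intro Min_le) auto
      then show ?thesis using m by (simp add: \<delta>_def)
    qed
    have "(\<integral>\<^sup>+ x. ennreal (U \<delta> x) \<partial>lebesgue) =
      (\<Sum>f\<in>FF. \<integral>\<^sup>+ x. ennreal (indicat_real (cball 0 R) x * \<bar>conv f (rescale \<theta> \<delta>) x - f x\<bar>) \<partial>lebesgue)"
      unfolding U_def using term_measurable[OF _ \<delta>]
      by (subst nn_integral_sum[symmetric]) (auto intro!: nn_integral_cong sum_ennreal[symmetric])
    also have "\<dots> \<le> (\<Sum>f\<in>FF. ennreal e)"
    proof (rule sum_mono)
      fix f assume f: "f \<in> FF"
      have "(\<integral>\<^sup>+ x. ennreal (indicat_real (cball 0 R) x * \<bar>conv f (rescale \<theta> \<delta>) x - f x\<bar>) \<partial>lebesgue) =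
        (\<integral>\<^sup>+ x. indicator (cball 0 R) x * ennreal \<bar>conv f (rescale \<theta> \<delta>) x - f x\<bar> \<partial>lebesgue)"
        by (intro nn_integral_cong) (auto simp: indicator_def)
      then show "(\<integral>\<^sup>+ x. ennreal (indicat_real (cball 0 R) x * \<bar>conv f (rescale \<theta> \<delta>) x - f x\<bar>) \<partial>lebesgue) \<le> ennreal e"
        using d(2)[OF f \<delta> \<delta>d[OF f]] by simp
    qed
    also have "\<dots> = ennreal (real (card FF) * e)" using e by (simp add: ennreal_mult ennreal_of_nat_eq_real_of_nat)
    also have "\<dots> \<le> ennreal ((1/2) ^ n)"
      by (intro ennreal_leI) (simp add: e_def divide_simps)
    finally show ?thesis using \<delta> by blast
  qed
  then obtain \<delta> where \<delta>: "\<And>n. \<delta> n > 0" "\<And>n. (\<integral>\<^sup>+ x. ennreal (U (\<delta> n) x) \<partial>lebesgue) \<le> ennreal ((1/2) ^ n)"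
    by metis
  have U0: "0 \<le> U (\<delta> n) x" for n x unfolding U_def by (intro sum_nonneg) auto
  have Um: "U (\<delta> n) \<in> borel_measurable lebesgue" for n
    unfolding U_def[abs_def] using term_measurable \<delta>(1) by (intro borel_measurable_sum) auto
  have Ui: "integrable lebesgue (U (\<delta> n))" for n
    using \<delta>(2)[of n] U0 Um by (intro integrableI_nonneg) (auto intro: le_less_trans)
  have Un: "(LINT x|lebesgue. norm (U (\<delta> n) x)) \<le> (1/2) ^ n" for n
  proof -
    have "ennreal (LINT x|lebesgue. U (\<delta> n) x) \<le> ennreal ((1/2) ^ n)"
      using nn_integral_eq_integral[OF Ui[of n]] U0 \<delta>(2)[of n] by simp
    then show ?thesis using U0[of n] by (simp add: ennreal_le_iff)
  qed
  have "(\<lambda>n. LINT x|lebesgue. norm (U (\<delta> n) x)) \<longlonglongrightarrow> 0"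
  proof (rule tendsto_sandwich[OF _ _ tendsto_const])
    show "(\<lambda>n. (1/2::real) ^ n) \<longlonglongrightarrow> 0" by (simp add: LIMSEQ_realpow_zero)
  qed (use Un in auto)
  then obtain r where r: "AE x in lebesgue. (\<lambda>n. U (\<delta> (r n)) x) \<longlonglongrightarrow> 0"
    using tendsto_L1_AE_subseq[of lebesgue "\<lambda>n. U (\<delta> n)", OF Ui] by blast
  show ?thesis
  proof (intro exI[of _ "\<delta> \<circ> r"] conjI allI)
    show "0 < (\<delta> \<circ> r) n" for n using \<delta>(1) by simp
    show "AE x in lebesgue. norm x \<le> R \<longrightarrow>
      (\<forall>f\<in>FF. (\<lambda>n. conv f (rescale \<theta> ((\<delta> \<circ> r) n)) x) \<longlonglongrightarrow> f x)"
      using r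
    proof eventually_elim
      case (elim x)
      show ?case
      proof (intro impI ballI)
        fix f assume x: "norm x \<le> R" and f: "f \<in> FF"
        have le: "\<bar>conv f (rescale \<theta> (\<delta> (r n))) x - f x\<bar> \<le> U (\<delta> (r n)) x" for n
          using member_le_sum[OF f, of "\<lambda>f. indicat_real (cball 0 R) x * \<bar>conv f (rescale \<theta> (\<delta> (r n))) x - f x\<bar>"] FF(1) x
          by (simp add: U_def)
        have "(\<lambda>n. conv f (rescale \<theta> (\<delta> (r n))) x - f x) \<longlonglongrightarrow> 0"
          by (rule Lim_null_comparison[OF _ elim]) (use le in auto)
        then show "(\<lambda>n. conv f (rescale \<theta> ((\<delta> \<circ> r) n)) x) \<longlonglongrightarrow> f x"
          by (simp add: LIM_zero_iff)
      qed
    qed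
  qed
qed

section \<open>The averaging kernel\<close>

lemma sets_borel_cball [measurable]: "cball a r \<in> sets borel"
  by simp

text \<open>The density of the image of \<open>1\<^bsub>(0,1]\<^esub>(s) ds \<otimes> 1\<^bsub>B\<^sub>1\<^esub>(z) dz\<close> under \<open>(s, z) \<mapsto> s z\<close>.\<close>

definition cone_density :: "real^'n \<Rightarrow> ennreal" where
  "cone_density w = (\<integral>\<^sup>+ s. indicator {0<..1} s * ennreal (1 / s ^ CARD('n)) * (if norm w \<le> s then 1 else 0) \<partial>lborel)"

lemma borel_measurable_cone_density [measurable]:
  "(cone_density :: real^'n \<Rightarrow> ennreal) \<in> borel_measurable borel"
  unfolding cone_density_def[abs_def] by measurable

lemma cone_density_uminus: "cone_density (- w) = cone_density w"
  by (simp add: cone_density_def)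

lemma cone_density_outside:
  assumes "norm w > 1"
  shows "cone_density w = 0"
proof -
  have "cone_density w = (\<integral>\<^sup>+ s. 0 \<partial>(lborel :: real measure))"
    unfolding cone_density_def using assms by (intro nn_integral_cong) (auto simp: indicator_def)
  then show ?thesis by simp
qed

text \<open>At fixed \<open>s\<close>, the substitution \<open>w = s *\<^sub>R z\<close> contributes
  the Jacobian \<open>1 / s ^ CARD('n)\<close> and turns \<open>norm z \<le> \<epsilon>\<close> into
  \<open>norm (w /\<^sub>R \<epsilon>) \<le> s\<close>. Integrating over \<open>s\<close> last
  leaves a weight in \<open>w /\<^sub>R \<epsilon>\<close> alone.\<close>

lemma nn_integral_segments:
  fixes G :: "real^'n \<Rightarrow> ennreal"
  assumes [measurable]: "G \<in> borel_measurable borel" and \<epsilon>: "\<epsilon> > 0"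
  shows "(\<integral>\<^sup>+ z. indicator (cball 0 \<epsilon>) z * (\<integral>\<^sup>+ s. indicator {0<..1::real} s * G (s *\<^sub>R z) \<partial>lborel) \<partial>lborel) =
    (\<integral>\<^sup>+ w. G w * cone_density (w /\<^sub>R \<epsilon>) \<partial>lborel)"
proof -
  have "(\<integral>\<^sup>+ z. indicator (cball 0 \<epsilon>) z * (\<integral>\<^sup>+ s. indicator {0<..1::real} s * G (s *\<^sub>R z) \<partial>lborel) \<partial>lborel) =
    (\<integral>\<^sup>+ z. \<integral>\<^sup>+ s. indicator {..\<epsilon>} (norm z) * (indicator {0<..1::real} s * G (s *\<^sub>R z)) \<partial>lborel \<partial>lborel)"
    by (intro nn_integral_cong, subst nn_integral_cmult) (auto simp: indicator_def)
  also have "\<dots> = (\<integral>\<^sup>+ s. \<integral>\<^sup>+ z. indicator {..\<epsilon>} (norm z) * (indicator {0<..1::real} s * G (s *\<^sub>R z)) \<partial>lborel \<partial>lborel)"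
    by (rule lborel_pair.Fubini'[symmetric]) measurable
  also have "\<dots> = (\<integral>\<^sup>+ s. \<integral>\<^sup>+ w. G w * (indicator {0<..1} s * ennreal (1 / s ^ CARD('n)) * (if norm (w /\<^sub>R \<epsilon>) \<le> s then 1 else 0)) \<partial>lborel \<partial>lborel)"
  proof (rule nn_integral_cong)
    fix s :: real
    show "(\<integral>\<^sup>+ z. indicator {..\<epsilon>} (norm z) * (indicator {0<..1::real} s * G (s *\<^sub>R z)) \<partial>lborel) =
      (\<integral>\<^sup>+ w. G w * (indicator {0<..1} s * ennreal (1 / s ^ CARD('n)) * (if norm (w /\<^sub>R \<epsilon>) \<le> s then 1 else 0)) \<partial>lborel)"
    proof (cases "s \<in> {0<..1}")
      case True
      then have s: "s > 0" by simp
      have "(\<integral>\<^sup>+ z. indicator {..\<epsilon>} (norm z) * G (s *\<^sub>R z) \<partial>lborel) =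
        ennreal (\<bar>1/s\<bar> ^ CARD('n)) * (\<integral>\<^sup>+ w. indicator {..\<epsilon>} (norm ((1/s) *\<^sub>R w)) * G w \<partial>lborel)"
        using s by (subst nn_integral_lborel_affine[where c="1/s" and t=0]) auto
      also have "\<dots> = (\<integral>\<^sup>+ w. ennreal (\<bar>1/s\<bar> ^ CARD('n)) * (indicator {..\<epsilon>} (norm ((1/s) *\<^sub>R w)) * G w) \<partial>lborel)"
        by (rule nn_integral_cmult[symmetric]) measurable
      also have "\<dots> = (\<integral>\<^sup>+ w. G w * (ennreal (1 / s ^ CARD('n)) * (if norm (w /\<^sub>R \<epsilon>) \<le> s then 1 else 0)) \<partial>lborel)"
        using s \<epsilon> by (intro nn_integral_cong) (auto simp: indicator_def power_divide field_simps)
      finally show ?thesis using True by simp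
    qed simp
  qed
  also have "\<dots> = (\<integral>\<^sup>+ w. \<integral>\<^sup>+ s. G w * (indicator {0<..1} s * ennreal (1 / s ^ CARD('n)) * (if norm (w /\<^sub>R \<epsilon>) \<le> s then 1 else 0)) \<partial>lborel \<partial>lborel)"
    by (rule lborel_pair.Fubini') measurable
  also have "\<dots> = (\<integral>\<^sup>+ w. G w * cone_density (w /\<^sub>R \<epsilon>) \<partial>lborel)"
    unfolding cone_density_def by (intro nn_integral_cong nn_integral_cmult) measurable
  finally show ?thesis .
qed

text \<open>An image measure keeps the total mass, here that of the interval of length 1 times the
  unit ball.\<close>

lemma nn_integral_cone_density:
  "(\<integral>\<^sup>+ w. cone_density (w :: real^'n) \<partial>lborel) = emeasure lborel (cball (0 :: real^'n) 1)"
proof -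
  have "(\<integral>\<^sup>+ w. cone_density (w :: real^'n) \<partial>lborel) =
    (\<integral>\<^sup>+ z. indicator (cball (0 :: real^'n) 1) z * (\<integral>\<^sup>+ s. indicator {0<..1::real} s \<partial>lborel) \<partial>lborel)"
    using nn_integral_segments[of "\<lambda>_ :: real^'n. 1" 1] by simp
  also have "\<dots> = emeasure lborel (cball (0 :: real^'n) 1)" by simp
  finally show ?thesis .
qed

definition ball_vol :: "'n::finite itself \<Rightarrow> real" where
  "ball_vol _ = measure lborel (cball (0 :: real^'n) 1)"

lemma ball_vol: "0 < ball_vol TYPE('n)"
  "emeasure lborel (cball (0 :: real^'n) 1) = ennreal (ball_vol TYPE('n))"
proof -
  show "emeasure lborel (cball (0 :: real^'n) 1) = ennreal (ball_vol TYPE('n))"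
    unfolding ball_vol_def by (rule emeasure_eq_ennreal_measure) (use emeasure_lborel_cball_finite[of "0 :: real^'n" 1] in auto)
  show "0 < ball_vol TYPE('n)"
    unfolding ball_vol_def using content_cball_pos[of 1 "0 :: real^'n"] by simp
qed

text \<open>The value \<open>0\<close> of \<open>enn2real\<close> at infinity only matters on a null set.\<close>

definition cone_kernel :: "real^'n \<Rightarrow> real" where
  "cone_kernel w = (enn2real (cone_density w) + indicat_real (cball 0 1) w) / (2 * ball_vol TYPE('n))"

lemma borel_measurable_cone_kernel [measurable]:
  "(cone_kernel :: real^'n \<Rightarrow> real) \<in> borel_measurable borel"
  unfolding cone_kernel_def[abs_def] by measurable

lemma cone_kernel_nonneg: "0 \<le> cone_kernel w"
  using ball_vol(1) by (auto simp: cone_kernel_def intro!: divide_nonneg_pos add_nonneg_nonneg)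

lemma AE_cone_density_finite: "AE w in lborel. cone_density (w :: real^'n) = ennreal (enn2real (cone_density w))"
proof -
  have "AE w in lborel. cone_density (w :: real^'n) \<noteq> \<infinity>"
    by (rule nn_integral_noteq_infinite) (auto simp: nn_integral_cone_density ball_vol(2))
  then show ?thesis by eventually_elim (auto simp: ennreal_enn2real_if)
qed

text \<open>Exceptions occur: at the origin the density is infinite and the real-valued kernel is
  not.\<close>

lemma AE_cone_kernel: "AE w in lborel. cone_density (w :: real^'n) + indicator (cball 0 1) w =
    ennreal (2 * ball_vol TYPE('n)) * ennreal (cone_kernel w)"
  using AE_cone_density_finite
proof eventually_elim
  case (elim w)
  have "ennreal (2 * ball_vol TYPE('n)) * ennreal (cone_kernel w) =
    ennreal (enn2real (cone_density w) + indicat_real (cball 0 1) w)"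
    using ball_vol(1)[where 'n='n] cone_kernel_nonneg[of w]
    by (subst ennreal_mult[symmetric]) (auto simp: cone_kernel_def)
  also have "\<dots> = cone_density w + indicator (cball 0 1) w"
    using elim by (subst ennreal_plus) (auto simp: indicator_def)
  finally show ?case by simp
qed

text \<open>Both summands have mass \<open>ball_vol\<close>, which explains the normalisation by
  twice this number.\<close>

lemma conv_kernel_cone_kernel: "conv_kernel (cone_kernel :: real^'n \<Rightarrow> real)"
proof -
  let ?V = "ball_vol TYPE('n)"
  have V: "?V > 0" by (rule ball_vol)
  have "ennreal (2 * ?V) * (\<integral>\<^sup>+ w. ennreal (cone_kernel (w :: real^'n)) \<partial>lborel) =
    (\<integral>\<^sup>+ w. cone_density w + indicator (cball (0 :: real^'n) 1) w \<partial>lborel)"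
    by (subst nn_integral_cmult[symmetric]) (use AE_cone_kernel in \<open>auto intro!: nn_integral_cong_AE\<close>)
  also have "\<dots> = ennreal (2 * ?V)"
  proof -
    have "(\<integral>\<^sup>+ w. cone_density w + indicator (cball (0 :: real^'n) 1) w \<partial>lborel) =
      (\<integral>\<^sup>+ w. cone_density (w :: real^'n) \<partial>lborel) + (\<integral>\<^sup>+ w. indicator (cball (0 :: real^'n) 1) w \<partial>lborel)"
      by (rule nn_integral_add) auto
    also have "\<dots> = ennreal ?V + ennreal ?V"
      unfolding nn_integral_cone_density ball_vol(2)[symmetric] by simp
    also have "\<dots> = ennreal (2 * ?V)" using V by (subst ennreal_plus[symmetric]) auto
    finally show ?thesis .
  qed
  finally have "ennreal (2 * ?V) * (\<integral>\<^sup>+ w. ennreal (cone_kernel (w :: real^'n)) \<partial>lborel) = ennreal (2 * ?V) * 1"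
    by simp
  then have 1: "(\<integral>\<^sup>+ w. ennreal (cone_kernel (w :: real^'n)) \<partial>lborel) = 1"
    using V by (subst (asm) ennreal_mult_cancel_left) auto
  have "integrable lborel (cone_kernel :: real^'n \<Rightarrow> real)"
    by (rule integrableI_nonneg) (auto simp: cone_kernel_nonneg 1)
  moreover have "integral\<^sup>L lborel (cone_kernel :: real^'n \<Rightarrow> real) = 1"
    by (subst integral_eq_nn_integral) (auto simp: cone_kernel_nonneg 1)
  ultimately show ?thesis by (simp add: conv_kernel_def cone_kernel_nonneg)
qed

lemma even_fun_cone_kernel: "even_fun cone_kernel"
  by (auto simp: even_fun_def cone_kernel_def cone_density_uminus indicator_def)

lemma supp_cone_kernel: "supp (cone_kernel :: real^'n \<Rightarrow> real) \<subseteq> cball 0 1"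
proof -
  have "norm w \<le> 1" if "cone_kernel (w :: real^'n) \<noteq> 0" for w
    using that cone_density_outside[of w] by (cases "norm w \<le> 1") (auto simp: cone_kernel_def)
  then show ?thesis unfolding supp_def by (intro closure_minimal) auto
qed

section \<open>Convolution of a measure with a kernel\<close>

lemma borel_measurable_measure_conv:
  assumes "sigma_finite_measure \<mu>" "sets \<mu> = sets borel" and [measurable]: "k \<in> borel_measurable borel"
  shows "measure_conv \<mu> k \<in> borel_measurable borel"
proof -
  interpret sigma_finite_measure \<mu> by fact
  note [measurable_cong] = assms(2)
  show ?thesis unfolding measure_conv_def[abs_def] by measurable
qed

text \<open>Associativity and commutativity of convolution, by Tonelli. It moves the mollifier
  \<open>k\<close> from the measure to the function \<open>measure_conv \<mu> \<rho>\<close>, for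
  which the almost everywhere limit is available.\<close>

lemma measure_conv_swap:
  fixes \<mu> :: "(real^'n) measure"
  assumes \<mu>: "sigma_finite_measure \<mu>" "sets \<mu> = sets borel"
    and [measurable]: "k \<in> borel_measurable borel" "\<rho> \<in> borel_measurable borel"
    and nn: "\<And>x. 0 \<le> k x" "\<And>x. 0 \<le> \<rho> x"
  shows "(\<integral>\<^sup>+ w. measure_conv \<mu> k (x - w) * ennreal (\<rho> w) \<partial>lborel) =
    (\<integral>\<^sup>+ v. ennreal (k (x - v)) * measure_conv \<mu> \<rho> v \<partial>lborel)"
proof -
  interpret m: sigma_finite_measure \<mu> by fact
  interpret p: pair_sigma_finite \<mu> "lborel :: (real^'n) measure" ..
  note [measurable_cong] = \<mu>(2)
  have "(\<integral>\<^sup>+ w. measure_conv \<mu> k (x - w) * ennreal (\<rho> w) \<partial>lborel) =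
    (\<integral>\<^sup>+ w. \<integral>\<^sup>+ y. ennreal (k (x - w - y)) * ennreal (\<rho> w) \<partial>\<mu> \<partial>lborel)"
    unfolding measure_conv_def by (intro nn_integral_cong nn_integral_multc[symmetric]) measurable
  also have "\<dots> = (\<integral>\<^sup>+ y. \<integral>\<^sup>+ w. ennreal (k (x - w - y)) * ennreal (\<rho> w) \<partial>lborel \<partial>\<mu>)"
    by (rule p.Fubini') measurable
  also have "\<dots> = (\<integral>\<^sup>+ y. \<integral>\<^sup>+ v. ennreal (k (x - v)) * ennreal (\<rho> (v - y)) \<partial>lborel \<partial>\<mu>)"
  proof (rule nn_integral_cong)
    fix y
    show "(\<integral>\<^sup>+ w. ennreal (k (x - w - y)) * ennreal (\<rho> w) \<partial>lborel) =
      (\<integral>\<^sup>+ v. ennreal (k (x - v)) * ennreal (\<rho> (v - y)) \<partial>lborel)"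
      using nn_integral_lborel_translate[of "\<lambda>v. ennreal (k (x - v)) * ennreal (\<rho> (v - y))" y]
      by (simp add: algebra_simps)
  qed
  also have "\<dots> = (\<integral>\<^sup>+ v. \<integral>\<^sup>+ y. ennreal (k (x - v)) * ennreal (\<rho> (v - y)) \<partial>\<mu> \<partial>lborel)"
    by (rule p.Fubini'[symmetric]) measurable
  also have "\<dots> = (\<integral>\<^sup>+ v. ennreal (k (x - v)) * measure_conv \<mu> \<rho> v \<partial>lborel)"
    unfolding measure_conv_def by (intro nn_integral_cong nn_integral_cmult) measurable
  finally show ?thesis .
qed

text \<open>By Tonelli, the integral over the ball of radius \<open>R\<close> is at most the measure
  of the ball of radius \<open>R + \<epsilon>\<close>. Finiteness therefore holds only almost
  everywhere, even though the measure is locally finite: \<open>\<rho>\<close> need not be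
  bounded.\<close>

lemma measure_conv_L1_loc:
  fixes \<mu> :: "(real^'n) measure" and \<rho> :: "real^'n \<Rightarrow> real"
  assumes \<mu>: "sigma_finite_measure \<mu>" "sets \<mu> = sets borel" "\<And>K. compact K \<Longrightarrow> emeasure \<mu> K < \<infinity>"
    and \<rho>[measurable]: "\<rho> \<in> borel_measurable borel" and \<rho>1: "(\<integral>\<^sup>+ x. ennreal (\<rho> x) \<partial>lborel) = 1"
    and supp: "supp \<rho> \<subseteq> cball 0 \<epsilon>"
  shows "L1_loc (\<lambda>x. enn2real (measure_conv \<mu> \<rho> x))"
    "AE x in lborel. measure_conv \<mu> \<rho> x = ennreal (enn2real (measure_conv \<mu> \<rho> x))"
proof -
  interpret m: sigma_finite_measure \<mu> by fact
  interpret p: pair_sigma_finite \<mu> "lborel :: (real^'n) measure" ..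
  note [measurable_cong] = \<mu>(2)
  have H[measurable]: "measure_conv \<mu> \<rho> \<in> borel_measurable borel"
    by (rule borel_measurable_measure_conv[OF \<mu>(1,2) \<rho>])
  have fin: "(\<integral>\<^sup>+ v. indicator {..R} (norm v) * measure_conv \<mu> \<rho> v \<partial>lborel) < \<infinity>" for R
  proof -
    have "(\<integral>\<^sup>+ v. indicator {..R} (norm v) * measure_conv \<mu> \<rho> v \<partial>lborel) =
      (\<integral>\<^sup>+ v. \<integral>\<^sup>+ y. indicator {..R} (norm v) * ennreal (\<rho> (v - y)) \<partial>\<mu> \<partial>lborel)"
      unfolding measure_conv_def by (intro nn_integral_cong nn_integral_cmult[symmetric]) measurable
    also have "\<dots> = (\<integral>\<^sup>+ y. \<integral>\<^sup>+ v. indicator {..R} (norm v) * ennreal (\<rho> (v - y)) \<partial>lborel \<partial>\<mu>)"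
      by (rule p.Fubini') measurable
    also have "\<dots> \<le> (\<integral>\<^sup>+ y. indicator (cball 0 (R + \<epsilon>)) y \<partial>\<mu>)"
    proof (rule nn_integral_mono)
      fix y
      have "(\<integral>\<^sup>+ v. indicator {..R} (norm v) * ennreal (\<rho> (v - y)) \<partial>lborel) \<le>
        (\<integral>\<^sup>+ v. indicator (cball 0 (R + \<epsilon>)) y * ennreal (\<rho> (v - y)) \<partial>lborel)"
      proof (rule nn_integral_mono)
        fix v
        show "indicator {..R} (norm v) * ennreal (\<rho> (v - y)) \<le> indicator (cball 0 (R + \<epsilon>)) y * ennreal (\<rho> (v - y))"
        proof (cases "norm v \<le> R \<and> v - y \<in> supp \<rho>")
          case True
          then have "norm (v - y) \<le> \<epsilon>" using supp by auto
          then have "norm y \<le> R + \<epsilon>" using True norm_triangle_ineq3[of v y] by linarith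
          then show ?thesis by (auto simp: indicator_def)
        qed (auto simp: supp_outside)
      qed
      also have "\<dots> = indicator (cball 0 (R + \<epsilon>)) y * (\<integral>\<^sup>+ v. ennreal (\<rho> (v - y)) \<partial>lborel)"
        by (rule nn_integral_cmult) measurable
      also have "\<dots> = indicator (cball 0 (R + \<epsilon>)) y"
        using nn_integral_lborel_translate[of "\<lambda>v. ennreal (\<rho> v)" "- y"] \<rho>1 by simp
      finally show "(\<integral>\<^sup>+ v. indicator {..R} (norm v) * ennreal (\<rho> (v - y)) \<partial>lborel) \<le> indicator (cball 0 (R + \<epsilon>)) y" .
    qed
    also have "\<dots> = emeasure \<mu> (cball 0 (R + \<epsilon>))" using \<mu>(2) by (intro nn_integral_indicator) simp
    also have "\<dots> < \<infinity>" by (rule \<mu>(3)) simp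
    finally show ?thesis .
  qed
  have "AE x in lborel. \<forall>n::nat. indicator {..real n} (norm x) * measure_conv \<mu> \<rho> x \<noteq> \<infinity>"
    unfolding AE_all_countable
    by (intro allI nn_integral_noteq_infinite) (use fin in \<open>auto simp: less_top[symmetric]\<close>)
  then show "AE x in lborel. measure_conv \<mu> \<rho> x = ennreal (enn2real (measure_conv \<mu> \<rho> x))"
  proof eventually_elim
    case (elim x)
    obtain n :: nat where "norm x \<le> real n" using real_arch_simple by blast
    then have "measure_conv \<mu> \<rho> x \<noteq> \<infinity>" using elim[rule_format, of n] by simp
    then show ?case by (simp add: ennreal_enn2real_if)
  qed
  show "L1_loc (\<lambda>x. enn2real (measure_conv \<mu> \<rho> x))"
    unfolding L1_loc_def set_integrable_def
  proof (intro allI impI)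
    fix K :: "(real^'n) set" assume K: "compact K"
    then obtain R where R: "\<And>x. x \<in> K \<Longrightarrow> norm x \<le> R"
      using compact_imp_bounded[OF K] unfolding bounded_iff by blast
    have [measurable]: "K \<in> sets borel" using K by (simp add: compact_imp_closed borel_closed)
    have "integrable lborel (\<lambda>x. indicat_real K x *\<^sub>R enn2real (measure_conv \<mu> \<rho> x))"
    proof (rule integrableI_nonneg)
      have "(\<integral>\<^sup>+ x. ennreal (indicat_real K x *\<^sub>R enn2real (measure_conv \<mu> \<rho> x)) \<partial>lborel) \<le>
        (\<integral>\<^sup>+ v. indicator {..R} (norm v) * measure_conv \<mu> \<rho> v \<partial>lborel)"
        using R by (intro nn_integral_mono) (auto simp: indicator_def ennreal_enn2real_if)
      then show "(\<integral>\<^sup>+ x. ennreal (indicat_real K x *\<^sub>R enn2real (measure_conv \<mu> \<rho> x)) \<partial>lborel) < \<infinity>"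
        using fin[of R] by (rule le_less_trans)
    qed auto
    then show "integrable lebesgue (\<lambda>x. indicat_real K x *\<^sub>R enn2real (measure_conv \<mu> \<rho> x))"
      by (subst integrable_completion) auto
  qed
qed

section \<open>The estimate for mollified vector fields\<close>

lemma test_fun_partial:
  fixes k :: "real^'n \<Rightarrow> real"
  assumes "test_fun k"
  shows "test_fun (partial j k)"
  unfolding test_fun_def
proof
  have "C_k n (partial j k)" for n
  proof -
    have "C_k (Suc n) k" using assms unfolding test_fun_def smooth_def by blast
    then show ?thesis unfolding partial_def[abs_def] by simp
  qed
  then show "smooth (partial j k)" by (simp add: smooth_def)
  have "x \<in> supp k" if "partial j k x \<noteq> 0" for x
    using that grad_outside_supp[of x k] by (auto simp: grad_def vec_eq_iff)
  then have "supp (partial j k) \<subseteq> supp k"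
    unfolding supp_def[of "partial j k"] by (intro closure_minimal) (auto simp: supp_def)
  then show "compact (supp (partial j k))"
    using assms unfolding test_fun_def
    by (metis closed_closure closed_Int_compact inf.absorb_iff1 supp_def)
qed

lemma grad_conv_component:
  fixes f k :: "real^'n \<Rightarrow> real"
  assumes "L1_loc f" "test_fun k"
  shows "grad (conv f k) x $ j = conv f (partial j k) x"
  using integral_inner_left[OF test_fun_integrable_conv(2)[OF assms, of x], of "axis j 1"]
  unfolding grad_conv[OF assms] conv_def by (simp add: inner_axis grad_def)

lemma continuous_grad_conv:
  fixes f k :: "real^'n \<Rightarrow> real"
  assumes "L1_loc f" "test_fun k"
  shows "continuous_on UNIV (grad (conv f k))"
proof -
  have "grad (conv f k) = (\<lambda>x. \<chi> j. conv f (partial j k) x)"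
    by (auto simp: fun_eq_iff vec_eq_iff grad_conv_component[OF assms])
  then show ?thesis
    using continuous_conv[OF assms(1) test_fun_partial[OF assms(2)]]
    by (simp add: continuous_on_vec_lambda)
qed

lemma abs_diff_le_nn_integral_grad:
  fixes f :: "real^'n \<Rightarrow> real"
  assumes d: "\<And>x. f differentiable (at x)" and c: "continuous_on UNIV (grad f)"
  shows "ennreal \<bar>f x - f (x - z)\<bar> \<le> (\<integral>\<^sup>+ s. indicator {0<..1::real} s * ennreal \<bar>grad f (x - s *\<^sub>R z) \<bullet> z\<bar> \<partial>lborel)"
proof -
  define D where "D s = - (grad f (x - s *\<^sub>R z) \<bullet> z)" for s
  have der: "((\<lambda>s. f (x - s *\<^sub>R z)) has_real_derivative D s) (at s)" for s
  proof -
    have "((\<lambda>s. f (x - s *\<^sub>R z)) has_derivative (\<lambda>t. grad f (x - s *\<^sub>R z) \<bullet> (- (t *\<^sub>R z)))) (at s)"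
      by (rule has_derivative_compose[OF _ has_derivative_grad[OF d]]) (auto intro!: derivative_eq_intros)
    then show ?thesis
      unfolding has_field_derivative_def D_def
      by (rule has_derivative_eq_rhs) (simp add: fun_eq_iff mult.commute)
  qed
  have Dc: "continuous_on UNIV D"
    unfolding D_def
    by (intro continuous_intros continuous_on_compose2[OF c]) auto
  have "has_bochner_integral lborel (\<lambda>s. D s * indicator {0..1} s) (f (x - 1 *\<^sub>R z) - f (x - 0 *\<^sub>R z))"
    by (rule has_bochner_integral_FTC_Icc_real[where F="\<lambda>s. f (x - s *\<^sub>R z)"])
      (use der Dc in \<open>auto simp: continuous_on_eq_continuous_at\<close>)
  then have "ennreal \<bar>f x - f (x - z)\<bar> \<le> (\<integral>\<^sup>+ s. ennreal (norm (D s * indicator {0..1} s)) \<partial>lborel)"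
    using has_bochner_integral_norm_bound by (fastforce simp: abs_minus_commute)
  also have "\<dots> = (\<integral>\<^sup>+ s. indicator {0<..1::real} s * ennreal \<bar>grad f (x - s *\<^sub>R z) \<bullet> z\<bar> \<partial>lborel)"
  proof (rule nn_integral_cong_AE)
    \<comment> \<open>The endpoint 0 is dropped to match \<open>nn_integral_segments\<close>, whose
      substitution divides by \<open>s\<close>.\<close>
    have "AE s in lborel. s \<noteq> (0::real)" by (rule AE_lborel_singleton)
    then show "AE s in lborel. ennreal (norm (D s * indicator {0..1} s)) =
      indicator {0<..1::real} s * ennreal \<bar>grad f (x - s *\<^sub>R z) \<bullet> z\<bar>"
      by eventually_elim (auto simp: D_def indicator_def)
  qed
  finally show ?thesis .
qed

text \<open>Along the segment the derivative is at most \<open>norm z\<close> times the sum of the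
  absolute values of \<open>CARD('n)\<close> partial derivatives, each bounded by the mollified
  variation.\<close>

lemma abs_conv_component_diff_le:
  fixes b :: "real^'n \<Rightarrow> real^'n"
  assumes b: "L1_loc b" and D: "distr_derivative b D" and k: "test_fun k" "\<And>x. 0 \<le> k x"
  shows "ennreal \<bar>conv (\<lambda>y. b y $ i) k x - conv (\<lambda>y. b y $ i) k (x - z)\<bar> \<le>
    ennreal (real CARD('n) * norm z) *
    (\<integral>\<^sup>+ s. indicator {0<..1::real} s * measure_conv (variation_measure D) k (x - s *\<^sub>R z) \<partial>lborel)"
proof -
  let ?f = "conv (\<lambda>y. b y $ i) k" and ?m = "measure_conv (variation_measure D) k"
  have rD: "vector_radon_measure D" using D by (simp add: distr_derivative_def)
  have [measurable]: "k \<in> borel_measurable borel"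
    using test_fun_continuous[OF k(1)] by (rule borel_measurable_continuous_onI)
  have [measurable]: "?m \<in> borel_measurable borel"
    by (rule borel_measurable_measure_conv[OF sigma_finite_variation_measure[OF rD]]) auto
  note bi = L1_loc_component[OF b, of i]
  have diff: "?f differentiable (at x)" for x
    using has_derivative_conv[OF bi k(1)] by (auto simp: differentiable_def)
  have g: "ennreal \<bar>grad ?f p \<bullet> z\<bar> \<le> ennreal (real CARD('n) * norm z) * ?m p" for p
  proof -
    have "\<bar>grad ?f p \<bullet> z\<bar> \<le> (\<Sum>j\<in>UNIV. \<bar>grad ?f p $ j\<bar> * norm z)"
      unfolding inner_vec_def
      by (rule order_trans[OF sum_abs])
        (auto simp: abs_mult intro!: sum_mono mult_left_mono component_le_norm_cart)
    then have "ennreal \<bar>grad ?f p \<bullet> z\<bar> \<le> ennreal (\<Sum>j\<in>UNIV. \<bar>grad ?f p $ j\<bar> * norm z)"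
      by (rule ennreal_leI)
    also have "\<dots> = (\<Sum>j\<in>UNIV. ennreal \<bar>grad ?f p $ j\<bar> * ennreal (norm z))"
      by (subst sum_ennreal[symmetric]) (auto simp: ennreal_mult)
    also have "\<dots> \<le> (\<Sum>j\<in>(UNIV::'n set). ?m p * ennreal (norm z))"
      by (intro sum_mono mult_right_mono abs_grad_conv_component_le[OF b D k]) auto
    also have "\<dots> = ennreal (real CARD('n) * norm z) * ?m p"
      by (simp add: ennreal_mult ennreal_of_nat_eq_real_of_nat ac_simps)
    finally show ?thesis .
  qed
  have "ennreal \<bar>?f x - ?f (x - z)\<bar> \<le> (\<integral>\<^sup>+ s. indicator {0<..1::real} s * ennreal \<bar>grad ?f (x - s *\<^sub>R z) \<bullet> z\<bar> \<partial>lborel)"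
    by (rule abs_diff_le_nn_integral_grad[OF diff continuous_grad_conv[OF bi k(1)]])
  also have "\<dots> \<le> (\<integral>\<^sup>+ s. ennreal (real CARD('n) * norm z) * (indicator {0<..1::real} s * ?m (x - s *\<^sub>R z)) \<partial>lborel)"
  proof (rule nn_integral_mono)
    fix s :: real
    show "indicator {0<..1} s * ennreal \<bar>grad ?f (x - s *\<^sub>R z) \<bullet> z\<bar> \<le>
      ennreal (real CARD('n) * norm z) * (indicator {0<..1} s * ?m (x - s *\<^sub>R z))"
      using g[of "x - s *\<^sub>R z"] by (cases "s \<in> {0<..1}") auto
  qed
  also have "\<dots> = ennreal (real CARD('n) * norm z) * (\<integral>\<^sup>+ s. indicator {0<..1::real} s * ?m (x - s *\<^sub>R z) \<partial>lborel)"
    by (rule nn_integral_cmult) measurable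
  finally show ?thesis .
qed

text \<open>Dominates the integrand of the commutator once \<open>u\<close> is split off. The
  difference of the vector fields is measured by the sum over components because each component is
  estimated on its own.\<close>

definition commutator_bound ::
  "(real^'n \<Rightarrow> real^'n) \<Rightarrow> (real^'n \<Rightarrow> real) \<Rightarrow> (real^'n \<Rightarrow> real) \<Rightarrow> real^'n \<Rightarrow> real^'n \<Rightarrow> real" where
  "commutator_bound b g k x y =
    (\<Sum>i\<in>UNIV. \<bar>b x $ i - b y $ i\<bar>) * norm (grad k (x - y)) + k (x - y) * \<bar>g y\<bar>"

text \<open>\<open>AE_cone_kernel\<close> at scale \<open>\<epsilon>\<close>; the factor
  \<open>\<epsilon> ^ CARD('n)\<close> is the one by which \<open>rescale\<close> divides.\<close>

lemma nn_integral_scaled_cone_kernel: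
  fixes G :: "real^'n \<Rightarrow> ennreal"
  assumes [measurable]: "G \<in> borel_measurable borel" and \<epsilon>: "\<epsilon> > 0"
  shows "(\<integral>\<^sup>+ w. G w * (cone_density (w /\<^sub>R \<epsilon>) + indicator (cball 0 \<epsilon>) w) \<partial>lborel) =
    ennreal (2 * ball_vol TYPE('n) * \<epsilon> ^ CARD('n)) * (\<integral>\<^sup>+ w. G w * ennreal (rescale cone_kernel \<epsilon> w) \<partial>lborel)"
proof -
  let ?V = "ball_vol TYPE('n)"
  have V: "?V > 0" by (rule ball_vol)
  have "(\<integral>\<^sup>+ w. G w * (cone_density (w /\<^sub>R \<epsilon>) + indicator (cball 0 \<epsilon>) w) \<partial>lborel) =
    (\<integral>\<^sup>+ w. G w * (cone_density (w /\<^sub>R \<epsilon>) + indicator (cball 0 1) (w /\<^sub>R \<epsilon>)) \<partial>lborel)"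
    using \<epsilon> by (intro nn_integral_cong) (auto simp: indicator_def field_simps)
  also have "\<dots> = ennreal (\<bar>\<epsilon>\<bar> ^ CARD('n)) * (\<integral>\<^sup>+ w. G (\<epsilon> *\<^sub>R w) * (cone_density w + indicator (cball 0 1) w) \<partial>lborel)"
    using \<epsilon> by (subst nn_integral_lborel_affine[where c=\<epsilon> and t=0]) auto
  also have "(\<integral>\<^sup>+ w. G (\<epsilon> *\<^sub>R w) * (cone_density w + indicator (cball 0 1) w) \<partial>lborel) =
    (\<integral>\<^sup>+ w. G (\<epsilon> *\<^sub>R w) * (ennreal (2 * ?V) * ennreal (cone_kernel w)) \<partial>lborel)"
    by (intro nn_integral_cong_AE) (use AE_cone_kernel in \<open>eventually_elim, simp\<close>)
  also have "ennreal (\<bar>\<epsilon>\<bar> ^ CARD('n)) * \<dots> = (\<integral>\<^sup>+ w. G w * (ennreal (2 * ?V) * ennreal (cone_kernel (w /\<^sub>R \<epsilon>))) \<partial>lborel)"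
    using \<epsilon> by (subst (2) nn_integral_lborel_affine[where c=\<epsilon> and t=0]) auto
  also have "\<dots> = (\<integral>\<^sup>+ w. ennreal (2 * ?V * \<epsilon> ^ CARD('n)) * (G w * ennreal (rescale cone_kernel \<epsilon> w)) \<partial>lborel)"
  proof (rule nn_integral_cong)
    fix w :: "real^'n"
    have "ennreal (2 * ?V) * ennreal (cone_kernel (w /\<^sub>R \<epsilon>)) = ennreal (2 * ?V * \<epsilon> ^ CARD('n)) * ennreal (rescale cone_kernel \<epsilon> w)"
      using V \<epsilon> cone_kernel_nonneg[of "w /\<^sub>R \<epsilon>"]
      by (subst (1 2) ennreal_mult[symmetric]) (auto simp: rescale_def)
    then show "G w * (ennreal (2 * ?V) * ennreal (cone_kernel (w /\<^sub>R \<epsilon>))) =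
      ennreal (2 * ?V * \<epsilon> ^ CARD('n)) * (G w * ennreal (rescale cone_kernel \<epsilon> w))"
      by (simp add: ac_simps)
  qed
  also have "\<dots> = ennreal (2 * ?V * \<epsilon> ^ CARD('n)) * (\<integral>\<^sup>+ w. G w * ennreal (rescale cone_kernel \<epsilon> w) \<partial>lborel)"
    by (rule nn_integral_cmult) measurable
  finally show ?thesis .
qed

text \<open>With \<open>y = x - z\<close>, both summands of the bound become integrals of the
  mollified variation: the first with weight \<open>cone_density\<close> through the segments, the
  second with the indicator of the ball. Together the weights form the cone kernel. \<open>A\<close>
  will be of order \<open>1 / \<epsilon> ^ CARD('n)\<close>.\<close>

lemma nn_integral_commutator_bound_smooth:
  fixes b :: "real^'n \<Rightarrow> real^'n"
  assumes b: "L1_loc b" and D: "distr_derivative b D" and g: "distr_div b g" "L1_loc g"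
    and k: "test_fun k" "\<And>x. 0 \<le> k x"
    and \<kappa>: "test_fun \<kappa>" "\<And>z. 0 \<le> \<kappa> z" "\<And>z. \<kappa> z \<le> A * indicat_real (cball 0 \<epsilon>) z"
      "\<And>z. norm z * norm (grad \<kappa> z) \<le> A * indicat_real (cball 0 \<epsilon>) z"
    and A: "0 \<le> A" and \<epsilon>: "\<epsilon> > 0"
  shows "(\<integral>\<^sup>+ y. ennreal (commutator_bound (\<lambda>y. \<chi> i. conv (\<lambda>y. b y $ i) k y) (conv g k) \<kappa> x y) \<partial>lborel) \<le>
    ennreal (2 * ball_vol TYPE('n) * \<epsilon> ^ CARD('n) * (real CARD('n))\<^sup>2 * A) *
      (\<integral>\<^sup>+ v. ennreal (k (x - v)) * measure_conv (variation_measure D) (rescale cone_kernel \<epsilon>) v \<partial>lborel)"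
proof -
  let ?m = "measure_conv (variation_measure D) k" and ?d = "real CARD('n)" and ?V = "ball_vol TYPE('n)"
  define B where "B i = conv (\<lambda>y. b y $ i) k" for i
  define K where "K = ennreal (?d\<^sup>2 * A)"
  define J where "J z = (\<integral>\<^sup>+ s. indicator {0<..1::real} s * ?m (x - s *\<^sub>R z) \<partial>lborel)" for z
  have rD: "vector_radon_measure D" using D by (simp add: distr_derivative_def)
  note sf = sigma_finite_variation_measure[OF rD]
  have km[measurable]: "k \<in> borel_measurable borel"
    using test_fun_continuous[OF k(1)] by (rule borel_measurable_continuous_onI)
  have [measurable]: "?m \<in> borel_measurable borel"
    by (rule borel_measurable_measure_conv[OF sf]) auto
  have [measurable]: "J \<in> borel_measurable borel" unfolding J_def[abs_def] by measurable
  have d1: "1 \<le> ?d" by (simp add: Suc_leI)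
  have Bm: "B i \<in> borel_measurable borel" for i
    unfolding B_def using continuous_conv[OF L1_loc_component[OF b] k(1)] by (rule borel_measurable_continuous_onI)
  have gm: "conv g k \<in> borel_measurable borel"
    using continuous_conv[OF g(2) k(1)] by (rule borel_measurable_continuous_onI)
  have \<kappa>m: "\<kappa> \<in> borel_measurable borel" "grad \<kappa> \<in> borel_measurable borel"
    using test_fun_continuous[OF \<kappa>(1)] test_fun_continuous_grad[OF \<kappa>(1)]
    by (auto intro: borel_measurable_continuous_onI)
  note [measurable] = Bm gm \<kappa>m
  have pt: "ennreal (commutator_bound (\<lambda>y. \<chi> i. B i y) (conv g k) \<kappa> x (x - z)) \<le>
    K * (indicator (cball 0 \<epsilon>) z * J z + indicator (cball 0 \<epsilon>) z * ?m (x - z))" for z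
  proof -
    have "ennreal ((\<Sum>i\<in>UNIV. \<bar>B i x - B i (x - z)\<bar>) * norm (grad \<kappa> z)) =
      (\<Sum>i\<in>UNIV. ennreal \<bar>B i x - B i (x - z)\<bar>) * ennreal (norm (grad \<kappa> z))"
      by (subst ennreal_mult) (auto intro: sum_nonneg simp: sum_ennreal)
    also have "\<dots> \<le> (\<Sum>i\<in>(UNIV::'n set). ennreal (?d * norm z) * J z) * ennreal (norm (grad \<kappa> z))"
      unfolding B_def J_def
      by (intro mult_right_mono sum_mono abs_conv_component_diff_le[OF b D k]) auto
    also have "\<dots> = ennreal (?d\<^sup>2 * (norm z * norm (grad \<kappa> z))) * J z"
      by (simp add: ennreal_mult ennreal_of_nat_eq_real_of_nat power2_eq_square ac_simps)
    \<comment> \<open>The length \<open>norm z\<close> of the segment compensates for the size of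
      the gradient; the hypotheses control only this product.\<close>
    also have "\<dots> \<le> ennreal (?d\<^sup>2 * (A * indicat_real (cball 0 \<epsilon>) z)) * J z"
      by (intro mult_right_mono ennreal_leI mult_left_mono \<kappa>) auto
    also have "\<dots> = K * (indicator (cball 0 \<epsilon>) z * J z)"
      by (auto simp: K_def indicator_def)
    finally have 1: "ennreal ((\<Sum>i\<in>UNIV. \<bar>B i x - B i (x - z)\<bar>) * norm (grad \<kappa> z)) \<le> K * (indicator (cball 0 \<epsilon>) z * J z)" .
    have "ennreal (\<kappa> z * \<bar>conv g k (x - z)\<bar>) = ennreal (\<kappa> z) * ennreal \<bar>conv g k (x - z)\<bar>"
      by (intro ennreal_mult \<kappa>) auto
    also have "\<dots> \<le> ennreal (A * indicat_real (cball 0 \<epsilon>) z) * (of_nat CARD('n) * ?m (x - z))"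
      by (intro mult_mono ennreal_leI \<kappa> abs_conv_div_le[OF b D g(1) k]) auto
    also have "\<dots> = ennreal (?d * A) * (indicator (cball 0 \<epsilon>) z * ?m (x - z))"
      using A by (auto simp: indicator_def ennreal_mult ennreal_of_nat_eq_real_of_nat ac_simps)
    \<comment> \<open>One dimension factor would do for the divergence; it is enlarged to the square
      so that both summands carry the constant \<open>K\<close>.\<close>
    also have "\<dots> \<le> K * (indicator (cball 0 \<epsilon>) z * ?m (x - z))"
      unfolding K_def power2_eq_square using A d1
      by (intro mult_right_mono ennreal_leI) auto
    finally have 2: "ennreal (\<kappa> z * \<bar>conv g k (x - z)\<bar>) \<le> K * (indicator (cball 0 \<epsilon>) z * ?m (x - z))" .
    have "ennreal (commutator_bound (\<lambda>y. \<chi> i. B i y) (conv g k) \<kappa> x (x - z)) =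
      ennreal ((\<Sum>i\<in>UNIV. \<bar>B i x - B i (x - z)\<bar>) * norm (grad \<kappa> z)) + ennreal (\<kappa> z * \<bar>conv g k (x - z)\<bar>)"
      unfolding commutator_bound_def using \<kappa>(2)
      by (subst ennreal_plus[symmetric]) (auto intro!: mult_nonneg_nonneg sum_nonneg)
    also have "\<dots> \<le> K * (indicator (cball 0 \<epsilon>) z * J z) + K * (indicator (cball 0 \<epsilon>) z * ?m (x - z))"
      by (rule add_mono[OF 1 2])
    finally show ?thesis by (simp add: distrib_left)
  qed
  have "(\<integral>\<^sup>+ y. ennreal (commutator_bound (\<lambda>y. \<chi> i. B i y) (conv g k) \<kappa> x y) \<partial>lborel) =
    (\<integral>\<^sup>+ z. ennreal (commutator_bound (\<lambda>y. \<chi> i. B i y) (conv g k) \<kappa> x (x - z)) \<partial>lborel)"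
  proof (rule nn_integral_lborel_reflect[symmetric])
    show "(\<lambda>y. ennreal (commutator_bound (\<lambda>y. \<chi> i. B i y) (conv g k) \<kappa> x y)) \<in> borel_measurable borel"
      unfolding commutator_bound_def vec_lambda_beta by measurable
  qed
  also have "\<dots> \<le> (\<integral>\<^sup>+ z. K * (indicator (cball 0 \<epsilon>) z * J z + indicator (cball 0 \<epsilon>) z * ?m (x - z)) \<partial>lborel)"
    by (intro nn_integral_mono pt)
  also have "\<dots> = K * (\<integral>\<^sup>+ z. indicator (cball 0 \<epsilon>) z * J z + indicator (cball 0 \<epsilon>) z * ?m (x - z) \<partial>lborel)"
    by (rule nn_integral_cmult) measurable
  also have "(\<integral>\<^sup>+ z. indicator (cball 0 \<epsilon>) z * J z + indicator (cball 0 \<epsilon>) z * ?m (x - z) \<partial>lborel) =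
    (\<integral>\<^sup>+ z. indicator (cball 0 \<epsilon>) z * J z \<partial>lborel) + (\<integral>\<^sup>+ z. indicator (cball 0 \<epsilon>) z * ?m (x - z) \<partial>lborel)"
    by (rule nn_integral_add) measurable
  also have "(\<integral>\<^sup>+ z. indicator (cball 0 \<epsilon>) z * J z \<partial>lborel) = (\<integral>\<^sup>+ w. ?m (x - w) * cone_density (w /\<^sub>R \<epsilon>) \<partial>lborel)"
    unfolding J_def by (rule nn_integral_segments[OF _ \<epsilon>]) measurable
  also have "\<dots> + (\<integral>\<^sup>+ z. indicator (cball 0 \<epsilon>) z * ?m (x - z) \<partial>lborel) =
    (\<integral>\<^sup>+ w. ?m (x - w) * cone_density (w /\<^sub>R \<epsilon>) + indicator (cball 0 \<epsilon>) w * ?m (x - w) \<partial>lborel)"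
    by (rule nn_integral_add[symmetric]) measurable
  also have "\<dots> = (\<integral>\<^sup>+ w. ?m (x - w) * (cone_density (w /\<^sub>R \<epsilon>) + indicator (cball 0 \<epsilon>) w) \<partial>lborel)"
    by (simp add: distrib_left mult.commute)
  also have "\<dots> = ennreal (2 * ?V * \<epsilon> ^ CARD('n)) * (\<integral>\<^sup>+ w. ?m (x - w) * ennreal (rescale cone_kernel \<epsilon> w) \<partial>lborel)"
    by (rule nn_integral_scaled_cone_kernel[OF _ \<epsilon>]) measurable
  also have "(\<integral>\<^sup>+ w. ?m (x - w) * ennreal (rescale cone_kernel \<epsilon> w) \<partial>lborel) =
    (\<integral>\<^sup>+ v. ennreal (k (x - v)) * measure_conv (variation_measure D) (rescale cone_kernel \<epsilon>) v \<partial>lborel)"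
    by (rule measure_conv_swap[OF sf]) (auto intro: rescale_nonneg cone_kernel_nonneg \<epsilon> k)
  also have "K * (ennreal (2 * ?V * \<epsilon> ^ CARD('n)) * \<dots>) = ennreal (2 * ?V * \<epsilon> ^ CARD('n) * ?d\<^sup>2 * A) * \<dots>"
    using A \<epsilon> ball_vol(1)[where 'n='n] by (simp add: K_def ennreal_mult ac_simps)
  finally show ?thesis unfolding B_def .
qed

section \<open>The commutator estimate\<close>

lemma test_fun_kernel_bounds:
  fixes \<theta> :: "real^'n \<Rightarrow> real"
  assumes \<theta>: "test_fun \<theta>" "supp \<theta> \<subseteq> cball 0 1"
  obtains M where "0 \<le> M" "\<And>z. \<theta> z \<le> M" "\<And>z. norm z * norm (grad \<theta> z) \<le> M"
proof -
  have K: "compact (supp \<theta>)" using \<theta>(1) by (simp add: test_fun_def)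
  obtain M1 where M1: "0 \<le> M1" "\<And>z. norm (\<theta> z) \<le> M1"
    using bounded_of_compact_support[OF test_fun_continuous[OF \<theta>(1)] K] supp_outside by blast
  obtain M2 where M2: "0 \<le> M2" "\<And>z. norm (grad \<theta> z) \<le> M2"
    using bounded_of_compact_support[OF test_fun_continuous_grad[OF \<theta>(1)] K] grad_outside_supp by blast
  show thesis
  proof
    show "0 \<le> max M1 M2" using M1 by simp
    show "\<theta> z \<le> max M1 M2" for z using M1(2)[of z] by simp
    show "norm z * norm (grad \<theta> z) \<le> max M1 M2" for z
    proof (cases "z \<in> supp \<theta>")
      case True
      then have "norm z * norm (grad \<theta> z) \<le> 1 * M2"
        using \<theta>(2) M2 by (intro mult_mono) auto
      then show ?thesis by simp
    qed (use M1 in \<open>simp add: grad_outside_supp\<close>)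
  qed
qed

text \<open>The product of \<open>norm z\<close> and the gradient scales exactly like the kernel
  itself: the \<open>1 / \<epsilon>\<close> of the derivative is absorbed by \<open>norm z\<close>.
  This makes the final constant independent of \<open>\<epsilon>\<close>.\<close>

lemma rescale_kernel_bounds:
  fixes \<theta> :: "real^'n \<Rightarrow> real"
  assumes \<theta>: "test_fun \<theta>" "supp \<theta> \<subseteq> cball 0 1" and \<epsilon>: "\<epsilon> > 0"
    and M: "\<And>z. \<theta> z \<le> M" "\<And>z. norm z * norm (grad \<theta> z) \<le> M"
  shows "rescale \<theta> \<epsilon> z \<le> M / \<epsilon> ^ CARD('n) * indicat_real (cball 0 \<epsilon>) z"
    "norm z * norm (grad (rescale \<theta> \<epsilon>) z) \<le> M / \<epsilon> ^ CARD('n) * indicat_real (cball 0 \<epsilon>) z"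
proof -
  have s: "supp (rescale \<theta> \<epsilon>) \<subseteq> cball 0 \<epsilon>" by (rule supp_rescale[OF \<theta>(2) \<epsilon>])
  show "rescale \<theta> \<epsilon> z \<le> M / \<epsilon> ^ CARD('n) * indicat_real (cball 0 \<epsilon>) z"
  proof (cases "z \<in> cball 0 \<epsilon>")
    case True
    then show ?thesis using M(1)[of "z /\<^sub>R \<epsilon>"] \<epsilon> by (simp add: rescale_def divide_right_mono)
  next
    case False
    then have "z \<notin> supp (rescale \<theta> \<epsilon>)" using s by blast
    then show ?thesis using False by (simp add: supp_outside)
  qed
  show "norm z * norm (grad (rescale \<theta> \<epsilon>) z) \<le> M / \<epsilon> ^ CARD('n) * indicat_real (cball 0 \<epsilon>) z"
  proof (cases "z \<in> cball 0 \<epsilon>")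
    case True
    have "norm z * norm (grad (rescale \<theta> \<epsilon>) z) =
      norm (z /\<^sub>R \<epsilon>) * norm (grad \<theta> (z /\<^sub>R \<epsilon>)) / \<epsilon> ^ CARD('n)"
      using \<epsilon> by (simp add: grad_rescale[OF \<theta>(1)] field_simps)
    also have "\<dots> \<le> M / \<epsilon> ^ CARD('n)" using M(2)[of "z /\<^sub>R \<epsilon>"] \<epsilon> by (intro divide_right_mono) auto
    finally show ?thesis using True by simp
  next
    case False
    then have "z \<notin> supp (rescale \<theta> \<epsilon>)" using s by blast
    then show ?thesis using False by (simp add: grad_outside_supp)
  qed
qed

text \<open>The convergence set of the mollifications serves twice: \<open>x\<close> is taken from
  it, and for this fixed \<open>x\<close> almost every relevant \<open>y\<close> lies in it too. So
  the integrand converges for almost every \<open>y\<close>, and Fatou's lemma applies. Sequences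
  depend on the ball of radius \<open>N\<close>; countably many exceptional null sets are
  discarded.\<close>

lemma AE_nn_integral_commutator_bound_le:
  fixes b :: "real^'n \<Rightarrow> real^'n"
  assumes b: "L1_loc b" and D: "distr_derivative b D" and g: "distr_div b g" "L1_loc g"
    and \<theta>: "test_fun \<theta>" "conv_kernel \<theta>" "supp \<theta> \<subseteq> cball 0 1"
    and M: "0 \<le> M" "\<And>z. \<theta> z \<le> M" "\<And>z. norm z * norm (grad \<theta> z) \<le> M" and \<epsilon>: "\<epsilon> > 0"
  shows "AE x in lebesgue. (\<integral>\<^sup>+ y. ennreal (commutator_bound b g (rescale \<theta> \<epsilon>) x y) \<partial>lebesgue) \<le>
    ennreal (2 * ball_vol TYPE('n) * (real CARD('n))\<^sup>2 * M) *
      measure_conv (variation_measure D) (rescale cone_kernel \<epsilon>) x"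
proof -
  let ?\<mu> = "variation_measure D" and ?\<kappa> = "rescale \<theta> \<epsilon>"
  define C where "C = ennreal (2 * ball_vol TYPE('n) * (real CARD('n))\<^sup>2 * M)"
  define H where "H = measure_conv ?\<mu> (rescale cone_kernel \<epsilon>)"
  define h where "h x = enn2real (H x)" for x
  have rD: "vector_radon_measure D" using D by (simp add: distr_derivative_def)
  note sf = sigma_finite_variation_measure[OF rD]
  have \<theta>0: "0 \<le> \<theta> x" for x using \<theta>(2) by (simp add: conv_kernel_def)
  have Hh: "L1_loc h" "AE x in lborel. H x = ennreal (h x)"
    using measure_conv_L1_loc[OF sf sets_variation_measure emeasure_variation_measure_compact[OF rD]
        borel_measurable_rescale[OF borel_measurable_cone_kernel] nn_integral_rescale_kernel[OF conv_kernel_cone_kernel \<epsilon>]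
        supp_rescale[OF supp_cone_kernel \<epsilon>]]
    unfolding H_def h_def by auto
  have \<kappa>: "test_fun ?\<kappa>" "\<And>z. 0 \<le> ?\<kappa> z" "supp ?\<kappa> \<subseteq> cball 0 \<epsilon>"
    using test_fun_rescale[OF \<theta>(1) \<epsilon>] rescale_nonneg[OF \<theta>0 \<epsilon>] supp_rescale[OF \<theta>(3) \<epsilon>] by auto
  define F where "F = insert g (insert h (range (\<lambda>i y. b y $ i)))"
  have F: "finite F" "f \<in> F \<Longrightarrow> L1_loc f" for f
    using g(2) Hh(1) L1_loc_component[OF b] by (auto simp: F_def)
  have smooth_le: "(\<integral>\<^sup>+ y. ennreal (commutator_bound (\<lambda>y. \<chi> i. conv (\<lambda>y. b y $ i) k y) (conv g k) ?\<kappa> x y) \<partial>lebesgue)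
    \<le> C * ennreal (conv h k x)" if k: "test_fun k" "\<And>x. 0 \<le> k x" for k x
  proof -
    \<comment> \<open>The volume factor from the averaging kernel cancels the
      \<open>1 / \<epsilon> ^ CARD('n)\<close> in the bounds for the rescaled
      \<open>\<theta>\<close>.\<close>
    have c: "2 * ball_vol TYPE('n) * \<epsilon> ^ CARD('n) * (real CARD('n))\<^sup>2 * (M / \<epsilon> ^ CARD('n)) =
      2 * ball_vol TYPE('n) * (real CARD('n))\<^sup>2 * M"
      using \<epsilon> by simp
    have "(\<integral>\<^sup>+ y. ennreal (commutator_bound (\<lambda>y. \<chi> i. conv (\<lambda>y. b y $ i) k y) (conv g k) ?\<kappa> x y) \<partial>lebesgue) \<le>
      C * (\<integral>\<^sup>+ v. ennreal (k (x - v)) * H v \<partial>lborel)"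
      unfolding nn_integral_completion C_def H_def c[symmetric]
      by (rule nn_integral_commutator_bound_smooth[OF b D g k \<kappa>(1,2) rescale_kernel_bounds[OF \<theta>(1,3) \<epsilon> M(2,3)] _ \<epsilon>])
        (use M(1) \<epsilon> in auto)
    also have "(\<integral>\<^sup>+ v. ennreal (k (x - v)) * H v \<partial>lborel) = (\<integral>\<^sup>+ v. ennreal (h v * k (x - v)) \<partial>lborel)"
    proof (rule nn_integral_cong_AE)
      show "AE v in lborel. ennreal (k (x - v)) * H v = ennreal (h v * k (x - v))"
        using Hh(2) by eventually_elim (simp add: ennreal_mult k(2) h_def mult.commute)
    qed
    also have "\<dots> = (\<integral>\<^sup>+ v. ennreal (h v * k (x - v)) \<partial>lebesgue)"
      by (rule nn_integral_completion[symmetric])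
    also have "\<dots> = ennreal (conv h k x)"
      unfolding conv_def
      by (rule nn_integral_eq_integral[OF test_fun_integrable_conv(1)[OF Hh(1) k(1)]]) (auto simp: h_def k(2))
    finally show ?thesis .
  qed
  have "AE x in lebesgue. norm x \<le> real N \<longrightarrow>
    (\<integral>\<^sup>+ y. ennreal (commutator_bound b g ?\<kappa> x y) \<partial>lebesgue) \<le> C * H x" for N :: nat
  proof -
    \<comment> \<open>For \<open>norm x \<le> real N\<close>, the points \<open>y\<close> that
      matter are within \<open>\<epsilon>\<close> of \<open>x\<close>, hence the larger
      radius.\<close>
    obtain \<delta> where \<delta>: "\<And>n::nat. 0 < \<delta> n" and good: "AE x in lebesgue. norm x \<le> real N + \<epsilon> \<longrightarrow>
      (\<forall>f\<in>F. (\<lambda>n. conv f (rescale \<theta> (\<delta> n)) x) \<longlonglongrightarrow> f x)"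
      using mollification_AE_subsequence[OF F \<theta>, of "real N + \<epsilon>"] by blast
    define k where "k n = rescale \<theta> (\<delta> n)" for n
    have k: "test_fun (k n)" "0 \<le> k n x" for n x
      unfolding k_def by (auto intro: test_fun_rescale[OF \<theta>(1) \<delta>] rescale_nonneg[OF \<theta>0 \<delta>])
    show ?thesis
      using good
    proof eventually_elim
      case (elim x)
      show ?case
      proof
        assume x: "norm x \<le> real N"
        have limx: "(\<lambda>n. conv f (k n) x) \<longlonglongrightarrow> f x" if "f \<in> F" for f
          using elim x \<epsilon> that by (auto simp: k_def)
        define u where "u n y = ennreal (commutator_bound (\<lambda>y. \<chi> i. conv (\<lambda>y. b y $ i) (k n) y) (conv g (k n)) ?\<kappa> x y)" for n y
        have um: "u n \<in> borel_measurable lebesgue" for n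
        proof -
          have [measurable]: "conv (\<lambda>y. b y $ i) (k n) \<in> borel_measurable borel" for i
            using continuous_conv[OF L1_loc_component[OF b] k(1)] by (rule borel_measurable_continuous_onI)
          have [measurable]: "conv g (k n) \<in> borel_measurable borel"
            using continuous_conv[OF g(2) k(1)] by (rule borel_measurable_continuous_onI)
          have [measurable]: "?\<kappa> \<in> borel_measurable borel" "grad ?\<kappa> \<in> borel_measurable borel"
            using test_fun_continuous[OF \<kappa>(1)] test_fun_continuous_grad[OF \<kappa>(1)]
            by (auto intro: borel_measurable_continuous_onI)
          have "u n \<in> borel_measurable borel"
            unfolding u_def[abs_def] commutator_bound_def vec_lambda_beta by measurable
          then show ?thesis by (intro measurable_completion) simp
        qed
        have "(\<integral>\<^sup>+ y. ennreal (commutator_bound b g ?\<kappa> x y) \<partial>lebesgue) = (\<integral>\<^sup>+ y. liminf (\<lambda>n. u n y) \<partial>lebesgue)"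
        proof (rule nn_integral_cong_AE)
          show "AE y in lebesgue. ennreal (commutator_bound b g ?\<kappa> x y) = liminf (\<lambda>n. u n y)"
            using good
          proof eventually_elim
            case (elim y)
            have "(\<lambda>n. u n y) \<longlonglongrightarrow> ennreal (commutator_bound b g ?\<kappa> x y)"
            proof (cases "x - y \<in> supp ?\<kappa>")
              case True
              then have "norm (x - y) \<le> \<epsilon>" using \<kappa>(3) by auto
              then have "norm y \<le> real N + \<epsilon>" using x norm_triangle_ineq3[of x y] by linarith
              then have limy: "(\<lambda>n. conv f (k n) y) \<longlonglongrightarrow> f y" if "f \<in> F" for f
                using elim that by (auto simp: k_def)
              have "(\<lambda>n. conv (\<lambda>y. b y $ i) (k n) p) \<longlonglongrightarrow> b p $ i" if "p = x \<or> p = y" for i p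
                using that limx[of "\<lambda>y. b y $ i"] limy[of "\<lambda>y. b y $ i"] by (auto simp: F_def)
              moreover have "(\<lambda>n. conv g (k n) y) \<longlonglongrightarrow> g y" using limy by (simp add: F_def)
              ultimately show ?thesis
                unfolding u_def commutator_bound_def vec_lambda_beta by (intro tendsto_intros tendsto_ennrealI) auto
            qed (simp add: u_def commutator_bound_def supp_outside grad_outside_supp)
            then show ?case by (simp add: lim_imp_Liminf)
          qed
        qed
        also have "\<dots> \<le> liminf (\<lambda>n. \<integral>\<^sup>+ y. u n y \<partial>lebesgue)"
          by (rule nn_integral_liminf[OF um])
        also have "\<dots> \<le> liminf (\<lambda>n. C * ennreal (conv h (k n) x))"
          unfolding u_def by (intro Liminf_mono always_eventually allI smooth_le k)
        also have "\<dots> = C * ennreal (h x)"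
        proof (rule lim_imp_Liminf)
          show "(\<lambda>n. C * ennreal (conv h (k n) x)) \<longlonglongrightarrow> C * ennreal (h x)"
            using limx[of h] by (intro ennreal_tendsto_cmult tendsto_ennrealI) (auto simp: F_def C_def)
        qed simp
        \<comment> \<open>Possibly strict, since \<open>h x\<close> is 0 where \<open>H x\<close> is
          infinite.\<close>
        also have "\<dots> \<le> C * H x"
          by (intro mult_left_mono) (auto simp: h_def ennreal_enn2real_if)
        finally show "(\<integral>\<^sup>+ y. ennreal (commutator_bound b g ?\<kappa> x y) \<partial>lebesgue) \<le> C * H x" .
      qed
    qed
  qed
  then have "AE x in lebesgue. \<forall>N::nat. norm x \<le> real N \<longrightarrow>
    (\<integral>\<^sup>+ y. ennreal (commutator_bound b g ?\<kappa> x y) \<partial>lebesgue) \<le> C * H x"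
    unfolding AE_all_countable by blast
  then show ?thesis
    unfolding C_def[symmetric] H_def[symmetric]
    by eventually_elim (use real_arch_simple in blast)
qed

text \<open>The commutator subtracts \<open>advection\<close>, which itself carries a minus sign, so
  the divergence enters with a plus. Reflecting the kernel flips the sign of its gradient and
  combines both transport terms into the difference \<open>b x - b y\<close>, the source of all
  cancellation in the estimate.\<close>

lemma commutator_eq:
  fixes b :: "real^'n \<Rightarrow> real^'n"
  assumes u: "Linf u" and b: "L1_loc b" and g: "L1_loc g" and k: "test_fun (rescale \<theta> \<epsilon>)"
  defines "\<kappa> \<equiv> rescale \<theta> \<epsilon>"
  shows "integrable lebesgue (\<lambda>y. u y * ((b x - b y) \<bullet> grad \<kappa> (x - y) + \<kappa> (x - y) * g y))"
    "commutator b g u \<theta> \<epsilon> x = (LINT y|lebesgue. u y * ((b x - b y) \<bullet> grad \<kappa> (x - y) + \<kappa> (x - y) * g y))"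
proof -
  have \<kappa>: "test_fun \<kappa>" using k by (simp add: \<kappa>_def)
  note uL = Linf_imp_L1_loc[OF u]
  have i1: "integrable lebesgue (\<lambda>y. b x \<bullet> (u y *\<^sub>R grad \<kappa> (x - y)))"
    using test_fun_integrable_conv(2)[OF uL \<kappa>] by (intro integrable_inner_right) auto
  have i2: "integrable lebesgue (\<lambda>y. u y * g y * \<kappa> (x - y))"
    by (rule test_fun_integrable_conv(1)[OF L1_loc_mult_Linf[OF u g] \<kappa>])
  have i3: "integrable lebesgue (\<lambda>y. u y * (b y \<bullet> grad \<kappa> (x - y)))"
  proof -
    have "integrable lebesgue (\<lambda>y. (u y * b y $ i) * partial i \<kappa> (x - y))" for i
      by (rule test_fun_integrable_conv(1)[OF L1_loc_mult_Linf[OF u L1_loc_component[OF b]] test_fun_partial[OF \<kappa>]])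
    then have "integrable lebesgue (\<lambda>y. \<Sum>i\<in>UNIV. (u y * b y $ i) * partial i \<kappa> (x - y))"
      by (intro Bochner_Integration.integrable_sum) auto
    then show ?thesis by (simp add: inner_vec_def grad_def sum_distrib_left mult.assoc)
  qed
  have eq: "u y * ((b x - b y) \<bullet> grad \<kappa> (x - y) + \<kappa> (x - y) * g y) =
    b x \<bullet> (u y *\<^sub>R grad \<kappa> (x - y)) + (u y * g y * \<kappa> (x - y) - u y * (b y \<bullet> grad \<kappa> (x - y)))" for y
    by (simp add: inner_diff_left algebra_simps)
  show "integrable lebesgue (\<lambda>y. u y * ((b x - b y) \<bullet> grad \<kappa> (x - y) + \<kappa> (x - y) * g y))"
    unfolding eq using i1 i2 i3 by auto
  have "commutator b g u \<theta> \<epsilon> x = b x \<bullet> (LINT y|lebesgue. u y *\<^sub>R grad \<kappa> (x - y)) +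
    (LINT y|lebesgue. u y * (\<kappa> (x - y) * g y + b y \<bullet> grad (\<lambda>y. \<kappa> (x - y)) y))"
    unfolding commutator_def distr_conv_def advection_def \<kappa>_def[symmetric] grad_conv[OF uL \<kappa>] by simp
  also have "(LINT y|lebesgue. u y * (\<kappa> (x - y) * g y + b y \<bullet> grad (\<lambda>y. \<kappa> (x - y)) y)) =
    (LINT y|lebesgue. u y * g y * \<kappa> (x - y) - u y * (b y \<bullet> grad \<kappa> (x - y)))"
    unfolding grad_reflect[OF \<kappa>] by (simp add: algebra_simps)
  also have "b x \<bullet> (LINT y|lebesgue. u y *\<^sub>R grad \<kappa> (x - y)) = (LINT y|lebesgue. b x \<bullet> (u y *\<^sub>R grad \<kappa> (x - y)))"
    using test_fun_integrable_conv(2)[OF uL \<kappa>, of x] by (subst integral_inner_right) auto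
  finally show "commutator b g u \<theta> \<epsilon> x = (LINT y|lebesgue. u y * ((b x - b y) \<bullet> grad \<kappa> (x - y) + \<kappa> (x - y) * g y))"
    unfolding eq using i1 i2 i3 by simp
qed

text \<open>The kernel confines \<open>y\<close> to the ball of radius \<open>\<epsilon>\<close>
  around \<open>x\<close>, so only the essential supremum of \<open>u\<close> over this ball enters.
  This bound holds at every \<open>x\<close>; exceptional points arise only in the estimate of the
  remaining integral.\<close>

lemma abs_commutator_le:
  fixes b :: "real^'n \<Rightarrow> real^'n"
  assumes u: "Linf u" and b: "L1_loc b" and g: "L1_loc g"
    and \<theta>: "test_fun \<theta>" "\<And>x. 0 \<le> \<theta> x" "supp \<theta> \<subseteq> cball 0 1" and \<epsilon>: "\<epsilon> > 0"
  shows "ennreal \<bar>commutator b g u \<theta> \<epsilon> x\<bar> \<le> Linf_norm u (cball x \<epsilon>) *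
    (\<integral>\<^sup>+ y. ennreal (commutator_bound b g (rescale \<theta> \<epsilon>) x y) \<partial>lebesgue)"
proof -
  let ?\<kappa> = "rescale \<theta> \<epsilon>"
  have \<kappa>: "test_fun ?\<kappa>" "supp ?\<kappa> \<subseteq> cball 0 \<epsilon>" "\<And>z. 0 \<le> ?\<kappa> z"
    using test_fun_rescale[OF \<theta>(1) \<epsilon>] supp_rescale[OF \<theta>(3) \<epsilon>] rescale_nonneg[OF \<theta>(2) \<epsilon>] by auto
  have bm: "(\<lambda>y. b y $ i) \<in> borel_measurable lebesgue" for i
    by (rule L1_loc_measurable[OF L1_loc_component[OF b]])
  have gm: "g \<in> borel_measurable lebesgue" by (rule L1_loc_measurable[OF g])
  have \<kappa>m: "(\<lambda>y. ?\<kappa> (x - y)) \<in> borel_measurable lebesgue" "(\<lambda>y. norm (grad ?\<kappa> (x - y))) \<in> borel_measurable lebesgue"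
  proof -
    have [measurable]: "?\<kappa> \<in> borel_measurable borel" "grad ?\<kappa> \<in> borel_measurable borel"
      using test_fun_continuous[OF \<kappa>(1)] test_fun_continuous_grad[OF \<kappa>(1)]
      by (auto intro: borel_measurable_continuous_onI)
    show "(\<lambda>y. ?\<kappa> (x - y)) \<in> borel_measurable lebesgue" "(\<lambda>y. norm (grad ?\<kappa> (x - y))) \<in> borel_measurable lebesgue"
      by (auto intro!: measurable_completion)
  qed
  have cm: "(\<lambda>y. ennreal (commutator_bound b g ?\<kappa> x y)) \<in> borel_measurable lebesgue"
    unfolding commutator_bound_def
    by (intro measurable_compose[OF _ measurable_ennreal] borel_measurable_add borel_measurable_times
        borel_measurable_sum borel_measurable_abs borel_measurable_diff bm gm \<kappa>m borel_measurable_const)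
  have pt: "\<bar>u y * ((b x - b y) \<bullet> grad ?\<kappa> (x - y) + ?\<kappa> (x - y) * g y)\<bar> \<le> \<bar>u y\<bar> * commutator_bound b g ?\<kappa> x y" for y
  proof -
    have "\<bar>(b x - b y) \<bullet> grad ?\<kappa> (x - y)\<bar> \<le> norm (b x - b y) * norm (grad ?\<kappa> (x - y))"
      by (rule Cauchy_Schwarz_ineq2)
    also have "\<dots> \<le> (\<Sum>i\<in>UNIV. \<bar>b x $ i - b y $ i\<bar>) * norm (grad ?\<kappa> (x - y))"
      using norm_le_l1_cart[of "b x - b y"] by (intro mult_right_mono) auto
    finally have 1: "\<bar>(b x - b y) \<bullet> grad ?\<kappa> (x - y)\<bar> \<le> (\<Sum>i\<in>UNIV. \<bar>b x $ i - b y $ i\<bar>) * norm (grad ?\<kappa> (x - y))" .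
    have 2: "\<bar>?\<kappa> (x - y) * g y\<bar> = ?\<kappa> (x - y) * \<bar>g y\<bar>" using \<kappa>(3) by (simp add: abs_mult)
    have "\<bar>(b x - b y) \<bullet> grad ?\<kappa> (x - y) + ?\<kappa> (x - y) * g y\<bar> \<le> commutator_bound b g ?\<kappa> x y"
      unfolding commutator_bound_def using 1 2 by linarith
    then show ?thesis unfolding abs_mult by (intro mult_left_mono) auto
  qed
  have "ennreal \<bar>commutator b g u \<theta> \<epsilon> x\<bar> \<le>
    (\<integral>\<^sup>+ y. ennreal (norm (u y * ((b x - b y) \<bullet> grad ?\<kappa> (x - y) + ?\<kappa> (x - y) * g y))) \<partial>lebesgue)"
    using integral_norm_bound_ennreal[OF commutator_eq(1)[OF u b g \<kappa>(1), of x]]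
    unfolding commutator_eq(2)[OF u b g \<kappa>(1)] by simp
  also have "\<dots> \<le> (\<integral>\<^sup>+ y. Linf_norm u (cball x \<epsilon>) * ennreal (commutator_bound b g ?\<kappa> x y) \<partial>lebesgue)"
  proof (rule nn_integral_mono_AE)
    have "AE y in lebesgue. y \<in> cball x \<epsilon> \<longrightarrow> ennreal \<bar>u y\<bar> \<le> Linf_norm u (cball x \<epsilon>)"
      by (rule AE_le_Linf_norm) auto
    then show "AE y in lebesgue. ennreal (norm (u y * ((b x - b y) \<bullet> grad ?\<kappa> (x - y) + ?\<kappa> (x - y) * g y))) \<le>
      Linf_norm u (cball x \<epsilon>) * ennreal (commutator_bound b g ?\<kappa> x y)"
    proof eventually_elim
      case (elim y)
      have "ennreal (norm (u y * ((b x - b y) \<bullet> grad ?\<kappa> (x - y) + ?\<kappa> (x - y) * g y))) \<le>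
        ennreal (\<bar>u y\<bar> * commutator_bound b g ?\<kappa> x y)"
        using pt by (intro ennreal_leI) simp
      also have "\<dots> = ennreal \<bar>u y\<bar> * ennreal (commutator_bound b g ?\<kappa> x y)"
        by (rule ennreal_mult') simp
      also have "\<dots> \<le> Linf_norm u (cball x \<epsilon>) * ennreal (commutator_bound b g ?\<kappa> x y)"
      proof (cases "y \<in> cball x \<epsilon>")
        case True
        then show ?thesis using elim by (intro mult_right_mono) auto
      next
        case False
        then have "x - y \<notin> cball 0 \<epsilon>" by (simp add: dist_norm norm_minus_commute)
        then have "x - y \<notin> supp ?\<kappa>" using \<kappa>(2) by blast
        then show ?thesis by (simp add: commutator_bound_def supp_outside grad_outside_supp)
      qed
      finally show ?case .
    qed
  qed
  also have "\<dots> = Linf_norm u (cball x \<epsilon>) * (\<integral>\<^sup>+ y. ennreal (commutator_bound b g ?\<kappa> x y) \<partial>lebesgue)"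
    by (rule nn_integral_cmult[OF cm])
  finally show ?thesis .
qed

section \<open>From the pointwise to the integrated inequality\<close>

lemma Linf_norm_mono:
  assumes u: "u \<in> borel_measurable lebesgue" and A: "A \<subseteq> B" "A \<in> sets lebesgue" "B \<in> sets lebesgue"
  shows "Linf_norm u A \<le> Linf_norm u B"
  unfolding Linf_norm_def[of u A]
proof (rule esssup_I)
  show "(\<lambda>x. ennreal \<bar>u x\<bar>) \<in> borel_measurable (restrict_space lebesgue A)"
    by (rule measurable_restrict_space1) (use u in measurable)
  show "AE x in restrict_space lebesgue A. ennreal \<bar>u x\<bar> \<le> Linf_norm u B"
    using AE_le_Linf_norm[OF A(3), of u] A by (subst AE_restrict_space_iff) auto
qed

text \<open>Tonelli leaves the kernel at \<open>x - y\<close>, whereas \<open>nn_conv\<close>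
  evaluates it at \<open>y - x\<close>; evenness identifies the two.\<close>

lemma nn_integral_measure_conv_adjoint:
  fixes \<mu> :: "(real^'n) measure"
  assumes \<mu>: "sigma_finite_measure \<mu>" "sets \<mu> = sets borel"
    and \<rho>[measurable]: "\<rho> \<in> borel_measurable borel" and \<rho>0: "\<And>x. 0 \<le> \<rho> x" and ev: "\<And>x. \<rho> (- x) = \<rho> x"
    and \<phi>: "\<phi> \<in> borel_measurable lebesgue"
  shows "(\<integral>\<^sup>+ x. ennreal \<bar>\<phi> x\<bar> * measure_conv \<mu> \<rho> x \<partial>lebesgue) = (\<integral>\<^sup>+ y. nn_conv (\<lambda>x. \<bar>\<phi> x\<bar>) \<rho> y \<partial>\<mu>)"
proof -
  interpret m: sigma_finite_measure \<mu> by fact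
  interpret p: pair_sigma_finite \<mu> "lborel :: (real^'n) measure" ..
  note [measurable_cong] = \<mu>(2)
  \<comment> \<open>Tonelli is applied to a Borel representative. Changing \<open>\<phi>\<close> on
    a Lebesgue null set alters \<open>nn_conv\<close> at no point, so the replacement is harmless
    even if \<open>\<mu>\<close> charges null sets.\<close>
  obtain \<psi> where \<psi>[measurable]: "\<psi> \<in> borel_measurable borel" and "AE x in lborel. \<phi> x = \<psi> x"
    using completion_ex_borel_measurable_real[OF \<phi>] by auto
  then have ae: "AE x in lebesgue. \<phi> x = \<psi> x" by (intro AE_completion)
  have "(\<integral>\<^sup>+ x. ennreal \<bar>\<phi> x\<bar> * measure_conv \<mu> \<rho> x \<partial>lebesgue) = (\<integral>\<^sup>+ x. ennreal \<bar>\<psi> x\<bar> * measure_conv \<mu> \<rho> x \<partial>lebesgue)"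
    by (rule nn_integral_cong_AE) (use ae in \<open>eventually_elim, simp\<close>)
  also have "\<dots> = (\<integral>\<^sup>+ x. ennreal \<bar>\<psi> x\<bar> * measure_conv \<mu> \<rho> x \<partial>lborel)" by (rule nn_integral_completion)
  also have "\<dots> = (\<integral>\<^sup>+ x. \<integral>\<^sup>+ y. ennreal \<bar>\<psi> x\<bar> * ennreal (\<rho> (x - y)) \<partial>\<mu> \<partial>lborel)"
    unfolding measure_conv_def by (intro nn_integral_cong nn_integral_cmult[symmetric]) measurable
  also have "\<dots> = (\<integral>\<^sup>+ y. \<integral>\<^sup>+ x. ennreal \<bar>\<psi> x\<bar> * ennreal (\<rho> (x - y)) \<partial>lborel \<partial>\<mu>)"
    by (rule p.Fubini') measurable
  also have "\<dots> = (\<integral>\<^sup>+ y. nn_conv (\<lambda>x. \<bar>\<phi> x\<bar>) \<rho> y \<partial>\<mu>)"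
  proof (rule nn_integral_cong)
    fix y
    have "nn_conv (\<lambda>x. \<bar>\<phi> x\<bar>) \<rho> y = (\<integral>\<^sup>+ x. ennreal (\<bar>\<psi> x\<bar> * \<rho> (y - x)) \<partial>lebesgue)"
      unfolding nn_conv_def by (rule nn_integral_cong_AE) (use ae in \<open>eventually_elim, simp\<close>)
    also have "\<dots> = (\<integral>\<^sup>+ x. ennreal (\<bar>\<psi> x\<bar> * \<rho> (y - x)) \<partial>lborel)" by (rule nn_integral_completion)
    also have "\<dots> = (\<integral>\<^sup>+ x. ennreal \<bar>\<psi> x\<bar> * ennreal (\<rho> (x - y)) \<partial>lborel)"
    proof (rule nn_integral_cong)
      fix x
      have "\<rho> (y - x) = \<rho> (x - y)" using ev[of "x - y"] by simp
      then show "ennreal (\<bar>\<psi> x\<bar> * \<rho> (y - x)) = ennreal \<bar>\<psi> x\<bar> * ennreal (\<rho> (x - y))"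
        by (simp add: ennreal_mult')
    qed
    finally show "(\<integral>\<^sup>+ x. ennreal \<bar>\<psi> x\<bar> * ennreal (\<rho> (x - y)) \<partial>lborel) = nn_conv (\<lambda>x. \<bar>\<phi> x\<bar>) \<rho> y" ..
  qed
  finally show ?thesis .
qed

theorem proposition8:
  fixes \<theta> :: "real^'n \<Rightarrow> real"
  assumes "test_fun \<theta>" and "conv_kernel \<theta>" and "even_fun \<theta>" and "supp \<theta> \<subseteq> cball 0 1"
  shows "\<exists>(\<rho> :: real^'n \<Rightarrow> real) (C :: real).
    conv_kernel \<rho> \<and> even_fun \<rho> \<and> supp \<rho> \<subseteq> cball 0 1 \<and> 0 \<le> C \<and>
    (\<forall>(u :: real^'n \<Rightarrow> real) (b :: real^'n \<Rightarrow> real^'n) (divb :: real^'n \<Rightarrow> real)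
       (Db :: (real^'n) set \<Rightarrow> real^'n^'n).
      Linf u \<longrightarrow> BV_loc b \<longrightarrow> distr_derivative b Db \<longrightarrow> L1_loc divb \<longrightarrow> distr_div b divb \<longrightarrow>
      (\<forall>\<epsilon>>0.
        (\<forall>\<phi> \<in> borel_measurable lebesgue.
          (\<integral>\<^sup>+ x. ennreal \<bar>commutator b divb u \<theta> \<epsilon> x * \<phi> x\<bar> \<partial>lebesgue)
            \<le> ennreal C * Linf_norm u (closed_nbhd (supp \<phi>) \<epsilon>) *
               (\<integral>\<^sup>+ x. nn_conv (\<lambda>y. \<bar>\<phi> y\<bar>) (rescale \<rho> \<epsilon>) x \<partial>variation_measure Db)) \<and>
        (AE x in lebesgue.
          ennreal \<bar>commutator b divb u \<theta> \<epsilon> x\<bar>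
            \<le> ennreal C * Linf_norm u (cball x \<epsilon>) *
               measure_conv (variation_measure Db) (rescale \<rho> \<epsilon>) x)))"
proof -
  obtain M where M: "0 \<le> M" "\<And>z. \<theta> z \<le> M" "\<And>z. norm z * norm (grad \<theta> z) \<le> M"
    using test_fun_kernel_bounds[OF assms(1,4)] by blast
  \<comment> \<open>Only \<open>\<theta>\<close> and the dimension enter, so the constant is fixed
    before \<open>u\<close>, \<open>b\<close> and \<open>\<epsilon>\<close>.\<close>
  define C where "C = 2 * ball_vol TYPE('n) * (real CARD('n))\<^sup>2 * M"
  have C: "0 \<le> C" using M(1) ball_vol(1)[where 'n='n] by (simp add: C_def)
  have \<theta>0: "0 \<le> \<theta> x" for x using assms(2) by (simp add: conv_kernel_def)
  show ?thesis
  proof (intro exI[of _ cone_kernel] exI[of _ C] conjI allI impI ballI)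
    show "conv_kernel (cone_kernel :: real^'n \<Rightarrow> real)" by (rule conv_kernel_cone_kernel)
    show "even_fun (cone_kernel :: real^'n \<Rightarrow> real)" by (rule even_fun_cone_kernel)
    show "supp (cone_kernel :: real^'n \<Rightarrow> real) \<subseteq> cball 0 1" by (rule supp_cone_kernel)
    show "0 \<le> C" by (rule C)
  next
    fix u :: "real^'n \<Rightarrow> real" and b :: "real^'n \<Rightarrow> real^'n" and g :: "real^'n \<Rightarrow> real"
      and D :: "(real^'n) set \<Rightarrow> real^'n^'n" and \<epsilon> :: real
    assume u: "Linf u" and "BV_loc b" and D: "distr_derivative b D" and g: "L1_loc g" "distr_div b g"
      and \<epsilon>: "0 < \<epsilon>"
    then have b: "L1_loc b" by (simp add: BV_loc_def)
    let ?\<mu> = "variation_measure D" and ?\<rho> = "rescale (cone_kernel :: real^'n \<Rightarrow> real) \<epsilon>"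
    have rD: "vector_radon_measure D" using D by (simp add: distr_derivative_def)
    note sf = sigma_finite_variation_measure[OF rD]
    have pointwise: "AE x in lebesgue. ennreal \<bar>commutator b g u \<theta> \<epsilon> x\<bar>
      \<le> ennreal C * Linf_norm u (cball x \<epsilon>) * measure_conv ?\<mu> ?\<rho> x"
      using AE_nn_integral_commutator_bound_le[OF b D g(2,1) assms(1,2,4) M \<epsilon>]
    proof eventually_elim
      case (elim x)
      have "ennreal \<bar>commutator b g u \<theta> \<epsilon> x\<bar> \<le> Linf_norm u (cball x \<epsilon>) *
        (\<integral>\<^sup>+ y. ennreal (commutator_bound b g (rescale \<theta> \<epsilon>) x y) \<partial>lebesgue)"
        by (rule abs_commutator_le[OF u b g(1) assms(1) \<theta>0 assms(4) \<epsilon>])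
      also have "\<dots> \<le> Linf_norm u (cball x \<epsilon>) * (ennreal C * measure_conv ?\<mu> ?\<rho> x)"
        using elim unfolding C_def by (intro mult_left_mono) auto
      finally show ?case by (simp add: ac_simps)
    qed
    then show "AE x in lebesgue. ennreal \<bar>commutator b g u \<theta> \<epsilon> x\<bar>
      \<le> ennreal C * Linf_norm u (cball x \<epsilon>) * measure_conv ?\<mu> ?\<rho> x" .
    fix \<phi> :: "real^'n \<Rightarrow> real" assume \<phi>: "\<phi> \<in> borel_measurable lebesgue"
    let ?S = "closed_nbhd (supp \<phi>) \<epsilon>"
    have um: "u \<in> borel_measurable lebesgue" using u by (simp add: Linf_def)
    have "closed ?S"
    proof (cases "supp \<phi> = {}")
      case False
      then have "?S = {x. infdist x (supp \<phi>) \<le> \<epsilon>}" by (simp add: closed_nbhd_def)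
      then show ?thesis by (simp add: closed_Collect_le continuous_on_infdist)
    qed (simp add: closed_nbhd_def)
    then have S: "?S \<in> sets lebesgue" by (simp add: borel_closed)
    \<comment> \<open>Where \<open>\<phi>\<close> is nonzero, the ball of the pointwise bound lies
      in the neighbourhood, so the norm over it can be replaced by one independent of
      \<open>x\<close> and taken out of the integral. Elsewhere the integrand on the left is
      0.\<close>
    have ball_sub: "cball x \<epsilon> \<subseteq> ?S" if "\<phi> x \<noteq> 0" for x
    proof
      fix y assume y: "y \<in> cball x \<epsilon>"
      have x: "x \<in> supp \<phi>" using that supp_outside by blast
      then have "infdist y (supp \<phi>) \<le> dist y x" by (rule infdist_le)
      then show "y \<in> ?S" using x y by (auto simp: closed_nbhd_def dist_commute)
    qed
    have [measurable]: "measure_conv ?\<mu> ?\<rho> \<in> borel_measurable borel"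
      by (rule borel_measurable_measure_conv[OF sf]) auto
    have Hm: "(\<lambda>x. ennreal \<bar>\<phi> x\<bar> * measure_conv ?\<mu> ?\<rho> x) \<in> borel_measurable lebesgue"
    proof -
      have "measure_conv ?\<mu> ?\<rho> \<in> borel_measurable lebesgue" by (intro measurable_completion) simp
      then show ?thesis using \<phi> by measurable
    qed
    have "(\<integral>\<^sup>+ x. ennreal \<bar>commutator b g u \<theta> \<epsilon> x * \<phi> x\<bar> \<partial>lebesgue) \<le>
      (\<integral>\<^sup>+ x. (ennreal C * Linf_norm u ?S) * (ennreal \<bar>\<phi> x\<bar> * measure_conv ?\<mu> ?\<rho> x) \<partial>lebesgue)"
    proof (rule nn_integral_mono_AE)
      show "AE x in lebesgue. ennreal \<bar>commutator b g u \<theta> \<epsilon> x * \<phi> x\<bar> \<le>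
        (ennreal C * Linf_norm u ?S) * (ennreal \<bar>\<phi> x\<bar> * measure_conv ?\<mu> ?\<rho> x)"
        using pointwise
      proof eventually_elim
        case (elim x)
        show ?case
        proof (cases "\<phi> x = 0")
          case False
          have "ennreal \<bar>commutator b g u \<theta> \<epsilon> x * \<phi> x\<bar> = ennreal \<bar>commutator b g u \<theta> \<epsilon> x\<bar> * ennreal \<bar>\<phi> x\<bar>"
            by (simp add: abs_mult ennreal_mult)
          also have "\<dots> \<le> (ennreal C * Linf_norm u (cball x \<epsilon>) * measure_conv ?\<mu> ?\<rho> x) * ennreal \<bar>\<phi> x\<bar>"
            by (intro mult_right_mono elim) auto
          also have "\<dots> \<le> (ennreal C * Linf_norm u ?S * measure_conv ?\<mu> ?\<rho> x) * ennreal \<bar>\<phi> x\<bar>"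
            by (intro mult_right_mono mult_left_mono Linf_norm_mono[OF um ball_sub[OF False] _ S]) auto
          finally show ?thesis by (simp add: ac_simps)
        qed simp
      qed
    qed
    also have "\<dots> = ennreal C * Linf_norm u ?S * (\<integral>\<^sup>+ x. ennreal \<bar>\<phi> x\<bar> * measure_conv ?\<mu> ?\<rho> x \<partial>lebesgue)"
      by (rule nn_integral_cmult[OF Hm])
    also have "(\<integral>\<^sup>+ x. ennreal \<bar>\<phi> x\<bar> * measure_conv ?\<mu> ?\<rho> x \<partial>lebesgue) =
      (\<integral>\<^sup>+ x. nn_conv (\<lambda>y. \<bar>\<phi> y\<bar>) ?\<rho> x \<partial>?\<mu>)"
    proof (rule nn_integral_measure_conv_adjoint[OF sf])
      show "?\<rho> (- x) = ?\<rho> x" for x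
      proof -
        have "cone_kernel (- w) = cone_kernel w" for w :: "real^'n"
          using even_fun_cone_kernel unfolding even_fun_def by blast
        then show ?thesis by (simp add: rescale_def)
      qed
    qed (auto intro: rescale_nonneg cone_kernel_nonneg \<epsilon> \<phi>)
    finally show "(\<integral>\<^sup>+ x. ennreal \<bar>commutator b g u \<theta> \<epsilon> x * \<phi> x\<bar> \<partial>lebesgue)
      \<le> ennreal C * Linf_norm u ?S * (\<integral>\<^sup>+ x. nn_conv (\<lambda>y. \<bar>\<phi> y\<bar>) ?\<rho> x \<partial>?\<mu>)" .
  qed
qed



end
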